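(* Let $(\rho,\overline{J},\overline{E},\overline{B})$ be quantities in the rest frame $S$ such that: $(\rho,\overline{J})$ satisfies the continuity equation $\frac{\partial\rho}{\partial t}+\nabla\cdot\overline{J}=0$; $\square^{2}(\overline{J})=\overline{0}$ and $\nabla\times\overline{J}=\overline{0}$; $(\rho,\overline{J},\overline{E},\overline{B})$ satisfy Maxwell's equations; $\square^{2}(\overline{E})=\overline{0}$; and $\overline{B}=\overline{0}$. Then in any inertial frame $S'$ moving with velocity vector $\overline{v}$ relative to $S$, if $(\rho',\overline{J}')$ are the transformed charge distribution and current, there exists a pair $(\overline{E}',\overline{B}')$ such that $(\rho',\overline{J}',\overline{E}',\overline{B}')$ satisfy Maxwell's equations in $S'$, and $\square'^{2}(\overline{E}')=\overline{0}$ with $\overline{B}'=\overline{0}$ in $S'$. In particular, the Poynting vector $\overline{E}'\times\overline{B}'$ is $\overline{0}$. Moreover, the pair $(\rho',\overline{J}')$ still satisfy the wave equations $\square'^{2}(\rho')=0$ and $\square'^{2}(\overline{J}')=\overline{0}$, with $\nabla'\times\overline{J}'=\overline{0}$.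
   Context: All quantities are smooth functions of space and time, with $\rho$ scalar valued and $\overline{J},\overline{E},\overline{B}$ vector valued. $\epsilon_{0},\mu_{0}>0$ are constants, $c=1/\sqrt{\mu_{0}\epsilon_{0}}$, and $\square^{2}=\nabla^{2}-\mu_{0}\epsilon_{0}\frac{\partial^{2}}{\partial t^{2}}$, acting componentwise on vector fields. Maxwell's equations for $(\rho,\overline{J},\overline{E},\overline{B})$ are: $\nabla\cdot\overline{E}=\rho/\epsilon_{0}$, $\nabla\cdot\overline{B}=0$, $\nabla\times\overline{E}=-\frac{\partial\overline{B}}{\partial t}$, $\nabla\times\overline{B}=\mu_{0}\overline{J}+\mu_{0}\epsilon_{0}\frac{\partial\overline{E}}{\partial t}$. The frame $S'$ moving with velocity $\overline{v}$, $v=|\overline{v}|<c$, has coordinates $(\overline{x}',t')$ given by the Lorentz transformation $\overline{x}'_{||}=\gamma(\overline{x}_{||}-\overline{v}t)$, $\overline{x}'_{\perp}=\overline{x}_{\perp}$, $t'=\gamma(t-\overline{v}\cdot\overline{x}/c^{2})$, with $\gamma=(1-v^{2}/c^{2})^{-1/2}$, where $||$ and $\perp$ denote the components parallel and perpendicular to $\overline{v}$. The transformed charge and current are $\rho'=\gamma(\rho-vJ_{||}/c^{2})$ and $\overline{J}'=\gamma(\overline{J}_{||}-\rho\overline{v})+\overline{J}_{\perp}$, where $vJ_{||}=\overline{v}\cdot\overline{J}$, regarded as functions of $(\overline{x}',t')$. $\nabla'$, $\square'^{2}$ and Maxwell's equations in $S'$ are the same operators and equations with respect to the coordinates $(\overline{x}',t')$.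 *)

theory Defs
  imports "HOL-Analysis.Analysis"
begin

section \<open>Fields on space-time\<close>

type_synonym spacetime = "(real^3) \<times> real"
type_synonym scalar_field = "spacetime \<Rightarrow> real"
type_synonym vector_field = "spacetime \<Rightarrow> real^3"

text \<open>All directional derivatives up to order \<open>k\<close> exist as Frechet derivatives and are continuous;
  this is \<open>C\<^sup>k\<close> on a finite-dimensional domain.\<close>

primrec Ck :: "nat \<Rightarrow> ('a::real_normed_vector \<Rightarrow> 'b::real_normed_vector) \<Rightarrow> bool" where
  "Ck 0 f \<longleftrightarrow> continuous_on UNIV f"
| "Ck (Suc k) f \<longleftrightarrow> (\<forall>x. f differentiable (at x)) \<and>
     (\<forall>u. Ck k (\<lambda>x. frechet_derivative f (at x) u))"

definition smooth :: "('a::real_normed_vector \<Rightarrow> 'b::real_normed_vector) \<Rightarrow> bool" where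
  "smooth f \<longleftrightarrow> (\<forall>k. Ck k f)"

definition dt :: "(spacetime \<Rightarrow> 'a::real_normed_vector) \<Rightarrow> spacetime \<Rightarrow> 'a" where
  "dt F = (\<lambda>(x, t). vector_derivative (\<lambda>s. F (x, s)) (at t))"

definition dx :: "3 \<Rightarrow> (spacetime \<Rightarrow> 'a::real_normed_vector) \<Rightarrow> spacetime \<Rightarrow> 'a" where
  "dx i F = (\<lambda>(x, t). vector_derivative (\<lambda>s. F (x + s *\<^sub>R axis i 1, t)) (at 0))"

definition divergence :: "vector_field \<Rightarrow> scalar_field" where
  "divergence F p = (\<Sum>i\<in>UNIV. dx i (\<lambda>q. F q $ i) p)"

definition curl :: "vector_field \<Rightarrow> vector_field" where
  "curl F p = vector
     [dx 2 (\<lambda>q. F q $ 3) p - dx 3 (\<lambda>q. F q $ 2) p,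
      dx 3 (\<lambda>q. F q $ 1) p - dx 1 (\<lambda>q. F q $ 3) p,
      dx 1 (\<lambda>q. F q $ 2) p - dx 2 (\<lambda>q. F q $ 1) p]"

definition laplacian :: "scalar_field \<Rightarrow> scalar_field" where
  "laplacian f p = (\<Sum>i\<in>UNIV. dx i (dx i f) p)"

definition dalembertian :: "real \<Rightarrow> real \<Rightarrow> scalar_field \<Rightarrow> scalar_field" where
  "dalembertian \<epsilon>\<^sub>0 \<mu>\<^sub>0 f p = laplacian f p - \<mu>\<^sub>0 * \<epsilon>\<^sub>0 * dt (dt f) p"

definition dalembertian_vec :: "real \<Rightarrow> real \<Rightarrow> vector_field \<Rightarrow> vector_field" where
  "dalembertian_vec \<epsilon>\<^sub>0 \<mu>\<^sub>0 F p = (\<chi> i. dalembertian \<epsilon>\<^sub>0 \<mu>\<^sub>0 (\<lambda>q. F q $ i) p)"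

definition continuity_equation :: "scalar_field \<Rightarrow> vector_field \<Rightarrow> bool" where
  "continuity_equation \<rho> J \<longleftrightarrow> (\<forall>p. dt \<rho> p + divergence J p = 0)"

definition maxwell ::
  "real \<Rightarrow> real \<Rightarrow> scalar_field \<Rightarrow> vector_field \<Rightarrow> vector_field \<Rightarrow> vector_field \<Rightarrow> bool" where
  "maxwell \<epsilon>\<^sub>0 \<mu>\<^sub>0 \<rho> J E B \<longleftrightarrow>
     (\<forall>p. divergence E p = \<rho> p / \<epsilon>\<^sub>0) \<and>
     (\<forall>p. divergence B p = 0) \<and>
     (\<forall>p. curl E p = - dt B p) \<and>
     (\<forall>p. curl B p = \<mu>\<^sub>0 *\<^sub>R J p + (\<mu>\<^sub>0 * \<epsilon>\<^sub>0) *\<^sub>R dt E p)"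


section \<open>Change of inertial frame\<close>

definition light_speed :: "real \<Rightarrow> real \<Rightarrow> real" where
  "light_speed \<epsilon>\<^sub>0 \<mu>\<^sub>0 = 1 / sqrt (\<mu>\<^sub>0 * \<epsilon>\<^sub>0)"

definition lorentz_factor :: "real \<Rightarrow> real^3 \<Rightarrow> real" where
  "lorentz_factor c v = 1 / sqrt (1 - (norm v)\<^sup>2 / c\<^sup>2)"

text \<open>For \<open>v = 0\<close> division by zero gives \<open>par 0 x = 0\<close> and \<open>perp 0 x = x\<close>, so that the Lorentz
  transformation below is then the identity.\<close>

definition par :: "real^3 \<Rightarrow> real^3 \<Rightarrow> real^3" where
  "par v x = ((v \<bullet> x) / (v \<bullet> v)) *\<^sub>R v"

definition perp :: "real^3 \<Rightarrow> real^3 \<Rightarrow> real^3" where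
  "perp v x = x - par v x"

definition lorentz :: "real \<Rightarrow> real^3 \<Rightarrow> spacetime \<Rightarrow> spacetime" where
  "lorentz c v = (\<lambda>(x, t).
     (lorentz_factor c v *\<^sub>R (par v x - t *\<^sub>R v) + perp v x,
      lorentz_factor c v * (t - (v \<bullet> x) / c\<^sup>2)))"

text \<open>The transformed sources are functions of the coordinates \<open>(x', t')\<close> of the moving frame,
  hence the inverse Lorentz transformation; it exists by \<open>bij_lorentz\<close> below.\<close>

definition transformed_charge ::
  "real \<Rightarrow> real^3 \<Rightarrow> scalar_field \<Rightarrow> vector_field \<Rightarrow> scalar_field" where
  "transformed_charge c v \<rho> J = (\<lambda>q. let p = inv (lorentz c v) q in
     lorentz_factor c v * (\<rho> p - (v \<bullet> J p) / c\<^sup>2))"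

definition transformed_current ::
  "real \<Rightarrow> real^3 \<Rightarrow> scalar_field \<Rightarrow> vector_field \<Rightarrow> vector_field" where
  "transformed_current c v \<rho> J = (\<lambda>q. let p = inv (lorentz c v) q in
     lorentz_factor c v *\<^sub>R (par v (J p) - \<rho> p *\<^sub>R v) + perp v (J p))"

lemma lorentz_neg_lorentz:
  assumes "norm v < c"
  shows "lorentz c (- v) (lorentz c v p) = p"
proof (cases p)
  case (Pair x t)
  define g where "g = lorentz_factor c v"
  have c: "c > 0" using assms norm_ge_zero[of v] by linarith
  have "(norm v)\<^sup>2 < c\<^sup>2"
    using assms by (intro power_strict_mono) auto
  then have pos: "1 - (norm v)\<^sup>2 / c\<^sup>2 > 0" using c by simp
  then have "g\<^sup>2 = 1 / (1 - (norm v)\<^sup>2 / c\<^sup>2)"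
    unfolding g_def lorentz_factor_def power_divide by simp
  with pos have g: "g\<^sup>2 * (1 - (v \<bullet> v) / c\<^sup>2) = 1"
    unfolding dot_square_norm by (metis less_irrefl nonzero_divide_eq_eq)
  have gneg: "lorentz_factor c (- v) = g" by (simp add: g_def lorentz_factor_def)
  have pneg: "par (- v) y = par v y" "perp (- v) y = perp v y" for y
    by (simp_all add: par_def perp_def)
  have par_v: "(v \<bullet> x) *\<^sub>R v = (v \<bullet> v) *\<^sub>R par v x"
    by (cases "v = 0") (simp_all add: par_def)
  have inner_par: "v \<bullet> par v y = v \<bullet> y" for y
    by (cases "v = 0") (simp_all add: par_def)
  have inner_perp: "v \<bullet> perp v y = 0" for y
    by (simp add: perp_def inner_par inner_diff_right)
  have par_lin: "par v (y + z) = par v y + par v z" "par v (a *\<^sub>R y) = a *\<^sub>R par v y"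
      "par v (y - z) = par v y - par v z" "par v v = v" "par v (par v y) = par v y"
      "par v (perp v y) = 0" for y z a
    by (cases "v = 0"; simp add: par_def perp_def inner_add_right inner_diff_right
        add_divide_distrib diff_divide_distrib scaleR_add_left scaleR_diff_left)+
  define x' where "x' = g *\<^sub>R (par v x - t *\<^sub>R v) + perp v x"
  define t' where "t' = g * (t - (v \<bullet> x) / c\<^sup>2)"
  have L: "lorentz c v p = (x', t')" by (simp add: lorentz_def Pair x'_def t'_def g_def)
  have px': "par v x' = g *\<^sub>R (par v x - t *\<^sub>R v)"
    by (simp add: x'_def par_lin)
  have vx': "v \<bullet> x' = g * ((v \<bullet> x) - t * (v \<bullet> v))"
    by (simp add: x'_def inner_add_right inner_diff_right inner_par inner_perp)
  have "perp v x' = perp v x" unfolding perp_def[of v x'] px' by (simp add: x'_def)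
  then have "g *\<^sub>R (par v x' + t' *\<^sub>R v) + perp v x'
      = (g\<^sup>2) *\<^sub>R (par v x - (1 / c\<^sup>2) *\<^sub>R ((v \<bullet> x) *\<^sub>R v)) + perp v x"
    by (simp add: px' t'_def power2_eq_square algebra_simps)
  also have "\<dots> = (g\<^sup>2 * (1 - (v \<bullet> v) / c\<^sup>2)) *\<^sub>R par v x + perp v x"
    unfolding par_v by (simp add: algebra_simps)
  also have "\<dots> = x" using g by (simp add: perp_def)
  finally have 1: "g *\<^sub>R (par v x' + t' *\<^sub>R v) + perp v x' = x" .
  have "g * (t' + (v \<bullet> x') / c\<^sup>2) = g\<^sup>2 * (1 - (v \<bullet> v) / c\<^sup>2) * t"
    unfolding vx' t'_def using c by (simp add: field_simps power2_eq_square)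
  then have 2: "g * (t' + (v \<bullet> x') / c\<^sup>2) = t" using g by simp
  show ?thesis unfolding L using 1 2 by (simp add: lorentz_def gneg pneg Pair)
qed

lemma bij_lorentz:
  assumes "norm v < c"
  shows "bij (lorentz c v)" and "inv (lorentz c v) = lorentz c (- v)"
proof -
  have 1: "lorentz c (- v) (lorentz c v p) = p" for p
    using lorentz_neg_lorentz assms by blast
  have 2: "lorentz c v (lorentz c (- v) p) = p" for p
    using lorentz_neg_lorentz[of "- v" c p] assms by simp
  show "bij (lorentz c v)"
    by (rule o_bij[where g = "lorentz c (- v)"]) (auto simp: fun_eq_iff 1 2)
  show "inv (lorentz c v) = lorentz c (- v)"
    by (rule inv_equality) (auto simp: 1 2)
qed

end

theory Submission
  imports Defs
begin

text \<open>With \<open>B' = 0\<close>, Maxwell's equations in the moving frame say that \<open>curl E' = 0\<close>,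
  \<open>div E' = \<rho>' / \<epsilon>\<close> and \<open>\<epsilon> \<partial>E'/\<partial>t' = - J'\<close>. The field \<open>E'\<close> is not the Lorentz transform of \<open>(E, 0)\<close>,
  which in general has a magnetic part; it is built from the transformed sources alone.

  In the rest frame, eliminating \<open>E\<close> leaves a first-order system for the sources: the continuity
  equation, \<open>curl J = 0\<close>, and \<open>grad \<rho> + \<partial>J/\<partial>t / c\<^sup>2 = 0\<close>. It says that the one-form
  \<open>J \<bullet> dx - c\<^sup>2 \<rho> dt\<close> on space-time is closed and has zero Minkowski divergence. The transformed
  sources are the components of the pullback of this form along the inverse Lorentz
  transformation, so the system holds again in the moving frame (\<open>irrotational_sources_lorentz\<close>).
  Differentiating it once more gives the wave equations for \<open>\<rho>'\<close> and \<open>J'\<close>.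

  Given such sources, put
  \<open>E'(x, t) = grad h (x) - (1/\<epsilon>) \<integral>\<^sub>0\<^sup>t J'(x, s) ds\<close>, where \<open>h\<close> solves the Poisson equation
  \<open>\<Delta>h = \<rho>'(\<cdot>, 0) / \<epsilon>\<close>. The equation for \<open>\<partial>E'/\<partial>t\<close> holds by
  construction; those for \<open>div E'\<close> and \<open>curl E'\<close> hold at \<open>t = 0\<close> by the choice of \<open>h\<close> and
  propagate in time by the first-order system; the wave equation for \<open>E'\<close> follows from
  \<open>\<Delta>E' = grad div E'\<close> (\<open>electric_field_of_irrotational_sources\<close>).

  The analytic content is thus the solvability of \<open>\<Delta>h = g\<close> on all of space for a smooth \<open>g\<close>
  without any growth condition (\<open>poisson_solvable\<close>). Cut \<open>g\<close> into compactly supported pieces \<open>g\<^sub>n\<close>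
  that move off to infinity and solve for each piece by convolution with a fundamental solution
  \<open>\<Phi>\<^sub>n\<close> of the Laplacian. With the Newton kernel the sum of the solutions need not converge. But each \<open>g\<^sub>n\<close>
  may, after a further splitting, be taken to live in a half-space \<open>{y. y \<bullet> e \<ge> n - 2}\<close> for a coordinate direction \<open>e\<close>, and for
  points near the origin only the values \<open>\<Phi>\<^sub>n z\<close> with \<open>z \<bullet> e \<le> - 1\<close> matter. There are fundamental
  solutions that are arbitrarily small on that whole half-space
  (\<open>half_space_fundamental_solution\<close>): for \<open>a = - (z \<bullet> e) > 0\<close>, the Newton kernel is a superposition of
  harmonic exponentials,
  \<open>1 / |z| = (1 / 2\<pi>) \<integral>\<^sub>0\<^sup>2\<^sup>\<pi> \<integral>\<^sub>0\<^sup>\<infinity> exp (- s a) cos (s (z \<bullet> n \<phi>)) ds d\<phi>\<close>, where \<open>n \<phi>\<close> runs through the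
  unit vectors orthogonal to \<open>e\<close>. Stopping the inner integral at \<open>S\<close> gives a function that is
  harmonic on all of space, and subtracting it from \<open>1 / |z|\<close> leaves a remainder of size
  \<open>exp (- S a) / a\<close>. Since convolution commutes with differentiation, the solutions become small together
  with all their derivatives, and the series converges to a smooth \<open>h\<close>.\<close>

section \<open>Iterated directional derivatives\<close>

text \<open>The directional derivative, as a function of the base point. Fixing the direction keeps the
  values in the same space, so that it can be iterated as in the definition of \<open>Ck\<close>.\<close>

definition dd :: "'a::real_normed_vector \<Rightarrow> ('a \<Rightarrow> 'b::real_normed_vector) \<Rightarrow> 'a \<Rightarrow> 'b" where
  "dd u f = (\<lambda>x. frechet_derivative f (at x) u)"

lemma dd_eqI: "(\<And>x. (f has_derivative f' x) (at x)) \<Longrightarrow> dd u f = (\<lambda>x. f' x u)"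
  unfolding dd_def by (metis frechet_derivative_at)

lemma dd_eq: "(f has_derivative f') (at x) \<Longrightarrow> dd u f x = f' u"
  unfolding dd_def by (metis frechet_derivative_at)

lemma Ck_SucI:
  assumes "\<And>x. (f has_derivative f' x) (at x)" and "\<And>u. Ck k (\<lambda>x. f' x u)"
  shows "Ck (Suc k) f"
proof -
  have "(\<lambda>x. frechet_derivative f (at x) u) = (\<lambda>x. f' x u)" for u
    using dd_eqI[OF assms(1)] by (simp add: dd_def)
  then show ?thesis using assms by (auto simp: differentiable_def)
qed

lemma Ck_SucD:
  assumes "Ck (Suc k) f"
  shows "(f has_derivative (\<lambda>u. dd u f x)) (at x)" and "Ck k (dd u f)"
  using assms frechet_derivative_works[of f "at x"] by (auto simp: dd_def)

lemma Ck_decSuc: "Ck (Suc k) f \<Longrightarrow> Ck k f"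
proof (induction k arbitrary: f)
  case 0
  then show ?case
    by (auto simp: continuous_on_eq_continuous_at differentiable_imp_continuous_within)
next
  case (Suc k)
  show ?case by (rule Ck_SucI[where f'="\<lambda>x u. dd u f x"]) (use Suc Ck_SucD in blast)+
qed

lemma smoothD:
  assumes "smooth f"
  shows smooth_has_derivative: "(f has_derivative (\<lambda>u. dd u f x)) (at x)"
    and smooth_dd: "smooth (dd u f)"
    and smooth_continuous: "continuous_on S f"
proof -
  show "(f has_derivative (\<lambda>u. dd u f x)) (at x)" "smooth (dd u f)"
    using assms Ck_SucD unfolding smooth_def by blast+
  have "Ck 0 f" using assms by (simp add: smooth_def)
  then show "continuous_on S f" using continuous_on_subset by auto
qed

lemma dd_linear:
  assumes "smooth f" shows "linear (\<lambda>u. dd u f x)"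
  using smooth_has_derivative[OF assms] by (rule has_derivative_linear)

lemma Ck_const: "Ck k (\<lambda>x. c)"
proof (induction k arbitrary: c)
  case (Suc k)
  show ?case by (rule Ck_SucI[where f'="\<lambda>x u. 0"]) (auto intro: Suc)
qed auto

lemma Ck_add: "Ck k f \<Longrightarrow> Ck k g \<Longrightarrow> Ck k (\<lambda>x. f x + g x)"
proof (induction k arbitrary: f g)
  case 0
  then show ?case by (simp add: continuous_on_add)
next
  case (Suc k)
  show ?case
    by (rule Ck_SucI[where f'="\<lambda>x u. dd u f x + dd u g x"])
      (auto intro!: has_derivative_add Suc.IH Ck_SucD[OF Suc.prems(1)] Ck_SucD[OF Suc.prems(2)])
qed

lemma Ck_linear_comp:
  assumes "bounded_linear L" shows "Ck k f \<Longrightarrow> Ck k (\<lambda>x. L (f x))"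
proof (induction k arbitrary: f)
  case 0
  then show ?case using assms by (auto intro: bounded_linear.continuous_on)
next
  case (Suc k)
  show ?case
    by (rule Ck_SucI[where f'="\<lambda>x u. L (dd u f x)"])
      (auto intro!: bounded_linear.has_derivative[OF assms] Suc.IH Ck_SucD[OF Suc.prems])
qed

lemma Ck_comp_affine:
  assumes L: "bounded_linear L" shows "Ck k f \<Longrightarrow> Ck k (\<lambda>x. f (a + L x))"
proof (induction k arbitrary: f)
  case 0
  have "continuous_on UNIV (\<lambda>x. a + L x)"
    by (intro continuous_on_add continuous_on_const bounded_linear.continuous_on[OF L] continuous_on_id)
  with 0 show ?case using continuous_on_compose2[of UNIV f UNIV "\<lambda>x. a + L x"] by simp
next
  case (Suc k)
  have "((\<lambda>x. a + L x) has_derivative L) (at x)" for x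
    by (auto intro!: derivative_eq_intros bounded_linear.has_derivative[OF L] simp: fun_eq_iff)
  then have "((\<lambda>x. f (a + L x)) has_derivative (\<lambda>u. dd (L u) f (a + L x))) (at x)" for x
    by (rule has_derivative_compose[OF _ Ck_SucD(1)[OF Suc.prems]])
  then show ?case
    by (rule Ck_SucI) (rule Suc.IH[OF Ck_SucD(2)[OF Suc.prems]])
qed

lemma Ck_bilinear:
  assumes B: "bounded_bilinear B"
  shows "Ck k f \<Longrightarrow> Ck k g \<Longrightarrow> Ck k (\<lambda>x. B (f x) (g x))"
proof (induction k arbitrary: f g)
  case 0
  then show ?case using B by (auto intro: bounded_bilinear.continuous_on)
next
  case (Suc k)
  have "((\<lambda>x. B (f x) (g x)) has_derivative (\<lambda>u. B (f x) (dd u g x) + B (dd u f x) (g x))) (at x)" for x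
    by (rule bounded_bilinear.FDERIV[OF B Ck_SucD(1)[OF Suc.prems(1)] Ck_SucD(1)[OF Suc.prems(2)]])
  then show ?case
    by (rule Ck_SucI)
      (intro Ck_add Suc.IH Ck_SucD(2)[OF Suc.prems(1)] Ck_SucD(2)[OF Suc.prems(2)]
         Ck_decSuc[OF Suc.prems(1)] Ck_decSuc[OF Suc.prems(2)])
qed

lemma smooth_const [intro!]: "smooth (\<lambda>x. c)"
  by (simp add: smooth_def Ck_const)

lemma smooth_add: "smooth f \<Longrightarrow> smooth g \<Longrightarrow> smooth (\<lambda>x. f x + g x)"
  by (simp add: smooth_def Ck_add)

lemma smooth_linear_comp: "bounded_linear L \<Longrightarrow> smooth f \<Longrightarrow> smooth (\<lambda>x. L (f x))"
  by (simp add: smooth_def Ck_linear_comp)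

lemma smooth_comp_affine: "bounded_linear L \<Longrightarrow> smooth f \<Longrightarrow> smooth (\<lambda>x. f (a + L x))"
  by (simp add: smooth_def Ck_comp_affine)

lemma smooth_comp_linear: "bounded_linear L \<Longrightarrow> smooth f \<Longrightarrow> smooth (\<lambda>x. f (L x))"
  using smooth_comp_affine[of L f 0] by simp

lemma smooth_mult:
  fixes f g :: "_ \<Rightarrow> real"
  shows "smooth f \<Longrightarrow> smooth g \<Longrightarrow> smooth (\<lambda>x. f x * g x)"
  by (simp add: smooth_def Ck_bilinear[OF bounded_bilinear_mult])

lemma smooth_scaleR: "smooth f \<Longrightarrow> smooth g \<Longrightarrow> smooth (\<lambda>x. f x *\<^sub>R g x)"
  by (simp add: smooth_def Ck_bilinear[OF bounded_bilinear_scaleR])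

lemma smooth_scaleR_const: "smooth g \<Longrightarrow> smooth (\<lambda>x. c *\<^sub>R g x)"
  by (rule smooth_scaleR) auto

lemma smooth_diff: "smooth f \<Longrightarrow> smooth g \<Longrightarrow> smooth (\<lambda>x. f x - g x)"
  using smooth_add[of f "\<lambda>x. (-1) *\<^sub>R g x"] smooth_scaleR_const[of g "-1"] by simp

lemma smooth_sum: "(\<And>i. i \<in> A \<Longrightarrow> smooth (f i)) \<Longrightarrow> smooth (\<lambda>x. \<Sum>i\<in>A. f i x)"
  by (induction A rule: infinite_finite_induct) (auto intro: smooth_add)

lemma smooth_prod:
  fixes f :: "_ \<Rightarrow> _ \<Rightarrow> real"
  shows "(\<And>i. i \<in> A \<Longrightarrow> smooth (f i)) \<Longrightarrow> smooth (\<lambda>x. \<Prod>i\<in>A. f i x)"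
  by (induction A rule: infinite_finite_induct) (auto intro: smooth_mult)

text \<open>Smoothness by a closure argument: it is enough to find a family of functions that contains \<open>f\<close>
  and is closed under directional derivatives. Many functions below are shown to be smooth by
  naming such a family, for example all products of a smooth function with a power of a fixed one.\<close>

lemma smoothI_derivative:
  assumes "P f"
    and step: "\<And>f. P f \<Longrightarrow> \<exists>f'. (\<forall>x. (f has_derivative f' x) (at x)) \<and> (\<forall>u. P (\<lambda>x. f' x u))"
  shows "smooth f"
proof -
  have "P f \<Longrightarrow> Ck k f" for k f
  proof (induction k arbitrary: f)
    case 0
    then show ?case using step[OF 0]
      by (metis Ck.simps(1) continuous_on_eq_continuous_at has_derivative_continuous open_UNIV)
  next
    case (Suc k)
    then show ?case using step[OF Suc.prems] by (metis Ck_SucI)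
  qed
  with assms show ?thesis by (simp add: smooth_def)
qed

text \<open>For limits of series only the derivatives along basis vectors are under control; the other
  directional derivatives are finite linear combinations of these.\<close>

lemma Ck_SucI_Basis:
  fixes f :: "'a::euclidean_space \<Rightarrow> 'b::real_normed_vector"
  assumes der: "\<And>x. (f has_derivative (\<lambda>u. \<Sum>b\<in>Basis. (u \<bullet> b) *\<^sub>R g b x)) (at x)"
    and g: "\<And>b. b \<in> Basis \<Longrightarrow> Ck k (g b)"
  shows "Ck (Suc k) f"
proof (rule Ck_SucI[OF der])
  fix u
  have "finite A \<Longrightarrow> A \<subseteq> Basis \<Longrightarrow> Ck k (\<lambda>x. \<Sum>b\<in>A. (u \<bullet> b) *\<^sub>R g b x)" for A
    by (induction A rule: finite_induct)
      (auto intro!: Ck_add Ck_const Ck_linear_comp[OF bounded_linear_scaleR_right] g)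
  then show "Ck k (\<lambda>x. \<Sum>b\<in>Basis. (u \<bullet> b) *\<^sub>R g b x)" by simp
qed

lemma dd_Basis:
  fixes f :: "'a::euclidean_space \<Rightarrow> 'b::real_normed_vector"
  assumes "smooth f" shows "dd u f x = (\<Sum>b\<in>Basis. (u \<bullet> b) *\<^sub>R dd b f x)"
proof -
  have "dd u f x = dd (\<Sum>b\<in>Basis. (u \<bullet> b) *\<^sub>R b) f x" by (simp add: euclidean_representation)
  also have "\<dots> = (\<Sum>b\<in>Basis. (u \<bullet> b) *\<^sub>R dd b f x)"
    using linear_sum[OF dd_linear[OF assms], of "\<lambda>b. (u \<bullet> b) *\<^sub>R b" Basis x]
    by (simp add: linear_scale[OF dd_linear[OF assms]] del: euclidean_representation)
  finally show ?thesis .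
qed

lemma dd_add: "smooth f \<Longrightarrow> smooth g \<Longrightarrow> dd u (\<lambda>x. f x + g x) = (\<lambda>x. dd u f x + dd u g x)"
  by (rule dd_eqI) (auto intro: has_derivative_add smooth_has_derivative)

lemma dd_diff: "smooth f \<Longrightarrow> smooth g \<Longrightarrow> dd u (\<lambda>x. f x - g x) = (\<lambda>x. dd u f x - dd u g x)"
  by (rule dd_eqI) (auto intro: has_derivative_diff smooth_has_derivative)

lemma dd_linear_comp: "bounded_linear L \<Longrightarrow> smooth f \<Longrightarrow> dd u (\<lambda>x. L (f x)) = (\<lambda>x. L (dd u f x))"
  by (rule dd_eqI) (auto intro: bounded_linear.has_derivative smooth_has_derivative)

lemma dd_comp_affine:
  assumes L: "bounded_linear L" and f: "smooth f"
  shows "dd u (\<lambda>x. f (a + L x)) = (\<lambda>x. dd (L u) f (a + L x))"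
proof (rule dd_eqI)
  fix x
  have "((\<lambda>x. a + L x) has_derivative L) (at x)"
    by (auto intro!: derivative_eq_intros bounded_linear.has_derivative[OF L] simp: fun_eq_iff)
  then show "((\<lambda>x. f (a + L x)) has_derivative (\<lambda>u. dd (L u) f (a + L x))) (at x)"
    by (rule has_derivative_compose[OF _ smooth_has_derivative[OF f]])
qed

lemma dd_mult:
  fixes f g :: "_ \<Rightarrow> real"
  assumes "smooth f" "smooth g"
  shows "dd u (\<lambda>x. f x * g x) = (\<lambda>x. f x * dd u g x + dd u f x * g x)"
  by (rule dd_eqI) (use assms in \<open>auto intro: has_derivative_mult smooth_has_derivative\<close>)

lemma has_vector_derivative_along:
  assumes g: "smooth g"
  shows "((\<lambda>s. g (y + s *\<^sub>R w)) has_vector_derivative dd w g (y + s *\<^sub>R w)) (at s)"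
proof -
  have "((\<lambda>s. y + s *\<^sub>R w) has_derivative (\<lambda>r. r *\<^sub>R w)) (at s)"
    by (auto intro!: derivative_eq_intros)
  then have "((\<lambda>s. g (y + s *\<^sub>R w)) has_derivative (\<lambda>r. dd (r *\<^sub>R w) g (y + s *\<^sub>R w))) (at s)"
    by (rule has_derivative_compose[OF _ smooth_has_derivative[OF g]])
  then show ?thesis
    by (simp add: has_vector_derivative_def linear_scale[OF dd_linear[OF g]])
qed

lemma has_real_derivative_along:
  assumes g: "smooth g"
  shows "((\<lambda>s. g (y + s *\<^sub>R w)) has_real_derivative dd w g (y + s *\<^sub>R w)) (at s)"
  using has_vector_derivative_along[OF assms] by (simp add: has_real_derivative_iff_has_vector_derivative)

text \<open>The mean value theorem applied first along \<open>u\<close> and then along \<open>v\<close>. The second difference on the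
  left is symmetric in \<open>u\<close> and \<open>v\<close>, which is why mixed derivatives commute.\<close>

lemma second_difference:
  fixes f :: "'a::real_normed_vector \<Rightarrow> real"
  assumes f: "smooth f" and h: "h > 0"
  shows "\<exists>\<xi> \<eta>. 0 < \<xi> \<and> \<xi> < h \<and> 0 < \<eta> \<and> \<eta> < h \<and>
    f (x + h *\<^sub>R u + h *\<^sub>R v) - f (x + h *\<^sub>R u) - f (x + h *\<^sub>R v) + f x
      = h\<^sup>2 * dd v (dd u f) (x + \<xi> *\<^sub>R u + \<eta> *\<^sub>R v)"
proof -
  define \<phi> where "\<phi> s = f (x + h *\<^sub>R v + s *\<^sub>R u) - f (x + s *\<^sub>R u)" for s
  define \<phi>' where "\<phi>' s = dd u f (x + h *\<^sub>R v + s *\<^sub>R u) - dd u f (x + s *\<^sub>R u)" for s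
  have "(\<phi> has_real_derivative \<phi>' s) (at s)" for s
    unfolding \<phi>_def \<phi>'_def by (intro DERIV_diff has_real_derivative_along f)
  from MVT2[OF h this] obtain \<xi> where \<xi>: "0 < \<xi>" "\<xi> < h" "\<phi> h - \<phi> 0 = h * \<phi>' \<xi>"
    by (metis (no_types) diff_zero)
  obtain \<eta> where \<eta>: "0 < \<eta>" "\<eta> < h"
    "dd u f (x + \<xi> *\<^sub>R u + h *\<^sub>R v) - dd u f (x + \<xi> *\<^sub>R u + 0 *\<^sub>R v)
      = h * dd v (dd u f) (x + \<xi> *\<^sub>R u + \<eta> *\<^sub>R v)"
    using MVT2[OF h has_real_derivative_along[OF smooth_dd[OF f, of u], of "x + \<xi> *\<^sub>R u" v]]
    unfolding diff_zero by blast
  then have "\<phi>' \<xi> = h * dd v (dd u f) (x + \<xi> *\<^sub>R u + \<eta> *\<^sub>R v)"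
    by (simp add: \<phi>'_def algebra_simps)
  with \<xi> have "\<phi> h - \<phi> 0 = h\<^sup>2 * dd v (dd u f) (x + \<xi> *\<^sub>R u + \<eta> *\<^sub>R v)"
    by (simp add: power2_eq_square)
  moreover have "\<phi> h - \<phi> 0 = f (x + h *\<^sub>R u + h *\<^sub>R v) - f (x + h *\<^sub>R u) - f (x + h *\<^sub>R v) + f x"
    by (simp add: \<phi>_def add.commute add.left_commute)
  ultimately show ?thesis using \<xi>(1,2) \<eta>(1,2) by metis
qed

lemma dd_commute:
  fixes f :: "'a::real_normed_vector \<Rightarrow> real"
  assumes f: "smooth f" shows "dd u (dd v f) = dd v (dd u f)"
proof
  fix x
  define d where "d h u v = f (x + h *\<^sub>R u + h *\<^sub>R v) - f (x + h *\<^sub>R u) - f (x + h *\<^sub>R v) + f x" for h u v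
  define h where "h n = inverse (real (Suc n))" for n
  have h0: "h \<longlonglongrightarrow> 0" unfolding h_def by (rule LIMSEQ_inverse_real_of_nat)
  have hpos: "h n > 0" for n by (simp add: h_def)
  have *: "(\<lambda>n. d (h n) u v / (h n)\<^sup>2) \<longlonglongrightarrow> dd v (dd u f) x" for u v
  proof -
    have "\<forall>n. \<exists>\<xi> \<eta>. 0 < \<xi> \<and> \<xi> < h n \<and> 0 < \<eta> \<and> \<eta> < h n \<and>
        d (h n) u v = (h n)\<^sup>2 * dd v (dd u f) (x + \<xi> *\<^sub>R u + \<eta> *\<^sub>R v)"
      using second_difference[OF f hpos] unfolding d_def by blast
    then obtain \<xi> \<eta> where b: "\<And>n. 0 < \<xi> n" "\<And>n. \<xi> n < h n" "\<And>n. 0 < \<eta> n" "\<And>n. \<eta> n < h n"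
      and e: "\<And>n. d (h n) u v = (h n)\<^sup>2 * dd v (dd u f) (x + \<xi> n *\<^sub>R u + \<eta> n *\<^sub>R v)"
      by metis
    have "\<xi> \<longlonglongrightarrow> 0" "\<eta> \<longlonglongrightarrow> 0"
      by (rule tendsto_sandwich[OF _ _ tendsto_const h0]; use b in \<open>simp add: less_imp_le\<close>)+
    then have "(\<lambda>n. x + \<xi> n *\<^sub>R u + \<eta> n *\<^sub>R v) \<longlonglongrightarrow> x + 0 *\<^sub>R u + 0 *\<^sub>R v"
      by (intro tendsto_intros)
    moreover have "isCont (dd v (dd u f)) x"
      using smooth_continuous[OF smooth_dd[OF smooth_dd[OF f]], of UNIV]
      by (simp add: continuous_on_eq_continuous_at)
    ultimately have "(\<lambda>n. dd v (dd u f) (x + \<xi> n *\<^sub>R u + \<eta> n *\<^sub>R v)) \<longlonglongrightarrow> dd v (dd u f) x"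
      using isCont_tendsto_compose[of x "dd v (dd u f)"] by simp
    moreover have "d (h n) u v / (h n)\<^sup>2 = dd v (dd u f) (x + \<xi> n *\<^sub>R u + \<eta> n *\<^sub>R v)" for n
      using e[of n] hpos[of n] by simp
    ultimately show ?thesis by simp
  qed
  have "d (h n) u v = d (h n) v u" for n by (simp add: d_def algebra_simps)
  then show "dd u (dd v f) x = dd v (dd u f) x"
    using LIMSEQ_unique[OF *[of u v]] *[of v u] by simp
qed

lemma smooth_inner: "smooth f \<Longrightarrow> smooth (\<lambda>x. f x \<bullet> b)"
  by (rule smooth_linear_comp[OF bounded_linear_inner_left])

section \<open>Convolution with test functions\<close>

definition test_function :: "('a::euclidean_space \<Rightarrow> real) \<Rightarrow> bool" where
  "test_function f \<longleftrightarrow> smooth f \<and> (\<exists>R. \<forall>x. R < norm x \<longrightarrow> f x = 0)"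

definition lap :: "('a::euclidean_space \<Rightarrow> real) \<Rightarrow> 'a \<Rightarrow> real" where
  "lap f x = (\<Sum>b\<in>Basis. dd b (dd b f) x)"

definition locally_integrable :: "('a::euclidean_space \<Rightarrow> real) \<Rightarrow> bool" where
  "locally_integrable \<Phi> \<longleftrightarrow> (\<forall>r. integrable lborel (\<lambda>z. indicator (cball 0 r) z * \<Phi> z))"

definition conv :: "('a::euclidean_space \<Rightarrow> real) \<Rightarrow> ('a \<Rightarrow> real) \<Rightarrow> 'a \<Rightarrow> real" where
  "conv \<Phi> f x = (\<integral>z. \<Phi> z * f (x - z) \<partial>lborel)"

lemma test_smooth: "test_function f \<Longrightarrow> smooth f"
  by (simp add: test_function_def)

lemma dd_zero_on_open:
  assumes "open S" "x \<in> S" "\<And>y. y \<in> S \<Longrightarrow> f y = 0"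
  shows "dd u f x = 0"
proof -
  have "(f has_derivative (\<lambda>_. 0)) (at x)"
    by (rule has_derivative_transform_within_open[OF has_derivative_const assms(1,2)])
      (simp add: assms(3))
  then show ?thesis by (rule dd_eq)
qed

lemma open_norm_gt: "open {x::'a::real_normed_vector. R < norm x}"
  by (intro open_Collect_less continuous_intros)

lemma test_function_dd: "test_function f \<Longrightarrow> test_function (dd u f)"
  unfolding test_function_def
proof safe
  fix R assume "\<forall>x. R < norm x \<longrightarrow> f x = 0"
  then have "\<forall>x. R < norm x \<longrightarrow> dd u f x = 0"
    using dd_zero_on_open[OF open_norm_gt[of R], of _ f u] by blast
  then show "\<exists>R. \<forall>x. R < norm x \<longrightarrow> dd u f x = 0" ..
qed (rule smooth_dd)

lemma test_function_mult: "smooth g \<Longrightarrow> test_function f \<Longrightarrow> test_function (\<lambda>x. g x * f x)"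
  unfolding test_function_def by (auto intro: smooth_mult)

lemma test_function_mult': "test_function f \<Longrightarrow> smooth g \<Longrightarrow> test_function (\<lambda>x. f x * g x)"
  unfolding test_function_def by (auto intro: smooth_mult)

lemma test_function_add:
  assumes "test_function f" "test_function g" shows "test_function (\<lambda>x. f x + g x)"
proof -
  from assms obtain R R' where "\<forall>x. R < norm x \<longrightarrow> f x = 0" "\<forall>x. R' < norm x \<longrightarrow> g x = 0"
    by (auto simp: test_function_def)
  then have "\<forall>x. max R R' < norm x \<longrightarrow> f x + g x = 0" by simp
  with assms show ?thesis unfolding test_function_def by (blast intro: smooth_add)
qed

lemma test_function_diff:
  assumes "test_function f" "test_function g" shows "test_function (\<lambda>x. f x - g x)"
  using test_function_add[OF assms(1) test_function_mult[OF smooth_const assms(2), of "-1"]] by simp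

lemma test_function_zero: "test_function (\<lambda>x. 0)"
  by (auto simp: test_function_def)

lemma test_function_sum: "(\<And>i. i \<in> A \<Longrightarrow> test_function (f i)) \<Longrightarrow> test_function (\<lambda>x. \<Sum>i\<in>A. f i x)"
  by (induction A rule: infinite_finite_induct) (auto intro: test_function_add test_function_zero)

lemma lap_eq: "lap f = (\<lambda>x. \<Sum>b\<in>Basis. dd b (dd b f) x)"
  by (simp add: fun_eq_iff lap_def)

lemma test_function_lap: "test_function f \<Longrightarrow> test_function (lap f)"
  unfolding lap_eq by (intro test_function_sum test_function_dd)

lemma smooth_lap: "smooth f \<Longrightarrow> smooth (lap f)"
  unfolding lap_eq by (intro smooth_sum smooth_dd)

lemma dd_reflect:
  assumes "smooth f"
  shows "dd u (\<lambda>z. f (x - z)) = (\<lambda>z. - dd u f (x - z))"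
proof -
  have "bounded_linear (\<lambda>z::'a. - z)" by (intro bounded_linear_minus bounded_linear_ident)
  from dd_comp_affine[OF this assms, of u x]
  show ?thesis using linear_neg[OF dd_linear[OF assms]] by simp
qed

lemma smooth_reflect: "smooth f \<Longrightarrow> smooth (\<lambda>z. f (x - z))"
  using smooth_comp_affine[OF bounded_linear_minus[OF bounded_linear_ident], of f x] by simp

lemma dd_minus: "smooth f \<Longrightarrow> dd u (\<lambda>x. - f x) = (\<lambda>x. - dd u f x)"
  by (rule dd_linear_comp[OF bounded_linear_minus[OF bounded_linear_ident]])

lemma test_function_reflect:
  assumes "test_function f" shows "test_function (\<lambda>z. f (x - z))"
proof -
  from assms obtain R where R: "\<And>x. R < norm x \<Longrightarrow> f x = 0" and "smooth f"
    by (auto simp: test_function_def)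
  have "f (x - z) = 0" if "R + norm x < norm z" for z
    using norm_triangle_ineq2[of z x] that by (intro R) (simp add: norm_minus_commute)
  with \<open>smooth f\<close> show ?thesis unfolding test_function_def by (blast intro: smooth_reflect)
qed

lemma lap_reflect:
  assumes "smooth f" shows "lap (\<lambda>z. f (x - z)) = (\<lambda>z. lap f (x - z))"
  using assms
  by (simp add: lap_eq dd_reflect dd_minus[OF smooth_reflect[OF smooth_dd]] smooth_dd)

lemma test_function_bounded:
  assumes "test_function f" obtains M where "\<And>x. \<bar>f x\<bar> \<le> M"
proof -
  from assms obtain R where R: "\<And>x. R < norm x \<Longrightarrow> f x = 0" and "smooth f"
    by (auto simp: test_function_def)
  then have "compact (f ` cball 0 R)"
    by (intro compact_continuous_image smooth_continuous) auto
  then obtain M where M: "\<And>y. y \<in> f ` cball 0 R \<Longrightarrow> norm y \<le> M"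
    using compact_imp_bounded bounded_iff by metis
  have "\<bar>f x\<bar> \<le> max M 0" for x
    by (cases "R < norm x") (use R[of x] M[of "f x"] in auto)
  then show ?thesis by (rule that)
qed

lemma integrable_mult_test:
  assumes \<Phi>: "locally_integrable \<Phi>" and f: "test_function f"
  shows "integrable lborel (\<lambda>z. \<Phi> z * f z)"
proof -
  from f obtain R where R: "\<And>x. R < norm x \<Longrightarrow> f x = 0" and "smooth f"
    by (auto simp: test_function_def)
  obtain M where M: "\<And>x. \<bar>f x\<bar> \<le> M" using test_function_bounded[OF f] by blast
  have I: "integrable lborel (\<lambda>z. indicator (cball 0 R) z * \<Phi> z)"
    using \<Phi> by (simp add: locally_integrable_def)
  have eq: "\<Phi> z * f z = (indicator (cball 0 R) z * \<Phi> z) * f z" for z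
    using R[of z] by (auto simp: indicator_def)
  have m: "f \<in> borel_measurable lborel"
    using smooth_continuous[OF \<open>smooth f\<close>, of UNIV] by (simp add: borel_measurable_continuous_onI)
  show ?thesis unfolding eq
  proof (rule Bochner_Integration.integrable_bound[OF integrable_mult_right[OF I, of M]])
    show "(\<lambda>z. indicator (cball 0 R) z * \<Phi> z * f z) \<in> borel_measurable lborel"
      using borel_measurable_integrable[OF I] m by measurable
    show "AE z in lborel. norm (indicator (cball 0 R) z * \<Phi> z * f z)
        \<le> norm (M * (indicator (cball 0 R) z * \<Phi> z))"
    proof (rule AE_I2)
      fix z
      have "\<bar>f z\<bar> \<le> \<bar>M\<bar>" using M[of z] by linarith
      then show "norm (indicator (cball 0 R) z * \<Phi> z * f z)
        \<le> norm (M * (indicator (cball 0 R) z * \<Phi> z))"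
        by (simp add: abs_mult mult_right_mono mult.commute mult_left_mono)
    qed
  qed
qed

lemma integrable_conv:
  "locally_integrable \<Phi> \<Longrightarrow> test_function f \<Longrightarrow> integrable lborel (\<lambda>z. \<Phi> z * f (x - z))"
  by (rule integrable_mult_test[OF _ test_function_reflect])

lemma mean_value_along:
  fixes f :: "'a::real_normed_vector \<Rightarrow> real"
  assumes "smooth f"
  obtains \<xi> where "0 < \<xi>" "\<xi> < 1" "f (y + h) - f y = dd h f (y + \<xi> *\<^sub>R h)"
  using MVT2[OF zero_less_one has_real_derivative_along[OF assms, of y h]] by auto

lemma dd_bound:
  fixes f :: "'a::euclidean_space \<Rightarrow> real"
  assumes "smooth f" "\<And>b. b \<in> Basis \<Longrightarrow> \<bar>dd b f x\<bar> \<le> M b"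
  shows "\<bar>dd h f x\<bar> \<le> (\<Sum>b\<in>Basis. M b) * norm h"
proof -
  have "\<bar>dd h f x\<bar> \<le> (\<Sum>b\<in>Basis. \<bar>(h \<bullet> b) * dd b f x\<bar>)"
    unfolding dd_Basis[OF assms(1), of h] real_scaleR_def by (rule sum_abs)
  also have "\<dots> \<le> (\<Sum>b\<in>Basis. norm h * M b)"
    unfolding abs_mult by (intro sum_mono mult_mono Basis_le_norm assms(2)) auto
  finally show ?thesis by (simp add: sum_distrib_left mult.commute)
qed

lemma test_function_lipschitz:
  assumes f: "test_function f"
  obtains C where "C \<ge> 0" "\<And>y h. \<bar>f (y + h) - f y\<bar> \<le> C * norm h"
proof -
  have "\<forall>b. \<exists>M. \<forall>x. \<bar>dd b f x\<bar> \<le> M"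
    using test_function_bounded[OF test_function_dd[OF f]] by metis
  then obtain M where M: "\<And>b x. \<bar>dd b f x\<bar> \<le> M b" by metis
  have "\<bar>f (y + h) - f y\<bar> \<le> (\<Sum>b\<in>Basis. M b) * norm h" for y h
  proof -
    obtain \<xi> where "f (y + h) - f y = dd h f (y + \<xi> *\<^sub>R h)"
      using mean_value_along[OF test_smooth[OF f]] by blast
    then show ?thesis using dd_bound[OF test_smooth[OF f] M] by simp
  qed
  moreover have "(\<Sum>b\<in>Basis. M b) \<ge> 0"
    using M by (intro sum_nonneg) (meson abs_ge_zero order_trans)
  ultimately show ?thesis using that by blast
qed

text \<open>The remainder estimate is uniform in the base point because the second derivatives of a test
  function are bounded. This uniformity is what allows differentiation under the integral sign
  against a kernel that is merely locally integrable.\<close>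

lemma test_function_taylor:
  assumes f: "test_function f"
  obtains C where "C \<ge> 0" "\<And>y h. \<bar>f (y + h) - f y - dd h f y\<bar> \<le> C * (norm h)\<^sup>2"
proof -
  have "\<forall>b. \<exists>M\<ge>0. \<forall>y h. \<bar>dd b f (y + h) - dd b f y\<bar> \<le> M * norm h"
    using test_function_lipschitz[OF test_function_dd[OF f]] by metis
  then obtain M where M: "\<And>b. M b \<ge> 0" "\<And>b y h. \<bar>dd b f (y + h) - dd b f y\<bar> \<le> M b * norm h"
    by metis
  note f = test_smooth[OF f]
  have "\<bar>f (y + h) - f y - dd h f y\<bar> \<le> (\<Sum>b\<in>Basis. M b) * (norm h)\<^sup>2" for y h
  proof -
    obtain \<xi> where \<xi>: "0 < \<xi>" "\<xi> < 1" "f (y + h) - f y = dd h f (y + \<xi> *\<^sub>R h)"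
      using mean_value_along[OF f] by blast
    have "\<bar>dd b f (y + \<xi> *\<^sub>R h) - dd b f y\<bar> \<le> M b * norm h" for b
    proof -
      have "\<bar>dd b f (y + \<xi> *\<^sub>R h) - dd b f y\<bar> \<le> M b * (\<xi> * norm h)"
        using M(2)[of b y "\<xi> *\<^sub>R h"] \<xi> by simp
      also have "\<dots> \<le> M b * norm h"
        using \<xi> by (intro mult_left_mono[OF _ M(1)] mult_left_le_one_le) auto
      finally show ?thesis .
    qed
    then have "\<bar>(h \<bullet> b) * (dd b f (y + \<xi> *\<^sub>R h) - dd b f y)\<bar> \<le> norm h * (M b * norm h)"
      if "b \<in> Basis" for b
      unfolding abs_mult by (intro mult_mono Basis_le_norm that) auto
    then have "(\<Sum>b\<in>Basis. \<bar>(h \<bullet> b) * (dd b f (y + \<xi> *\<^sub>R h) - dd b f y)\<bar>)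
        \<le> (\<Sum>b\<in>Basis. norm h * (M b * norm h))"
      by (rule sum_mono)
    moreover have "f (y + h) - f y - dd h f y = (\<Sum>b\<in>Basis. (h \<bullet> b) * (dd b f (y + \<xi> *\<^sub>R h) - dd b f y))"
      unfolding \<xi>(3) dd_Basis[OF f, of h] by (simp add: sum_subtractf right_diff_distrib)
    ultimately have "\<bar>f (y + h) - f y - dd h f y\<bar> \<le> (\<Sum>b\<in>Basis. norm h * (M b * norm h))"
      using sum_abs[of "\<lambda>b. (h \<bullet> b) * (dd b f (y + \<xi> *\<^sub>R h) - dd b f y)" Basis] by linarith
    also have "\<dots> = (\<Sum>b\<in>Basis. M b) * (norm h)\<^sup>2"
      by (simp add: sum_distrib_left sum_distrib_right power2_eq_square mult_ac)
    finally show ?thesis .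
  qed
  moreover have "(\<Sum>b\<in>Basis. M b) \<ge> 0" using M by (intro sum_nonneg) auto
  ultimately show ?thesis using that by blast
qed

text \<open>In \<open>conv \<Phi> f x = \<integral> \<Phi> z f (x - z) dz\<close> the point \<open>x\<close> occurs only in the test function, so all
  derivatives fall on \<open>f\<close>.\<close>

lemma conv_has_derivative:
  assumes \<Phi>: "locally_integrable \<Phi>" and f: "test_function f"
  shows "(conv \<Phi> f has_derivative (\<lambda>u. conv \<Phi> (dd u f) x)) (at x)"
  unfolding has_derivative_at_alt
proof safe
  note i = integrable_conv[OF \<Phi>] test_function_dd f
  have lin: "linear (\<lambda>u. dd u f y)" for y by (rule dd_linear[OF test_smooth[OF f]])
  have "linear (\<lambda>u. conv \<Phi> (dd u f) x)"
  proof (rule linearI)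
    fix u v
    have "conv \<Phi> (dd (u + v) f) x = (\<integral>z. \<Phi> z * dd u f (x - z) + \<Phi> z * dd v f (x - z) \<partial>lborel)"
      by (simp add: conv_def linear_add[OF lin] distrib_left)
    also have "\<dots> = conv \<Phi> (dd u f) x + conv \<Phi> (dd v f) x"
      unfolding conv_def by (intro Bochner_Integration.integral_add i)
    finally show "conv \<Phi> (dd (u + v) f) x = conv \<Phi> (dd u f) x + conv \<Phi> (dd v f) x" .
  next
    fix r u
    have "conv \<Phi> (dd (r *\<^sub>R u) f) x = (\<integral>z. r * (\<Phi> z * dd u f (x - z)) \<partial>lborel)"
      by (simp add: conv_def linear_scale[OF lin] mult.left_commute)
    then show "conv \<Phi> (dd (r *\<^sub>R u) f) x = r *\<^sub>R conv \<Phi> (dd u f) x"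
      by (simp add: conv_def)
  qed
  then show "bounded_linear (\<lambda>u. conv \<Phi> (dd u f) x)" by (simp add: linear_conv_bounded_linear)
  fix e :: real assume e: "e > 0"
  from f obtain R where R: "\<And>x. R < norm x \<Longrightarrow> f x = 0" by (auto simp: test_function_def)
  have R': "dd u f y = 0" if "R < norm y" for u y
    using that dd_zero_on_open[OF open_norm_gt[of R], of y f u] R by auto
  obtain C where C: "C \<ge> 0" "\<And>y h. \<bar>f (y + h) - f y - dd h f y\<bar> \<le> C * (norm h)\<^sup>2"
    using test_function_taylor[OF f] by blast
  \<comment> \<open>for \<open>norm h < 1\<close> the increment of \<open>f\<close> at \<open>x - z\<close> vanishes unless \<open>norm z \<le> r\<close>\<close>
  define r where "r = R + 1 + norm x"
  define I where "I z = indicator (cball 0 r) z * \<bar>\<Phi> z\<bar>" for z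
  have "integrable lborel (\<lambda>z. \<bar>indicator (cball 0 r) z * \<Phi> z\<bar>)"
    using \<Phi> by (intro integrable_abs) (simp add: locally_integrable_def)
  then have I: "integrable lborel I"
    by (simp add: I_def[abs_def] abs_mult)
  have Ipos: "integral\<^sup>L lborel I \<ge> 0" by (simp add: I_def)
  \<comment> \<open>the Taylor remainder contributes at most \<open>C (norm h)\<^sup>2 \<integral> I\<close>; adding 1 avoids a zero denominator\<close>
  define d where "d = min 1 (e / (C * integral\<^sup>L lborel I + 1))"
  have den: "C * integral\<^sup>L lborel I + 1 > 0" using C(1) Ipos by (simp add: add_nonneg_pos)
  have "d > 0" using e den by (simp add: d_def)
  moreover have "norm (conv \<Phi> f y - conv \<Phi> f x - conv \<Phi> (dd (y - x) f) x) \<le> e * norm (y - x)"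
    if y: "norm (y - x) < d" for y
  proof -
    define h where "h = y - x"
    have h: "norm h < 1" "norm h * (C * integral\<^sup>L lborel I + 1) \<le> e"
      using y den by (auto simp: h_def d_def pos_less_divide_eq less_imp_le)
    define D where "D z = f (x - z + h) - f (x - z) - dd h f (x - z)" for z
    have D0: "D z = 0" if "r < norm z" for z
    proof -
      have "R + 1 < norm (x - z)"
        using norm_triangle_ineq2[of z x] that by (simp add: r_def norm_minus_commute)
      moreover have "norm (x - z) - norm h \<le> norm (x - z + h)"
        using norm_diff_ineq by blast
      ultimately show ?thesis using R[of "x - z + h"] R[of "x - z"] R'[of "x - z" h] h(1)
        by (simp add: D_def)
    qed
    have "conv \<Phi> f y - conv \<Phi> f x - conv \<Phi> (dd h f) x
        = (\<integral>z. \<Phi> z * f (y - z) - \<Phi> z * f (x - z) - \<Phi> z * dd h f (x - z) \<partial>lborel)"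
      unfolding conv_def
      by (simp add: Bochner_Integration.integral_diff Bochner_Integration.integrable_diff i)
    also have "\<dots> = (\<integral>z. \<Phi> z * D z \<partial>lborel)"
      by (rule Bochner_Integration.integral_cong) (auto simp: D_def h_def algebra_simps)
    also have "norm \<dots> \<le> (\<integral>z. C * (norm h)\<^sup>2 * I z \<partial>lborel)"
    proof (rule order_trans[OF integral_norm_bound integral_mono])
      have "integrable lborel (\<lambda>z. \<Phi> z * f (y - z) - \<Phi> z * f (x - z) - \<Phi> z * dd h f (x - z))"
        by (intro Bochner_Integration.integrable_diff i)
      moreover have "\<Phi> z * f (y - z) - \<Phi> z * f (x - z) - \<Phi> z * dd h f (x - z) = \<Phi> z * D z" for z
        by (simp add: D_def h_def algebra_simps)
      ultimately have "integrable lborel (\<lambda>z. \<Phi> z * D z)" by simp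
      then show "integrable lborel (\<lambda>z. norm (\<Phi> z * D z))" by (rule integrable_norm)
      show "integrable lborel (\<lambda>z. C * (norm h)\<^sup>2 * I z)" using I by simp
      fix z
      show "norm (\<Phi> z * D z) \<le> C * (norm h)\<^sup>2 * I z"
      proof (cases "r < norm z")
        case True then show ?thesis using D0 C(1) by (simp add: I_def)
      next
        case False
        have "\<bar>\<Phi> z\<bar> * \<bar>D z\<bar> \<le> \<bar>\<Phi> z\<bar> * (C * (norm h)\<^sup>2)"
          using C(2)[of "x - z" h] by (intro mult_left_mono) (auto simp: D_def)
        with False show ?thesis by (simp add: I_def abs_mult mult_ac)
      qed
    qed
    also have "\<dots> = norm h * (norm h * (C * integral\<^sup>L lborel I))"
      by (simp add: power2_eq_square)
    also have "\<dots> \<le> norm h * e"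
      using h(2) by (intro mult_left_mono) (auto simp: distrib_left intro: order_trans[rotated])
    finally show ?thesis by (simp add: h_def mult.commute)
  qed
  ultimately show "\<exists>d>0. \<forall>y. norm (y - x) < d \<longrightarrow>
      norm (conv \<Phi> f y - conv \<Phi> f x - conv \<Phi> (dd (y - x) f) x) \<le> e * norm (y - x)" by blast
qed

lemma smooth_conv:
  assumes "locally_integrable \<Phi>" "test_function f" shows "smooth (conv \<Phi> f)"
proof (rule smoothI_derivative[where P = "\<lambda>g. \<exists>f. test_function f \<and> g = conv \<Phi> f"])
  fix g assume "\<exists>f. test_function f \<and> g = conv \<Phi> f"
  then obtain f where f: "test_function f" "g = conv \<Phi> f" by blast
  show "\<exists>f'. (\<forall>x. (g has_derivative f' x) (at x)) \<and>
      (\<forall>u. \<exists>f. test_function f \<and> (\<lambda>x. f' x u) = conv \<Phi> f)"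
  proof (intro exI[of _ "\<lambda>x u. conv \<Phi> (dd u f) x"] conjI allI)
    show "(g has_derivative (\<lambda>u. conv \<Phi> (dd u f) x)) (at x)" for x
      unfolding f(2) by (rule conv_has_derivative[OF assms(1) f(1)])
    show "\<exists>f'. test_function f' \<and> conv \<Phi> (dd u f) = conv \<Phi> f'" for u
      using test_function_dd[OF f(1)] by blast
  qed
qed (use assms in blast)

lemma dd_conv:
  assumes "locally_integrable \<Phi>" "test_function f" shows "dd u (conv \<Phi> f) = conv \<Phi> (dd u f)"
  using dd_eqI[OF conv_has_derivative[OF assms]] by (simp add: fun_eq_iff)

lemma lap_conv:
  assumes \<Phi>: "locally_integrable \<Phi>" and f: "test_function f"
  shows "lap (conv \<Phi> f) = conv \<Phi> (lap f)"
proof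
  fix x
  have "lap (conv \<Phi> f) x = (\<Sum>b\<in>Basis. conv \<Phi> (dd b (dd b f)) x)"
    by (simp add: lap_def dd_conv \<Phi> f test_function_dd)
  also have "\<dots> = conv \<Phi> (lap f) x"
    unfolding conv_def lap_def sum_distrib_left
    by (intro Bochner_Integration.integral_sum[symmetric] integrable_conv \<Phi> test_function_dd f)
  finally show "lap (conv \<Phi> f) x = conv \<Phi> (lap f) x" .
qed

text \<open>The distributional equation \<open>\<Delta>\<Phi> = \<delta>\<close>, tested at the origin.\<close>

definition fundamental_solution :: "('a::euclidean_space \<Rightarrow> real) \<Rightarrow> bool" where
  "fundamental_solution \<Phi> \<longleftrightarrow> locally_integrable \<Phi> \<and>
     (\<forall>f. test_function f \<longrightarrow> (\<integral>z. \<Phi> z * lap f z \<partial>lborel) = f 0)"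

text \<open>Move the Laplacian onto the test function, reflect it, and evaluate the defining property of
  \<open>\<Phi>\<close> at the reflected test function \<open>z \<mapsto> f (x - z)\<close>, whose value at the origin is \<open>f x\<close>.\<close>

lemma lap_conv_fundamental_solution:
  assumes "fundamental_solution \<Phi>" "test_function f"
  shows "lap (conv \<Phi> f) x = f x"
proof -
  have "lap (conv \<Phi> f) x = (\<integral>z. \<Phi> z * lap (\<lambda>z. f (x - z)) z \<partial>lborel)"
    using assms by (simp add: lap_conv fundamental_solution_def conv_def lap_reflect test_smooth)
  then show ?thesis
    using assms by (simp add: fundamental_solution_def test_function_reflect)
qed

lemma locally_integrable_continuous:
  assumes "continuous_on UNIV (\<Phi> :: 'a::euclidean_space \<Rightarrow> real)" shows "locally_integrable \<Phi>"
  unfolding locally_integrable_def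
proof
  fix r
  show "integrable lborel (\<lambda>z. indicator (cball 0 r) z * \<Phi> z)"
    using borel_integrable_compact[OF compact_cball continuous_on_subset[OF assms subset_UNIV], of 0 r]
    by (simp add: mult.commute indicator_def if_distrib cong: if_cong)
qed

lemma integrable_test: "test_function f \<Longrightarrow> integrable lborel f"
  using integrable_mult_test[OF locally_integrable_continuous[OF continuous_on_const[of _ 1]]] by simp

lemma lborel_integral_reflect:
  fixes f :: "'a::euclidean_space \<Rightarrow> real"
  assumes [measurable]: "f \<in> borel_measurable borel"
  shows "(\<integral>z. f (x - z) \<partial>lborel) = (\<integral>z. f z \<partial>lborel)"
proof -
  have "(\<integral>z. f z \<partial>lborel) = (\<integral>z. f z \<partial>distr lborel borel (\<lambda>z. x + (-1) *\<^sub>R z))"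
    by (subst lborel_affine[of "-1" x]) (simp_all add: density_1)
  also have "\<dots> = (\<integral>z. f (x - z) \<partial>lborel)"
    by (subst integral_distr) auto
  finally show ?thesis ..
qed

text \<open>The integral of \<open>f (x - z)\<close> over \<open>z\<close> does not depend on \<open>x\<close>; differentiate it in \<open>x\<close>.\<close>

lemma integral_dd_test:
  assumes f: "test_function f" shows "(\<integral>z. dd u f z \<partial>lborel) = 0"
proof -
  have one: "locally_integrable (\<lambda>_::'a. 1)" by (rule locally_integrable_continuous) simp
  have m: "g \<in> borel_measurable borel" if "test_function g" for g :: "'a \<Rightarrow> real"
    using smooth_continuous[OF test_smooth[OF that], of UNIV] by (simp add: borel_measurable_continuous_onI)
  have c: "conv (\<lambda>_. 1) g = (\<lambda>_. \<integral>z. g z \<partial>lborel)" if "test_function g" for g :: "'a \<Rightarrow> real"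
    using lborel_integral_reflect[OF m[OF that]] by (simp add: conv_def fun_eq_iff)
  have "(\<integral>z. dd u f z \<partial>lborel) = conv (\<lambda>_. 1) (dd u f) 0"
    using c[OF test_function_dd[OF f]] by simp
  also have "\<dots> = dd u (conv (\<lambda>_. 1) f) 0"
    by (simp add: dd_conv[OF one f])
  also have "\<dots> = 0"
    unfolding c[OF f] by (rule dd_eq[OF has_derivative_const])
  finally show ?thesis .
qed

text \<open>The integrands differ by the divergence of \<open>A grad f - f grad A\<close>, which is compactly
  supported.\<close>

lemma green_identity:
  assumes A: "smooth A" and f: "test_function f"
  shows "(\<integral>z. A z * lap f z \<partial>lborel) = (\<integral>z. lap A z * f z \<partial>lborel)"
proof -
  note s = A test_smooth[OF f] smooth_dd smooth_mult
  define P where "P b z = A z * dd b f z - dd b A z * f z" for b z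
  have P: "test_function (P b)" for b
    unfolding P_def[abs_def] using A f
    by (intro test_function_diff test_function_mult test_function_dd smooth_dd)
  have "dd b (P b) z = A z * dd b (dd b f) z - dd b (dd b A) z * f z" for b z
    unfolding P_def[abs_def]
    by (subst dd_diff, (intro s)+, subst dd_mult, (intro s)+, subst dd_mult, (intro s)+) simp
  then have "A z * lap f z = lap A z * f z + (\<Sum>b\<in>Basis. dd b (P b) z)" for z
    by (simp add: lap_def sum_distrib_left sum_distrib_right sum_subtractf)
  then have "(\<integral>z. A z * lap f z \<partial>lborel) = (\<integral>z. lap A z * f z + (\<Sum>b\<in>Basis. dd b (P b) z) \<partial>lborel)"
    by simp
  also have "\<dots> = (\<integral>z. lap A z * f z \<partial>lborel) + (\<Sum>b\<in>Basis. (\<integral>z. dd b (P b) z \<partial>lborel))"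
    by (subst Bochner_Integration.integral_add)
      (auto intro!: integrable_test test_function_mult smooth_lap A f test_function_dd P
        Bochner_Integration.integrable_sum Bochner_Integration.integral_sum)
  finally show ?thesis by (simp add: integral_dd_test[OF P])
qed

lemma smooth_powr:
  fixes q :: "'a::real_normed_vector \<Rightarrow> real" and a :: real
  assumes q: "smooth q" and pos: "\<And>x. q x > 0"
  shows "smooth (\<lambda>x. q x powr a)"
    and "dd u (\<lambda>x. q x powr a) x = a * q x powr (a - 1) * dd u q x"
proof -
  have der: "((\<lambda>x. q x powr a) has_derivative (\<lambda>u. a * q x powr (a - 1) * dd u q x)) (at x)" for x a
  proof -
    have "((\<lambda>y. y powr a) has_derivative (\<lambda>h. a * q x powr (a - 1) * h)) (at (q x))"
      using has_real_derivative_powr[OF pos] by (simp add: has_field_derivative_def)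
    from has_derivative_compose[OF smooth_has_derivative[OF q] this] show ?thesis .
  qed
  then show "dd u (\<lambda>x. q x powr a) x = a * q x powr (a - 1) * dd u q x" by (rule dd_eq)
  show "smooth (\<lambda>x. q x powr a)"
  proof (rule smoothI_derivative[where P = "\<lambda>g. \<exists>p a. smooth p \<and> g = (\<lambda>x. p x * q x powr a)"])
    show "\<exists>p a'. smooth p \<and> (\<lambda>x. q x powr a) = (\<lambda>x. p x * q x powr a')"
      by (rule exI[of _ "\<lambda>_. 1"]) auto
    fix g assume "\<exists>p a. smooth p \<and> g = (\<lambda>x. p x * q x powr a)"
    then obtain p a where p: "smooth p" and g: "g = (\<lambda>x. p x * q x powr a)" by blast
    have s: "q x powr a = q x * q x powr (a - 1)" for x
      using pos[of x] by (simp add: powr_diff)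
    have "(g has_derivative (\<lambda>u. p x * (a * q x powr (a - 1) * dd u q x) + dd u p x * q x powr a)) (at x)" for x
      unfolding g by (rule has_derivative_mult[OF smooth_has_derivative[OF p] der])
    moreover have "p x * (a * q x powr (a - 1) * dd u q x) + dd u p x * q x powr a
        = (p x * (a * dd u q x) + dd u p x * q x) * q x powr (a - 1)" for u x
      unfolding s[of x] by (simp add: algebra_simps)
    moreover have "smooth (\<lambda>x. p x * (a * dd u q x) + dd u p x * q x)" for u
      by (intro smooth_add smooth_mult smooth_const smooth_dd p q)
    ultimately show "\<exists>f'. (\<forall>x. (g has_derivative f' x) (at x)) \<and>
        (\<forall>u. \<exists>p a. smooth p \<and> (\<lambda>x. f' x u) = (\<lambda>x. p x * q x powr a))"
      by (intro exI[of _ "\<lambda>x u. (p x * (a * dd u q x) + dd u p x * q x) * q x powr (a - 1)"]) (simp, blast)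
  qed
qed

section \<open>The Newton kernel\<close>

lemma smooth_ident: "smooth (\<lambda>x. x)"
proof -
  have "Ck k (\<lambda>x::'a. x)" for k
    by (cases k) (auto intro: Ck_SucI[where f' = "\<lambda>_ u. u"] Ck_const simp del: Ck.simps(2))
  then show ?thesis by (simp add: smooth_def)
qed

text \<open>Comparison with a countable sum of multiples of indicator functions of balls, whose volumes are
  known; this plays the part of integration in polar coordinates.\<close>

lemma integrable_by_shells:
  fixes g :: "'a::euclidean_space \<Rightarrow> real"
  assumes m: "g \<in> borel_measurable borel"
    and c: "\<And>k. c k \<ge> 0" and r: "\<And>k. r k \<ge> 0"
    and sum: "summable (\<lambda>k. c k * r k ^ DIM('a))"
    and shell: "\<And>z. g z \<noteq> 0 \<Longrightarrow> \<exists>k::nat. norm z \<le> r k \<and> \<bar>g z\<bar> \<le> c k"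
  shows "integrable lborel g"
proof (rule integrableI_bounded)
  show "g \<in> borel_measurable lborel" using m by simp
  let ?V = "unit_ball_vol (real DIM('a))"
  have le: "ennreal (norm (g z)) \<le> (\<Sum>k. ennreal (c k) * indicator (cball 0 (r k)) z)" for z
  proof (cases "g z = 0")
    case False
    then obtain k where k: "norm z \<le> r k" "\<bar>g z\<bar> \<le> c k" using shell by blast
    then have "ennreal (norm (g z)) \<le> ennreal (c k) * indicator (cball 0 (r k)) z"
      by (simp add: ennreal_leI)
    also have "\<dots> = (\<Sum>j\<in>{k}. ennreal (c j) * indicator (cball 0 (r j)) z)"
      by (subst sum.insert) simp_all
    also have "\<dots> \<le> (\<Sum>k. ennreal (c k) * indicator (cball 0 (r k)) z)"
      by (rule sum_le_suminf) auto
    finally show ?thesis .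
  qed simp
  have "(\<integral>\<^sup>+z. ennreal (norm (g z)) \<partial>lborel)
      \<le> (\<integral>\<^sup>+z. (\<Sum>k. ennreal (c k) * indicator (cball (0::'a) (r k)) z) \<partial>lborel)"
    by (rule nn_integral_mono) (rule le)
  also have "\<dots> = (\<Sum>k. ennreal (c k) * emeasure lborel (cball (0::'a) (r k)))"
    by (subst nn_integral_suminf)
      (auto simp: nn_integral_cmult_indicator intro!: borel_measurable_times_ennreal borel_measurable_indicator)
  also have "\<dots> = (\<Sum>k. ennreal (?V * (c k * r k ^ DIM('a))))"
    using c r by (simp add: emeasure_cball ennreal_mult' [symmetric] mult_ac)
  also have "\<dots> = ennreal (\<Sum>k. ?V * (c k * r k ^ DIM('a)))"
    using c r by (intro suminf_ennreal2 summable_mult sum) auto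
  also have "\<dots> < \<infinity>" by simp
  finally show "(\<integral>\<^sup>+z. ennreal (norm (g z)) \<partial>lborel) < \<infinity>" .
qed

lemma locally_integrable_newton: "locally_integrable (\<lambda>z::real^3. 1 / norm z)"
  unfolding locally_integrable_def
proof
  fix r0 :: real
  define r where "r = max r0 1"
  have r: "r > 0" "r0 \<le> r" by (auto simp: r_def)
  show "integrable lborel (\<lambda>z::real^3. indicator (cball 0 r0) z * (1 / norm z))"
  \<comment> \<open>on the dyadic shell \<open>r / 2\<^sup>k\<^sup>+\<^sup>1 < norm z \<le> r / 2\<^sup>k\<close> the kernel is at most \<open>2\<^sup>k\<^sup>+\<^sup>1 / r\<close>\<close>
  proof (rule integrable_by_shells[where c = "\<lambda>k. 2 ^ Suc k / r" and r = "\<lambda>k. r / 2 ^ k"])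
    show "(\<lambda>z::real^3. indicator (cball 0 r0) z * (1 / norm z)) \<in> borel_measurable borel"
      by (intro borel_measurable_times borel_measurable_indicator borel_measurable_divide
          borel_measurable_const borel_measurable_norm) simp_all
    have "(\<lambda>k. (2 ^ Suc k / r) * (r / 2 ^ k) ^ DIM(real^3)) = (\<lambda>k. (2 * r\<^sup>2) * (1/4) ^ k)"
    proof
      fix k
      have "(2::real) ^ k * 2 ^ k = 4 ^ k" by (simp flip: power_mult_distrib)
      then show "(2 ^ Suc k / r) * (r / 2 ^ k) ^ DIM(real^3) = (2 * r\<^sup>2) * (1/4) ^ k"
        using r by (simp add: field_simps power2_eq_square power3_eq_cube)
    qed
    then show "summable (\<lambda>k. (2 ^ Suc k / r) * (r / 2 ^ k) ^ DIM(real^3))"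
      by (simp add: summable_mult summable_geometric)
    fix z :: "real^3"
    assume nz: "indicator (cball 0 r0) z * (1 / norm z) \<noteq> 0"
    show "\<exists>k. norm z \<le> r / 2 ^ k \<and> \<bar>indicator (cball 0 r0) z * (1 / norm z)\<bar> \<le> 2 ^ Suc k / r"
    proof (cases "z = 0")
      case True then show ?thesis using r by (intro exI[of _ 0]) auto
    next
      case False
      show ?thesis
      proof -
        have le: "norm z \<le> r" using nz r by (auto simp: indicator_def split: if_splits)
        define P where "P k \<longleftrightarrow> r / 2 ^ Suc k < norm z" for k
        obtain k where k: "P k" "\<And>j. j < k \<Longrightarrow> \<not> P j"
        proof -
          obtain n where "(1/2) ^ n < norm z / r"
            using real_arch_pow_inv[of "norm z / r" "1/2"] False r by auto
          then have "r / 2 ^ n < norm z" using r by (simp add: field_simps power_one_over)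
          moreover have "r / 2 ^ Suc n \<le> r / 2 ^ n" using r by (simp add: field_simps)
          ultimately have "P n" by (simp add: P_def)
          then show ?thesis using that exists_least_iff[of P] by blast
        qed
        have "norm z \<le> r / 2 ^ k"
        proof (cases k)
          case 0 then show ?thesis using le by simp
        next
          case (Suc j) then show ?thesis using k(2)[of j] by (simp add: P_def)
        qed
        moreover have "1 / norm z \<le> 2 ^ Suc k / r"
          using k(1) False r by (simp add: P_def field_simps)
        ultimately show ?thesis using r by (intro exI[of _ k]) (auto simp: indicator_def)
      qed
    qed
  qed (use r in auto)
qed

lemma lborel_integral_scale:
  fixes g :: "'a::euclidean_space \<Rightarrow> real"
  assumes [measurable]: "g \<in> borel_measurable borel" and c: "c > 0"
  shows "(\<integral>z. g z \<partial>lborel) = c ^ DIM('a) * (\<integral>z. g (c *\<^sub>R z) \<partial>lborel)"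
proof -
  have "(\<integral>z. g z \<partial>lborel)
      = (\<integral>z. g z \<partial>density (distr lborel borel (\<lambda>z. 0 + c *\<^sub>R z)) (\<lambda>_. ennreal (c ^ DIM('a))))"
    using c by (subst lborel_affine[of c 0]) (simp_all add: ennreal_power)
  also have "\<dots> = (\<integral>z. c ^ DIM('a) * g (c *\<^sub>R z) \<partial>lborel)"
    using c by (subst integral_density) (auto simp: integral_distr)
  finally show ?thesis by simp
qed

lemma square_powr:
  assumes "(s::real) > 0" shows "(s\<^sup>2) powr (-5/2) = 1 / s ^ 5"
proof -
  have "(s\<^sup>2) powr (-5/2) = (s powr 2) powr (-5/2)" using assms by simp
  also have "\<dots> = s powr (-5)" by (simp only: powr_powr) simp
  also have "\<dots> = 1 / s powr 5" by (rule powr_minus_divide)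
  finally show ?thesis using assms by simp
qed

text \<open>This is \<open>- \<Delta> (|w|\<^sup>2 + 1)\<^sup>-\<^sup>1\<^sup>/\<^sup>2\<close>. Its rescalings form an approximate identity, up to the factor
  \<open>total_mass\<close>.\<close>

definition mass_density :: "real^3 \<Rightarrow> real" where
  "mass_density w = 3 * (w \<bullet> w + 1) powr (-5/2)"

lemma continuous_mass_density: "continuous_on UNIV mass_density"
proof -
  have "w \<bullet> w + 1 \<noteq> 0" for w :: "real^3"
    using add_nonneg_pos[OF inner_ge_zero[of w] zero_less_one] by simp
  then show ?thesis unfolding mass_density_def by (intro continuous_intros) auto
qed

lemma integrable_mass_density: "integrable lborel mass_density"
proof (rule integrable_by_shells[where c = "\<lambda>k. 96 / 32 ^ k" and r = "\<lambda>k. 2 ^ k"])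
  show "mass_density \<in> borel_measurable borel"
    using continuous_mass_density by (rule borel_measurable_continuous_onI)
  have "(\<lambda>k. 96 / 32 ^ k * (2 ^ k) ^ DIM(real^3)) = (\<lambda>k. 96 * (1/4 :: real) ^ k)"
  proof
    fix k
    have "(2 ^ k :: real) ^ 3 = (2 ^ 3) ^ k" by (simp only: power_mult[symmetric] mult.commute)
    then have "(2 ^ k :: real) ^ 3 * 4 ^ k = 32 ^ k" by (simp flip: power_mult_distrib)
    then show "96 / 32 ^ k * (2 ^ k) ^ DIM(real^3) = 96 * (1/4 :: real) ^ k"
      by (simp add: field_simps power3_eq_cube)
  qed
  then show "summable (\<lambda>k. 96 / 32 ^ k * (2 ^ k :: real) ^ DIM(real^3))"
    by (simp add: summable_mult summable_geometric)
  fix w :: "real^3"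
  have pos: "w \<bullet> w + 1 > 0" by (simp add: add_nonneg_pos)
  show "\<exists>k. norm w \<le> 2 ^ k \<and> \<bar>mass_density w\<bar> \<le> 96 / 32 ^ k"
  proof (cases "norm w \<le> 1")
    case True
    have "(w \<bullet> w + 1) powr (-5/2) \<le> 1"
      using powr_mono2'[of "-5/2" 1 "w \<bullet> w + 1"] by simp
    with True show ?thesis by (intro exI[of _ 0]) (simp add: mass_density_def)
  next
    case False
    obtain k where k: "norm w \<le> 2 ^ k" "\<And>j. j < k \<Longrightarrow> \<not> norm w \<le> 2 ^ j"
      using exists_least_iff[of "\<lambda>k. norm w \<le> 2 ^ k"] real_arch_pow[of 2 "norm w"] less_imp_le
      by (metis one_less_numeral_iff semiring_norm(76))
    with False obtain j where j: "k = Suc j" by (cases k) auto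
    have "2 ^ j \<le> norm w" using k(2)[of j] j by simp
    then have "((2::real) ^ j)\<^sup>2 \<le> (norm w)\<^sup>2" by (rule power_mono) simp
    then have "((2::real) ^ j)\<^sup>2 \<le> w \<bullet> w + 1" unfolding dot_square_norm by linarith
    then have "(w \<bullet> w + 1) powr (-5/2) \<le> ((2 ^ j)\<^sup>2) powr (-5/2)"
      by (intro powr_mono2') auto
    also have "\<dots> = 1 / 32 ^ j"
    proof -
      have "(2 ^ j :: real) ^ 5 = (2 ^ 5) ^ j" by (simp only: power_mult[symmetric] mult.commute)
      then show ?thesis using square_powr[of "2 ^ j"] by simp
    qed
    finally show ?thesis using k(1) j
      by (intro exI[of _ k]) (simp add: mass_density_def)
  qed
qed auto


text \<open>The number \<open>4 \<pi>\<close>, by which the Newton kernel is normalised to a fundamental solution.\<close>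

definition total_mass :: real where
  "total_mass = (\<integral>w. mass_density w \<partial>lborel)"

lemma total_mass_pos: "total_mass > 0"
proof -
  have pos: "mass_density w > 0" for w
  proof -
    have "w \<bullet> w + 1 > 0" by (simp add: add_nonneg_pos)
    then show ?thesis by (simp add: mass_density_def)
  qed
  have "total_mass \<noteq> 0"
  proof
    assume "total_mass = 0"
    then have "AE w in lborel. mass_density w = 0"
      using integral_nonneg_eq_0_iff_AE[OF integrable_mass_density] pos
      by (simp add: total_mass_def less_imp_le)
    then have "AE w in (lborel :: (real^3) measure). False"
      using pos by (simp add: less_imp_neq[symmetric])
    then show False by (simp add: eventually_False ae_filter_eq_bot_iff)
  qed
  moreover have "total_mass \<ge> 0"
    unfolding total_mass_def using pos by (intro Bochner_Integration.integral_nonneg) (simp add: less_imp_le)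
  ultimately show ?thesis by simp
qed

lemma smooth_inner_self: "smooth (\<lambda>z::'a::real_inner. z \<bullet> z)"
  using smooth_ident[where 'a='a] by (simp add: smooth_def Ck_bilinear[OF bounded_bilinear_inner])

lemma dd_inner: "dd u (\<lambda>z::'a::real_inner. z \<bullet> z + c) z = 2 * (z \<bullet> u)" "dd u (\<lambda>z. z \<bullet> b) z = u \<bullet> b"
proof -
  have "((\<lambda>z::'a. z \<bullet> z + c) has_derivative (\<lambda>u. z \<bullet> u + u \<bullet> z)) (at z)"
    by (intro has_derivative_add_const has_derivative_inner has_derivative_ident)
  from dd_eq[OF this, of u] show "dd u (\<lambda>z::'a. z \<bullet> z + c) z = 2 * (z \<bullet> u)"
    by (simp add: inner_commute)
  show "dd u (\<lambda>z. z \<bullet> b) z = u \<bullet> b"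
    by (rule dd_eq) (intro has_derivative_inner_left has_derivative_ident)
qed

text \<open>The Newton kernel regularised at scale \<open>e\<close> is smooth, so the second Green identity applies to it
  directly, and its Laplacian is the mass density rescaled to scale \<open>e\<close>.\<close>

context
  fixes e :: real and q N :: "real^3 \<Rightarrow> real"
  assumes e: "e > 0"
  defines "q \<equiv> \<lambda>z. z \<bullet> z + e\<^sup>2" and "N \<equiv> \<lambda>z. q z powr (-1/2)"
begin

lemma q_pos: "q z > 0" using e by (simp add: q_def add_nonneg_pos)

lemma q_smooth: "smooth q"
  unfolding q_def by (intro smooth_add smooth_inner_self smooth_const)

lemma dd_q: "dd u q z = 2 * (z \<bullet> u)"
  unfolding q_def by (rule dd_inner)

lemma regularised_smooth: "smooth N"
  unfolding N_def by (rule smooth_powr[OF q_smooth q_pos])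

lemma regularised_lap: "lap N z = - 3 * e\<^sup>2 * q z powr (-5/2)"
proof -
  have 1: "dd b N = (\<lambda>z. - (z \<bullet> b) * q z powr (-3/2))" for b
    unfolding N_def by (simp add: fun_eq_iff smooth_powr(2)[OF q_smooth q_pos] dd_q)
  have sb: "smooth (\<lambda>z::real^3. - (z \<bullet> b))" for b
    using smooth_diff[OF smooth_const[of 0] smooth_inner[OF smooth_ident]] by simp
  have "dd b (\<lambda>z::real^3. - (z \<bullet> b)) z = - (b \<bullet> b)" for b z
    using dd_minus[OF smooth_inner[OF smooth_ident], of b b] by (simp add: dd_inner fun_eq_iff)
  then have dd2: "dd b (dd b N) z = - (z \<bullet> b) * (-3/2 * q z powr (-5/2) * (2 * (z \<bullet> b))) - (b \<bullet> b) * q z powr (-3/2)"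
    for b
    unfolding 1 by (subst dd_mult[OF sb smooth_powr(1)[OF q_smooth q_pos]])
      (simp add: smooth_powr(2)[OF q_smooth q_pos] dd_q)
  have "lap N z = (\<Sum>b\<in>Basis. 3 * q z powr (-5/2) * ((z \<bullet> b) * (z \<bullet> b)) - q z powr (-3/2))"
    unfolding lap_def by (intro sum.cong) (simp_all add: dd2 inner_same_Basis algebra_simps)
  also have "\<dots> = 3 * q z powr (-5/2) * (z \<bullet> z) - 3 * q z powr (-3/2)"
    by (subst (3) euclidean_inner) (simp add: sum_subtractf sum_distrib_left)
  also have "q z powr (-3/2) = q z powr (-5/2) * q z"
    using powr_add[of "q z" "-5/2" 1] q_pos[of z] by simp
  finally show ?thesis by (simp add: q_def algebra_simps)
qed

lemma regularised_le: "N z \<le> 1 / norm z" if "z \<noteq> 0"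
proof -
  have "N z \<le> (z \<bullet> z) powr (-1/2)"
    unfolding N_def using that by (intro powr_mono2') (auto simp: q_def)
  also have "\<dots> = 1 / norm z"
    using that by (simp add: powr_minus_divide powr_half_sqrt norm_eq_sqrt_inner)
  finally show ?thesis .
qed

lemma regularised_integral:
  assumes f: "test_function f"
  shows "(\<integral>z. N z * lap f z \<partial>lborel) = - (\<integral>w. mass_density w * f (e *\<^sub>R w) \<partial>lborel)"
proof -
  have cf: "continuous_on UNIV f" by (rule smooth_continuous[OF test_smooth[OF f]])
  have cq: "continuous_on UNIV (\<lambda>z. q z powr (-5/2))"
    by (rule smooth_continuous[OF smooth_powr(1)[OF q_smooth q_pos]])
  have "(\<integral>z. N z * lap f z \<partial>lborel) = (\<integral>z. - 3 * e\<^sup>2 * q z powr (-5/2) * f z \<partial>lborel)"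
    by (simp add: green_identity[OF regularised_smooth f] regularised_lap)
  also have "\<dots> = e ^ 3 * (\<integral>w. - 3 * e\<^sup>2 * q (e *\<^sub>R w) powr (-5/2) * f (e *\<^sub>R w) \<partial>lborel)"
    using e by (subst lborel_integral_scale[of _ e])
      (intro borel_measurable_continuous_onI continuous_on_mult continuous_on_const cf cq, simp_all)
  also have "\<dots> = (\<integral>w. - (mass_density w * f (e *\<^sub>R w)) \<partial>lborel)"
  proof -
    have "e ^ 3 * (- 3 * e\<^sup>2 * q (e *\<^sub>R w) powr (-5/2) * f (e *\<^sub>R w)) = - (mass_density w * f (e *\<^sub>R w))" for w
    proof -
      have "q (e *\<^sub>R w) = e\<^sup>2 * (w \<bullet> w + 1)"
        by (simp add: q_def power2_eq_square algebra_simps)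
      then have "q (e *\<^sub>R w) powr (-5/2) = (e\<^sup>2) powr (-5/2) * (w \<bullet> w + 1) powr (-5/2)"
        by (simp add: powr_mult)
      also have "(e\<^sup>2) powr (-5/2) = 1 / e ^ 5" by (rule square_powr[OF e])
      finally have "q (e *\<^sub>R w) powr (-5/2) = (w \<bullet> w + 1) powr (-5/2) / e ^ 5" by simp
      moreover have "e ^ 3 * e\<^sup>2 = e ^ 5" by (simp flip: power_add)
      ultimately show ?thesis using e by (simp add: mass_density_def field_simps)
    qed
    then show ?thesis
      by (simp only: Bochner_Integration.integral_mult_right_zero[symmetric])
  qed
  finally show ?thesis by simp
qed

end

text \<open>Let \<open>e \<rightarrow> 0\<close> in the identity for the regularised kernel. On the left the kernels increase to
  \<open>1 / |z|\<close>; on the right the mass concentrates at the origin. Both limits are by dominated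
  convergence.\<close>

lemma newton_lap:
  fixes f :: "real^3 \<Rightarrow> real"
  assumes f: "test_function f"
  shows "(\<integral>z. 1 / norm z * lap f z \<partial>lborel) = - total_mass * f 0"
proof -
  define e where "e n = inverse (real (Suc n))" for n
  have e: "e n > 0" "e \<longlonglongrightarrow> 0" for n
    unfolding e_def using LIMSEQ_inverse_real_of_nat by auto
  define N where "N n z = (z \<bullet> z + (e n)\<^sup>2) powr (-1/2)" for n and z :: "real^3"
  have cf: "continuous_on UNIV f" by (rule smooth_continuous[OF test_smooth[OF f]])
  have i: "integrable lborel (\<lambda>z::real^3. 1 / norm z * lap f z)"
    by (rule integrable_mult_test[OF locally_integrable_newton test_function_lap[OF f]])
  have lim1: "(\<lambda>n. \<integral>z. N n z * lap f z \<partial>lborel) \<longlonglongrightarrow> (\<integral>z. 1 / norm z * lap f z \<partial>lborel)"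
  proof (rule integral_dominated_convergence[OF _ _ integrable_abs[OF i]])
    show "(\<lambda>z. 1 / norm z * lap f z) \<in> borel_measurable lborel"
      using i by (rule borel_measurable_integrable)
    show "(\<lambda>z. N n z * lap f z) \<in> borel_measurable lborel" for n
      using smooth_continuous[OF smooth_mult[OF regularised_smooth[OF e(1)] smooth_lap[OF test_smooth[OF f]]], of UNIV n]
      by (simp add: N_def borel_measurable_continuous_onI)
    \<comment> \<open>at \<open>z = 0\<close> the kernel \<open>1 / norm z\<close> takes the value 0, so the convergence holds only off the origin\<close>
    show "AE z in lborel. (\<lambda>n. N n z * lap f z) \<longlonglongrightarrow> 1 / norm z * lap f z"
      using AE_lborel_singleton[of 0]
    proof eventually_elim
      fix z :: "real^3" assume z: "z \<noteq> 0"
      have "(\<lambda>n. N n z) \<longlonglongrightarrow> (z \<bullet> z + 0\<^sup>2) powr (-1/2)"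
        unfolding N_def using z by (intro tendsto_intros e) auto
      also have "(z \<bullet> z + 0\<^sup>2) powr (-1/2) = 1 / norm z"
        using z by (simp add: powr_minus_divide powr_half_sqrt norm_eq_sqrt_inner)
      finally show "(\<lambda>n. N n z * lap f z) \<longlonglongrightarrow> 1 / norm z * lap f z"
        by (intro tendsto_intros)
    qed
    show "AE z in lborel. norm (N n z * lap f z) \<le> \<bar>1 / norm z * lap f z\<bar>" for n
      using AE_lborel_singleton[of 0]
    proof eventually_elim
      fix z :: "real^3" assume z: "z \<noteq> 0"
      show "norm (N n z * lap f z) \<le> \<bar>1 / norm z * lap f z\<bar>"
        using mult_right_mono[OF regularised_le[OF e(1) z, of n] abs_ge_zero[of "lap f z"]]
        by (simp add: N_def abs_mult)
    qed
  qed
  obtain M where M: "\<And>x. \<bar>f x\<bar> \<le> M" using test_function_bounded[OF f] by blast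
  have lim2: "(\<lambda>n. \<integral>w. mass_density w * f (e n *\<^sub>R w) \<partial>lborel) \<longlonglongrightarrow> (\<integral>w. mass_density w * f 0 \<partial>lborel)"
  proof (rule integral_dominated_convergence[OF _ _ integrable_mult_right[OF integrable_mass_density, of M]])
    show "(\<lambda>w. mass_density w * f 0) \<in> borel_measurable lborel"
      "(\<lambda>w. mass_density w * f (e n *\<^sub>R w)) \<in> borel_measurable lborel" for n
      by (auto intro!: borel_measurable_continuous_onI continuous_intros continuous_mass_density
          continuous_on_compose2[OF cf])
    have "(\<lambda>n. f (e n *\<^sub>R w)) \<longlonglongrightarrow> f (0 *\<^sub>R w)" for w
      by (rule continuous_on_tendsto_compose[OF cf]) (intro tendsto_scaleR e tendsto_const, simp_all)
    then show "AE w in lborel. (\<lambda>n. mass_density w * f (e n *\<^sub>R w)) \<longlonglongrightarrow> mass_density w * f 0"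
      by (auto intro!: tendsto_intros)
    have "mass_density w \<ge> 0" for w by (simp add: mass_density_def)
    then show "AE w in lborel. norm (mass_density w * f (e n *\<^sub>R w)) \<le> M * mass_density w" for n
      using M by (intro AE_I2) (simp add: abs_mult mult.commute[of M] mult_left_mono)
  qed
  have "(\<lambda>n. \<integral>z. N n z * lap f z \<partial>lborel) \<longlonglongrightarrow> - (\<integral>w. mass_density w * f 0 \<partial>lborel)"
    unfolding N_def regularised_integral[OF e(1) f] by (intro tendsto_minus lim2)
  from LIMSEQ_unique[OF lim1 this] show ?thesis by (simp add: total_mass_def)
qed

section \<open>Fundamental solutions that are small on a half-space\<close>

lemma integral_test_eq_cbox:
  fixes f g :: "'a::euclidean_space \<Rightarrow> real"
  assumes f: "test_function f" and g: "continuous_on UNIV g"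
    and supp: "\<And>z. f z \<noteq> 0 \<Longrightarrow> z \<in> cbox A B"
  shows "(\<integral>z. g z * f z \<partial>lborel) = integral (cbox A B) (\<lambda>z. g z * f z)"
proof -
  have "(\<integral>z. g z * f z \<partial>lborel) = integral UNIV (\<lambda>z. g z * f z)"
    by (rule integral_lborel[symmetric]) (rule integrable_mult_test[OF locally_integrable_continuous[OF g] f])
  also have "\<dots> = integral UNIV (\<lambda>z. if z \<in> cbox A B then g z * f z else 0)"
    using supp by (intro arg_cong[where f = "integral UNIV"]) (auto simp: fun_eq_iff)
  also have "\<dots> = integral (cbox A B) (\<lambda>z. g z * f z)"
    by (rule integral_restrict_UNIV)
  finally show ?thesis .
qed

lemma test_function_support_cbox:
  fixes f :: "'a::euclidean_space \<Rightarrow> real"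
  assumes "test_function f" obtains A B where "\<And>z. f z \<noteq> 0 \<Longrightarrow> z \<in> cbox A B"
proof -
  from assms obtain R where "\<And>x. R < norm x \<Longrightarrow> f x = 0" by (auto simp: test_function_def)
  then have "z \<in> cball 0 R" if "f z \<noteq> 0" for z using that by (force simp: not_less[symmetric])
  moreover obtain A B where "cball (0::'a) R \<subseteq> cbox A B"
    using bounded_subset_cbox_symmetric[OF bounded_cball] by metis
  ultimately show ?thesis using that by blast
qed

lemma continuous_integral_kernel:
  fixes k :: "'a::euclidean_space \<Rightarrow> 'p::euclidean_space \<Rightarrow> real"
  assumes k: "continuous_on UNIV (\<lambda>(z, p). k z p)"
  shows "continuous_on UNIV (\<lambda>z. integral (cbox P Q) (k z))"
  by (rule integral_continuous_on_param) (rule continuous_on_subset[OF k], simp)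

text \<open>A superposition of kernels that annihilate a test function annihilates it too. The compact
  support turns the integral over all of space into one over a box, where the order of integration
  of a continuous function may be exchanged.\<close>

lemma integral_kernel_test:
  fixes k :: "'a::euclidean_space \<Rightarrow> 'p::euclidean_space \<Rightarrow> real"
  assumes k: "continuous_on UNIV (\<lambda>(z, p). k z p)"
    and zero: "\<And>p. (\<integral>z. k z p * f z \<partial>lborel) = 0" and f: "test_function f"
  shows "(\<integral>z. integral (cbox P Q) (k z) * f z \<partial>lborel) = 0"
proof -
  have c: "continuous_on UNIV (\<lambda>z. integral (cbox P Q) (k z))"
    by (rule continuous_integral_kernel[OF k])
  obtain A B where AB: "\<And>z. f z \<noteq> 0 \<Longrightarrow> z \<in> cbox A B"
    using test_function_support_cbox[OF f] by blast
  have cf: "continuous_on UNIV f" by (rule smooth_continuous[OF test_smooth[OF f]])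
  have ck: "continuous_on UNIV (\<lambda>z. k z p)" for p
    using continuous_on_compose2[OF k, of UNIV "\<lambda>z. (z, p)"] by (simp add: continuous_intros)
  have ck2: "continuous_on (cbox (A, P) (B, Q)) (\<lambda>(z, p). k z p * f z)"
  proof -
    have "continuous_on UNIV (\<lambda>x. (case x of (z, p) \<Rightarrow> k z p) * f (fst x))"
      by (intro continuous_on_mult k continuous_on_compose2[OF cf] continuous_on_fst continuous_on_id) auto
    then show ?thesis by (rule continuous_on_subset[OF continuous_on_eq]) (auto simp: split_beta)
  qed
  have "(\<integral>z. integral (cbox P Q) (k z) * f z \<partial>lborel)
      = integral (cbox A B) (\<lambda>z. integral (cbox P Q) (k z) * f z)"
    by (rule integral_test_eq_cbox[OF f c AB])
  also have "\<dots> = integral (cbox A B) (\<lambda>z. integral (cbox P Q) (\<lambda>p. k z p * f z))"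
    by simp
  also have "\<dots> = integral (cbox P Q) (\<lambda>p. integral (cbox A B) (\<lambda>z. k z p * f z))"
    by (rule integral_swap_continuous[OF ck2])
  also have "\<dots> = 0"
    using integral_test_eq_cbox[OF f ck AB] zero by simp
  finally show "(\<integral>z. integral (cbox P Q) (k z) * f z \<partial>lborel) = 0" .
qed

text \<open>The real part of \<open>(A - \<i> B) exp (z \<bullet> (\<alpha> + \<i> \<beta>))\<close>. This family is closed under
  differentiation.\<close>

definition plane_wave :: "'a::real_inner \<Rightarrow> 'a \<Rightarrow> real \<Rightarrow> real \<Rightarrow> 'a \<Rightarrow> real" where
  "plane_wave \<alpha> \<beta> A B z = exp (z \<bullet> \<alpha>) * (A * cos (z \<bullet> \<beta>) + B * sin (z \<bullet> \<beta>))"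

lemma plane_wave_has_derivative:
  "(plane_wave \<alpha> \<beta> A B has_derivative
     (\<lambda>u. plane_wave \<alpha> \<beta> ((u \<bullet> \<alpha>) * A + (u \<bullet> \<beta>) * B) ((u \<bullet> \<alpha>) * B - (u \<bullet> \<beta>) * A) z)) (at z)"
  unfolding plane_wave_def[abs_def]
  by (rule has_derivative_eq_rhs, (rule derivative_intros)+) (auto simp: fun_eq_iff algebra_simps)

lemma plane_wave_smooth: "smooth (plane_wave \<alpha> \<beta> A B)"
proof (rule smoothI_derivative[where P = "\<lambda>g. \<exists>A B. g = plane_wave \<alpha> \<beta> A B"])
  fix g assume "\<exists>A B. g = plane_wave \<alpha> \<beta> A B"
  then obtain A B where g: "g = plane_wave \<alpha> \<beta> A B" by blast
  show "\<exists>f'. (\<forall>x. (g has_derivative f' x) (at x)) \<and> (\<forall>u. \<exists>A B. (\<lambda>x. f' x u) = plane_wave \<alpha> \<beta> A B)"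
    unfolding g
    by (intro exI[of _ "\<lambda>z u. plane_wave \<alpha> \<beta> ((u \<bullet> \<alpha>) * A + (u \<bullet> \<beta>) * B) ((u \<bullet> \<alpha>) * B - (u \<bullet> \<beta>) * A) z"]
        conjI allI plane_wave_has_derivative) blast
qed blast

text \<open>The Laplacian multiplies \<open>exp (z \<bullet> \<zeta>)\<close>, for a complex vector \<open>\<zeta> = \<alpha> + \<i> \<beta>\<close>, by the sum of the
  squares of the components of \<open>\<zeta>\<close>, which is \<open>\<alpha> \<bullet> \<alpha> - \<beta> \<bullet> \<beta> + 2 \<i> (\<alpha> \<bullet> \<beta>)\<close>.\<close>

lemma plane_wave_harmonic:
  fixes \<alpha> \<beta> :: "'a::euclidean_space"
  assumes "\<alpha> \<bullet> \<alpha> = \<beta> \<bullet> \<beta>" "\<alpha> \<bullet> \<beta> = 0"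
  shows "lap (plane_wave \<alpha> \<beta> A B) z = 0"
proof -
  have dd: "dd u (plane_wave \<alpha> \<beta> A B)
      = plane_wave \<alpha> \<beta> ((u \<bullet> \<alpha>) * A + (u \<bullet> \<beta>) * B) ((u \<bullet> \<alpha>) * B - (u \<bullet> \<beta>) * A)" for u A B
    using dd_eqI[OF plane_wave_has_derivative] by (simp add: fun_eq_iff)
  have "lap (plane_wave \<alpha> \<beta> A B) z = (\<Sum>b\<in>Basis. exp (z \<bullet> \<alpha>) *
      ((((\<alpha> \<bullet> b) * (\<alpha> \<bullet> b) - (\<beta> \<bullet> b) * (\<beta> \<bullet> b)) * A + 2 * ((\<alpha> \<bullet> b) * (\<beta> \<bullet> b)) * B) * cos (z \<bullet> \<beta>)
      + (((\<alpha> \<bullet> b) * (\<alpha> \<bullet> b) - (\<beta> \<bullet> b) * (\<beta> \<bullet> b)) * B - 2 * ((\<alpha> \<bullet> b) * (\<beta> \<bullet> b)) * A) * sin (z \<bullet> \<beta>)))"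
    unfolding lap_def dd plane_wave_def
    by (intro sum.cong refl) (simp add: inner_commute algebra_simps)
  also have "\<dots> = exp (z \<bullet> \<alpha>) *
      (((\<alpha> \<bullet> \<alpha> - \<beta> \<bullet> \<beta>) * A + 2 * (\<alpha> \<bullet> \<beta>) * B) * cos (z \<bullet> \<beta>)
      + ((\<alpha> \<bullet> \<alpha> - \<beta> \<bullet> \<beta>) * B - 2 * (\<alpha> \<bullet> \<beta>) * A) * sin (z \<bullet> \<beta>))"
    unfolding euclidean_inner[of \<alpha> \<alpha>] euclidean_inner[of \<beta> \<beta>] euclidean_inner[of \<alpha> \<beta>]
    by (simp add: sum_distrib_left sum_distrib_right sum_subtractf[symmetric] sum.distrib[symmetric])
  finally show ?thesis using assms by simp
qed

text \<open>In polar coordinates \<open>(r, t)\<close> for \<open>(b, c)\<close> the integrand is \<open>a / (a\<^sup>2 + r\<^sup>2 cos\<^sup>2 (\<phi> - t))\<close>, and with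
  \<open>D\<^sup>2 = a\<^sup>2 + r\<^sup>2\<close> and \<open>k = a / D\<close> an antiderivative is \<open>arctan (k tan (\<phi> - t)) / D\<close>, which jumps where
  the tangent does. The addition theorem rewrites it as the sum of \<open>(\<phi> - t) / D\<close> and a
  \<open>2\<pi>\<close>-periodic function without jumps, so only the linear part contributes.\<close>

lemma has_integral_inverse_distance:
  fixes a b c :: real
  assumes a: "a > 0"
  shows "((\<lambda>\<phi>. a / (a\<^sup>2 + (b * cos \<phi> + c * sin \<phi>)\<^sup>2)) has_integral
    2 * pi / sqrt (a\<^sup>2 + b\<^sup>2 + c\<^sup>2)) {0..2 * pi}"
proof -
  obtain r t where bc: "b = r * cos t" "c = r * sin t" using polar_Ex by blast
  define D where "D = sqrt (a\<^sup>2 + b\<^sup>2 + c\<^sup>2)"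
  have D2: "D\<^sup>2 = a\<^sup>2 + r\<^sup>2"
  proof -
    have "b\<^sup>2 + c\<^sup>2 = r\<^sup>2 * ((cos t)\<^sup>2 + (sin t)\<^sup>2)"
      unfolding bc by (simp only: power_mult_distrib distrib_left)
    then show ?thesis by (simp add: D_def add.assoc)
  qed
  have D: "D > 0" using a by (simp add: D_def add_pos_nonneg)
  define k where "k = a / D"
  have k: "k > 0" using a D by (simp add: k_def)
  define F where "F \<phi> = (\<phi> - t + arctan ((k - 1) * (sin (\<phi> - t) * cos (\<phi> - t)) /
     ((cos (\<phi> - t))\<^sup>2 + k * (sin (\<phi> - t))\<^sup>2))) / D" for \<phi>
  have der: "(F has_real_derivative a / (a\<^sup>2 + (b * cos \<phi> + c * sin \<phi>)\<^sup>2)) (at \<phi>)" for \<phi>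
  proof -
    define s co where "s = sin (\<phi> - t)" and "co = cos (\<phi> - t)"
    have sc: "co\<^sup>2 + s\<^sup>2 = 1" by (simp add: s_def co_def)
    have pos: "co\<^sup>2 + k * s\<^sup>2 > 0" "co\<^sup>2 + k\<^sup>2 * s\<^sup>2 > 0"
      using sc k by (cases "s = 0"; auto intro!: add_nonneg_pos)+
    define u where "u = (k - 1) * (s * co) / (co\<^sup>2 + k * s\<^sup>2)"
    define q where "q = co\<^sup>2 + k * s\<^sup>2"
    define m where "m = (k - 1) * (co * co - s * s) * q - (k - 1) * (s * co) * (2 * co * (- s) + k * (2 * s * co))"
    have "((\<lambda>\<phi>. (k - 1) * (sin (\<phi> - t) * cos (\<phi> - t))) has_real_derivative (k - 1) * (co * co - s * s)) (at \<phi>)"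
      by (auto intro!: derivative_eq_intros simp: s_def co_def)
    moreover have "((\<lambda>\<phi>. (cos (\<phi> - t))\<^sup>2 + k * (sin (\<phi> - t))\<^sup>2) has_real_derivative
        2 * co * (- s) + k * (2 * s * co)) (at \<phi>)"
      by (auto intro!: derivative_eq_intros simp: s_def co_def)
    ultimately have "((\<lambda>\<phi>. (k - 1) * (sin (\<phi> - t) * cos (\<phi> - t)) / ((cos (\<phi> - t))\<^sup>2 + k * (sin (\<phi> - t))\<^sup>2))
        has_real_derivative m / (q * q)) (at \<phi>)"
      using DERIV_divide[of _ _ \<phi> UNIV] pos(1) unfolding m_def q_def s_def co_def by fastforce
    then have "((\<lambda>\<phi>. arctan ((k - 1) * (sin (\<phi> - t) * cos (\<phi> - t)) / ((cos (\<phi> - t))\<^sup>2 + k * (sin (\<phi> - t))\<^sup>2)))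
        has_real_derivative inverse (1 + u\<^sup>2) * (m / (q * q))) (at \<phi>)"
      unfolding u_def s_def co_def by (rule DERIV_chain2[OF DERIV_arctan])
    moreover have "((\<lambda>\<phi>. \<phi> - t) has_real_derivative 1) (at \<phi>)"
      by (auto intro!: derivative_eq_intros)
    ultimately have "(F has_real_derivative (1 + inverse (1 + u\<^sup>2) * (m / (q * q))) / D) (at \<phi>)"
      unfolding F_def[abs_def] by (intro DERIV_cdivide DERIV_add)
    moreover have "(1 + inverse (1 + u\<^sup>2) * (m / (q * q))) / D = a / (a\<^sup>2 + (b * cos \<phi> + c * sin \<phi>)\<^sup>2)"
    proof -
      have "m = (k - 1) * (co\<^sup>2 - k * s\<^sup>2) * (co\<^sup>2 + s\<^sup>2)"
        by (simp add: m_def q_def power2_eq_square algebra_simps)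
      then have num: "m = (k - 1) * (co\<^sup>2 - k * s\<^sup>2)" by (simp add: sc)
      have "(co\<^sup>2 + k * s\<^sup>2)\<^sup>2 * (1 + u\<^sup>2) = (co\<^sup>2 + k * s\<^sup>2)\<^sup>2 + ((k - 1) * (s * co))\<^sup>2"
        using pos(1) by (simp add: u_def power_divide distrib_left)
      also have "\<dots> = (co\<^sup>2 + k\<^sup>2 * s\<^sup>2) * (co\<^sup>2 + s\<^sup>2)"
        by (simp add: power2_eq_square algebra_simps)
      finally have den: "(co\<^sup>2 + k * s\<^sup>2)\<^sup>2 * (1 + u\<^sup>2) = co\<^sup>2 + k\<^sup>2 * s\<^sup>2" by (simp add: sc)
      have "1 + (k - 1) * (co\<^sup>2 - k * s\<^sup>2) / (co\<^sup>2 + k\<^sup>2 * s\<^sup>2) = (k * (co\<^sup>2 + s\<^sup>2)) / (co\<^sup>2 + k\<^sup>2 * s\<^sup>2)"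
        using pos(2) by (simp add: field_simps power2_eq_square)
      also have "\<dots> / D = a / (D\<^sup>2 * co\<^sup>2 + a\<^sup>2 * s\<^sup>2)"
      proof -
        have "D\<^sup>2 * (co\<^sup>2 + k\<^sup>2 * s\<^sup>2) = D\<^sup>2 * co\<^sup>2 + a\<^sup>2 * s\<^sup>2"
          using D by (simp add: k_def power_divide distrib_left)
        moreover have "k / (co\<^sup>2 + k\<^sup>2 * s\<^sup>2) / D = a / (D\<^sup>2 * (co\<^sup>2 + k\<^sup>2 * s\<^sup>2))"
          using D by (simp add: k_def power2_eq_square)
        ultimately show ?thesis by (simp add: sc)
      qed
      also have "D\<^sup>2 * co\<^sup>2 + a\<^sup>2 * s\<^sup>2 = a\<^sup>2 * (co\<^sup>2 + s\<^sup>2) + (r * co)\<^sup>2"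
        unfolding D2 by (simp add: power_mult_distrib algebra_simps)
      also have "r * co = b * cos \<phi> + c * sin \<phi>"
        by (simp add: co_def cos_diff bc algebra_simps)
      finally have "(1 + (k - 1) * (co\<^sup>2 - k * s\<^sup>2) / (co\<^sup>2 + k\<^sup>2 * s\<^sup>2)) / D = a / (a\<^sup>2 + (b * cos \<phi> + c * sin \<phi>)\<^sup>2)"
        by (simp add: sc)
      moreover have "inverse (1 + u\<^sup>2) * (m / (q * q)) = m / ((co\<^sup>2 + k * s\<^sup>2)\<^sup>2 * (1 + u\<^sup>2))"
        by (simp add: q_def power2_eq_square divide_inverse)
      ultimately show ?thesis unfolding num den by simp
    qed
    ultimately show ?thesis by simp
  qed
  have "((\<lambda>\<phi>. a / (a\<^sup>2 + (b * cos \<phi> + c * sin \<phi>)\<^sup>2)) has_integral F (2 * pi) - F 0) {0..2 * pi}"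
    by (rule fundamental_theorem_of_calculus)
      (auto intro!: has_field_derivative_at_within[OF der] simp flip: has_real_derivative_iff_has_vector_derivative)
  moreover have "F (2 * pi) - F 0 = 2 * pi / D"
    by (simp add: F_def sin_diff cos_diff diff_divide_distrib[symmetric])
  ultimately show ?thesis by (simp add: D_def)
qed

lemma has_integral_exp_cos:
  fixes a w S :: real
  assumes a: "a > 0" and S: "S \<ge> 0"
  shows "((\<lambda>s. exp (- (s * a)) * cos (s * w)) has_integral
    a / (a\<^sup>2 + w\<^sup>2) - exp (- (S * a)) * (a * cos (S * w) - w * sin (S * w)) / (a\<^sup>2 + w\<^sup>2)) {0..S}"
proof -
  have pos: "a\<^sup>2 + w\<^sup>2 > 0" using a by (simp add: add_pos_nonneg)
  define F where "F s = - exp (- (s * a)) * (a * cos (s * w) - w * sin (s * w)) / (a\<^sup>2 + w\<^sup>2)" for s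
  have der: "(F has_real_derivative exp (- (s * a)) * cos (s * w)) (at s)" for s
  proof -
    have "((\<lambda>s. - exp (- (s * a)) * (a * cos (s * w) - w * sin (s * w))) has_real_derivative
       (exp (- (s * a)) * a * (a * cos (s * w) - w * sin (s * w))
       - exp (- (s * a)) * (a * (- sin (s * w) * w) - w * (cos (s * w) * w)))) (at s)"
      by (auto intro!: derivative_eq_intros simp: algebra_simps)
    then have "(F has_real_derivative (exp (- (s * a)) * a * (a * cos (s * w) - w * sin (s * w))
       - exp (- (s * a)) * (a * (- sin (s * w) * w) - w * (cos (s * w) * w))) / (a\<^sup>2 + w\<^sup>2)) (at s)"
      unfolding F_def[abs_def] by (rule DERIV_cdivide)
    also have "(exp (- (s * a)) * a * (a * cos (s * w) - w * sin (s * w))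
       - exp (- (s * a)) * (a * (- sin (s * w) * w) - w * (cos (s * w) * w))) / (a\<^sup>2 + w\<^sup>2)
      = exp (- (s * a)) * cos (s * w) * (a\<^sup>2 + w\<^sup>2) / (a\<^sup>2 + w\<^sup>2)"
      by (simp add: power2_eq_square algebra_simps)
    finally show ?thesis using pos a by simp
  qed
  have "((\<lambda>s. exp (- (s * a)) * cos (s * w)) has_integral F S - F 0) {0..S}"
    by (rule fundamental_theorem_of_calculus[OF S])
      (auto intro!: has_field_derivative_at_within[OF der] simp flip: has_real_derivative_iff_has_vector_derivative)
  then show ?thesis by (simp add: F_def)
qed


text \<open>Subtract from the Newton kernel the truncated superposition \<open>K\<close> of plane waves. The function \<open>K\<close>
  is annihilated by the Laplacian, so the difference is still a fundamental solution after
  normalisation, and on the half-space it equals the tail of the superposition.\<close>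

lemma half_space_fundamental_solution:
  fixes e f g :: "real^3"
  assumes ortho: "e \<bullet> e = 1" "f \<bullet> f = 1" "g \<bullet> g = 1" "e \<bullet> f = 0" "e \<bullet> g = 0" "f \<bullet> g = 0"
    and complete: "\<And>z. z \<bullet> z = (z \<bullet> e)\<^sup>2 + (z \<bullet> f)\<^sup>2 + (z \<bullet> g)\<^sup>2"
    and \<delta>: "\<delta> > 0" and \<epsilon>: "\<epsilon> > 0"
  obtains \<Phi> where "fundamental_solution \<Phi>" "\<And>z. z \<bullet> e \<le> - \<delta> \<Longrightarrow> \<bar>\<Phi> z\<bar> \<le> \<epsilon>"
proof -
  \<comment> \<open>the truncation point; the final estimate is \<open>exp (- S \<delta>) / (\<delta> total_mass) \<le> \<epsilon>\<close>\<close>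
  obtain S where S: "S \<ge> 0" "exp (- (S * \<delta>)) \<le> total_mass * \<epsilon> * \<delta>"
  proof
    define c where "c = total_mass * \<epsilon> * \<delta>"
    have c: "c > 0" using total_mass_pos \<delta> \<epsilon> by (simp add: c_def)
    show "max 0 (- ln c / \<delta>) \<ge> 0" by simp
    have "- ln c \<le> max 0 (- ln c / \<delta>) * \<delta>" using \<delta> by (simp add: max_mult_distrib_right)
    then have "exp (- (max 0 (- ln c / \<delta>) * \<delta>)) \<le> exp (ln c)" by simp
    also have "exp (ln c) = c" using c by simp
    finally show "exp (- (max 0 (- ln c / \<delta>) * \<delta>)) \<le> total_mass * \<epsilon> * \<delta>" unfolding c_def .
  qed
  define n where "n \<phi> = cos \<phi> *\<^sub>R f + sin \<phi> *\<^sub>R g" for \<phi> :: real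
  have n: "n \<phi> \<bullet> n \<phi> = 1" "e \<bullet> n \<phi> = 0" for \<phi>
    using ortho sin_cos_squared_add3[of \<phi>]
    by (simp_all add: n_def inner_add_left inner_add_right inner_commute algebra_simps)
  define k where "k z p = plane_wave (snd p *\<^sub>R e) (snd p *\<^sub>R n (fst p)) 1 0 z" for z and p :: "real \<times> real"
  have k_eq: "k z (\<phi>, s) = exp (- (s * (- (z \<bullet> e)))) * cos (s * ((z \<bullet> f) * cos \<phi> + (z \<bullet> g) * sin \<phi>))" for z \<phi> s
    by (simp add: k_def plane_wave_def n_def inner_add_right algebra_simps)
  have ck: "continuous_on UNIV (\<lambda>(z, p). k z p)"
    unfolding k_def plane_wave_def n_def split_beta by (intro continuous_intros)
  define K where "K z = integral (cbox (0, 0) (2 * pi, S)) (k z)" for z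
  have zero: "(\<integral>z. k z p * lap u z \<partial>lborel) = 0" if u: "test_function u" for u p
  proof -
    have "lap (\<lambda>z. k z p) z = 0" for z
      unfolding k_def using plane_wave_harmonic[of "snd p *\<^sub>R e" "snd p *\<^sub>R n (fst p)" 1 0 z]
      by (simp add: ortho n)
    moreover have "smooth (\<lambda>z. k z p)"
      unfolding k_def by (rule plane_wave_smooth)
    ultimately show ?thesis using green_identity[of "\<lambda>z. k z p" u] u by simp
  qed
  have cK: "continuous_on UNIV K"
    unfolding K_def by (rule continuous_integral_kernel[OF ck])
  have K_lap: "(\<integral>z. K z * lap u z \<partial>lborel) = 0" if u: "test_function u" for u
    unfolding K_def using integral_kernel_test[OF ck zero[OF u] test_function_lap[OF u]] .
  have bound: "\<bar>2 * pi / norm z - K z\<bar> \<le> exp (- (S * \<delta>)) / \<delta> * (2 * pi)" if z: "z \<bullet> e \<le> - \<delta>" for z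
  proof -
    define a b c where "a = - (z \<bullet> e)" and "b = z \<bullet> f" and "c = z \<bullet> g"
    define w where "w \<phi> = b * cos \<phi> + c * sin \<phi>" for \<phi>
    define I where "I \<phi> = integral {0..S} (\<lambda>s. k z (\<phi>, s))" for \<phi>
    have a: "a \<ge> \<delta>" "a > 0" using z \<delta> by (auto simp: a_def)
    have "norm z = sqrt (a\<^sup>2 + b\<^sup>2 + c\<^sup>2)"
      by (simp add: norm_eq_sqrt_inner complete[of z] a_def b_def c_def)
    then have 1: "((\<lambda>\<phi>. a / (a\<^sup>2 + (w \<phi>)\<^sup>2)) has_integral 2 * pi / norm z) {0..2 * pi}"
      using has_integral_inverse_distance[OF a(2), of b c] by (simp add: w_def)
    have ckz: "continuous_on UNIV (\<lambda>p. k z p)"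
      using continuous_on_compose2[OF ck, of UNIV "\<lambda>p. (z, p)"] by (simp add: continuous_on_Pair)
    have "I integrable_on {0..2 * pi}"
      unfolding I_def cbox_interval[symmetric]
      by (rule integral_integrable_2dim) (rule continuous_on_subset[OF ckz subset_UNIV])
    then have "(I has_integral integral {0..2 * pi} I) {0..2 * pi}"
      by (rule integrable_integral)
    moreover have "K z = integral {0..2 * pi} I"
      unfolding K_def I_def cbox_interval[symmetric]
      by (rule integral_prod_continuous) (rule continuous_on_subset[OF ckz subset_UNIV])
    ultimately have diff: "((\<lambda>\<phi>. a / (a\<^sup>2 + (w \<phi>)\<^sup>2) - I \<phi>) has_integral 2 * pi / norm z - K z) {0..2 * pi}"
      using has_integral_diff[OF 1] by metis
    \<comment> \<open>the tail of the inner integral in closed form, estimated by \<open>p\<^sup>2 \<le> q\<close> and \<open>\<delta>\<^sup>2 \<le> q\<close>\<close>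
    have "norm (a / (a\<^sup>2 + (w \<phi>)\<^sup>2) - I \<phi>) \<le> exp (- (S * \<delta>)) / \<delta>" for \<phi>
    proof -
      define p where "p = a * cos (S * w \<phi>) - w \<phi> * sin (S * w \<phi>)"
      define q where "q = a\<^sup>2 + (w \<phi>)\<^sup>2"
      have q: "q > 0" using a by (simp add: q_def add_pos_nonneg)
      have "I \<phi> = a / q - exp (- (S * a)) * p / q"
        using integral_unique[OF has_integral_exp_cos[OF a(2) S(1), of "w \<phi>"]]
        by (simp add: I_def k_eq a_def b_def c_def w_def p_def q_def)
      then have "a / q - I \<phi> = exp (- (S * a)) * (p / q)" by simp
      moreover have "\<bar>p\<bar> / q \<le> 1 / \<delta>"
      proof -
        have "q - p\<^sup>2 = (a * sin (S * w \<phi>) + w \<phi> * cos (S * w \<phi>))\<^sup>2"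
          using sin_cos_squared_add[of "S * w \<phi>"] unfolding p_def q_def by algebra
        then have "p\<^sup>2 \<le> q" by (metis diff_ge_0_iff_ge zero_le_power2)
        moreover have "\<delta>\<^sup>2 \<le> q"
        proof -
          have "\<delta>\<^sup>2 \<le> a\<^sup>2" using a \<delta> by (intro power_mono) auto
          then show ?thesis by (simp add: q_def add_increasing2)
        qed
        ultimately have "p\<^sup>2 * \<delta>\<^sup>2 \<le> q * q" using q by (intro mult_mono) auto
        then have "(\<bar>p\<bar> * \<delta>)\<^sup>2 \<le> q\<^sup>2"
          unfolding power_mult_distrib power2_abs power2_eq_square[of q] .
        then have "\<bar>p\<bar> * \<delta> \<le> q" by (rule power2_le_imp_le) (use q in simp)
        then show ?thesis using q \<delta> by (simp add: field_simps)
      qed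
      moreover have "exp (- (S * a)) \<le> exp (- (S * \<delta>))"
        using a(1) S(1) by (simp add: mult_left_mono)
      ultimately have "\<bar>a / q - I \<phi>\<bar> \<le> exp (- (S * \<delta>)) * (1 / \<delta>)"
        using q by (simp only: abs_mult abs_divide) (intro mult_mono, auto)
      then show ?thesis by (simp add: q_def)
    qed
    then have "norm (2 * pi / norm z - K z) \<le> exp (- (S * \<delta>)) / \<delta> * measure lborel (cbox 0 (2 * pi))"
      using \<delta> by (intro has_integral_bound[OF _ diff[folded cbox_interval]]) auto
    then show ?thesis by simp
  qed
  define \<Phi> where "\<Phi> z = - (1 / total_mass) * (1 / norm z - K z / (2 * pi))" for z :: "real^3"
  have "fundamental_solution \<Phi>"
    unfolding fundamental_solution_def
  proof (intro conjI allI impI)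
    have "integrable lborel (\<lambda>z. - (1 / total_mass) * (indicator (cball 0 r) z * (1 / norm z)
        - indicator (cball 0 r) z * K z / (2 * pi)))" for r
      using locally_integrable_newton locally_integrable_continuous[OF cK]
      unfolding locally_integrable_def
      by (intro integrable_mult_right Bochner_Integration.integrable_diff integrable_divide) auto
    then show "locally_integrable \<Phi>"
      unfolding locally_integrable_def \<Phi>_def by (simp add: algebra_simps)
    fix u :: "real^3 \<Rightarrow> real" assume u: "test_function u"
    have "(\<integral>z. \<Phi> z * lap u z \<partial>lborel)
        = (\<integral>z. - (1 / total_mass) * (1 / norm z * lap u z - K z * lap u z / (2 * pi)) \<partial>lborel)"
      by (rule Bochner_Integration.integral_cong) (auto simp: \<Phi>_def algebra_simps)
    also have "\<dots> = - (1 / total_mass) *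
        ((\<integral>z. 1 / norm z * lap u z \<partial>lborel) - (\<integral>z. K z * lap u z \<partial>lborel) / (2 * pi))"
      using integrable_mult_test[OF locally_integrable_newton test_function_lap[OF u]]
        integrable_mult_test[OF locally_integrable_continuous[OF cK] test_function_lap[OF u]]
      by (subst Bochner_Integration.integral_mult_right_zero, subst Bochner_Integration.integral_diff) auto
    also have "\<dots> = u 0"
      using total_mass_pos by (simp only: newton_lap[OF u] K_lap[OF u]) simp
    finally show "(\<integral>z. \<Phi> z * lap u z \<partial>lborel) = u 0" .
  qed
  moreover have "\<bar>\<Phi> z\<bar> \<le> \<epsilon>" if z: "z \<bullet> e \<le> - \<delta>" for z
  proof -
    have "\<Phi> z = - ((2 * pi / norm z - K z) / (2 * pi * total_mass))"
    proof -
      have "2 * pi / norm z - K z = 2 * pi * (1 / norm z - K z / (2 * pi))"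
        by (simp add: right_diff_distrib)
      then show ?thesis unfolding \<Phi>_def by simp
    qed
    then have "\<bar>\<Phi> z\<bar> = \<bar>2 * pi / norm z - K z\<bar> / (2 * pi * total_mass)"
      using total_mass_pos by (simp add: abs_mult)
    also have "\<dots> \<le> (exp (- (S * \<delta>)) / \<delta> * (2 * pi)) / (2 * pi * total_mass)"
      using total_mass_pos by (intro divide_right_mono bound z) auto
    also have "\<dots> = exp (- (S * \<delta>)) / (\<delta> * total_mass)" by simp
    also have "\<dots> \<le> \<epsilon>"
      using S(2) \<delta> total_mass_pos by (simp add: pos_divide_le_eq mult_ac)
    finally show ?thesis .
  qed
  ultimately show ?thesis using that by blast
qed

section \<open>Smooth cutoffs and solutions for compactly supported data\<close>

text \<open>These functions vanish to infinite order at 0. Allowing a polynomial factor in \<open>1 / x\<close> makes the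
  family closed under differentiation.\<close>

definition flat :: "real poly \<Rightarrow> real \<Rightarrow> real" where
  "flat p x = (if x > 0 then poly p (1 / x) * exp (- 1 / x) else 0)"

lemma flat_tendsto_0: "(flat p \<longlongrightarrow> 0) (at_right 0)"
proof -
  have "((\<lambda>y. poly p y / exp y) \<longlongrightarrow> 0) at_top" for p :: "real poly"
  proof -
    have "((\<lambda>y. \<Sum>i\<le>degree p. coeff p i * (y ^ i / exp y)) \<longlongrightarrow> (\<Sum>i\<le>degree p. coeff p i * 0)) at_top"
      by (intro tendsto_sum tendsto_mult tendsto_const tendsto_power_div_exp_0)
    then show ?thesis by (simp add: poly_altdef sum_divide_distrib)
  qed
  then have "((\<lambda>x. poly p (inverse x) / exp (inverse x)) \<longlongrightarrow> 0) (at_right 0)"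
    by (rule filterlim_compose[OF _ filterlim_inverse_at_top_right])
  then show ?thesis
    by (rule Lim_transform_eventually)
      (auto simp: eventually_at_right_less flat_def exp_minus divide_inverse
        intro!: eventually_mono[OF eventually_at_right_less[of 0]])
qed

lemma flat_has_derivative:
  "(flat p has_real_derivative flat (monom 1 2 * (p - pderiv p)) x) (at x)"
proof -
  consider "x > 0" | "x < 0" | "x = 0" by linarith
  then show ?thesis
  proof cases
    case 1
    have "((\<lambda>x. poly p (1 / x) * exp (- 1 / x)) has_real_derivative
        poly p (1 / x) * (exp (- 1 / x) * (1 / x\<^sup>2))
        + (poly (pderiv p) (1 / x) * (- 1 / x\<^sup>2)) * exp (- 1 / x)) (at x)"
    proof (rule DERIV_mult')
      have "((\<lambda>x. 1 / x) has_real_derivative - 1 / x\<^sup>2) (at x)"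
        using 1 by (auto intro!: derivative_eq_intros simp: power2_eq_square)
      then show "((\<lambda>x. poly p (1 / x)) has_real_derivative poly (pderiv p) (1 / x) * (- 1 / x\<^sup>2)) (at x)"
        by (rule DERIV_chain2[OF poly_DERIV])
      show "((\<lambda>x. exp (- 1 / x)) has_real_derivative exp (- 1 / x) * (1 / x\<^sup>2)) (at x)"
        using 1 by (auto intro!: derivative_eq_intros simp: power2_eq_square)
    qed
    also have "poly p (1 / x) * (exp (- 1 / x) * (1 / x\<^sup>2))
        + (poly (pderiv p) (1 / x) * (- 1 / x\<^sup>2)) * exp (- 1 / x) = flat (monom 1 2 * (p - pderiv p)) x"
      using 1 by (simp add: flat_def poly_monom power_divide algebra_simps)
    finally show ?thesis
      by (rule has_field_derivative_transform_within_open[OF _ open_greaterThan[of 0]])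
        (use 1 in \<open>auto simp: flat_def\<close>)
  next
    case 2
    show ?thesis
      by (rule has_field_derivative_transform_within_open[OF _ open_lessThan[of 0], where f = "\<lambda>_. 0"])
        (use 2 in \<open>auto simp: flat_def\<close>)
  next
    case 3
    have "((\<lambda>y. (flat p y - flat p 0) / (y - 0)) \<longlongrightarrow> 0) (at_right 0)"
      by (rule Lim_transform_eventually[OF flat_tendsto_0[of "pCons 0 p"]])
        (auto simp: flat_def intro!: eventually_mono[OF eventually_at_right_less[of 0]])
    moreover have "((\<lambda>y. (flat p y - flat p 0) / (y - 0)) \<longlongrightarrow> 0) (at_left 0)"
      by (rule tendsto_eventually)
        (auto simp: flat_def eventually_at_left_field intro!: exI[of _ "-1"])
    ultimately have "((\<lambda>y. (flat p y - flat p 0) / (y - 0)) \<longlongrightarrow> 0) (at 0)"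
      by (rule filterlim_split_at[rotated])
    then show ?thesis using 3 by (simp add: has_field_derivative_iff flat_def)
  qed
qed

lemma smooth_flat: "smooth (flat p)"
proof (rule smoothI_derivative[where P = "\<lambda>g. \<exists>p. g = flat p"])
  fix g assume "\<exists>p. g = flat p"
  then obtain p where g: "g = flat p" by blast
  show "\<exists>f'. (\<forall>x. (g has_derivative f' x) (at x)) \<and> (\<forall>u. \<exists>p. (\<lambda>x. f' x u) = flat p)"
  proof (intro exI[of _ "\<lambda>x u. flat (monom 1 2 * (p - pderiv p)) x * u"] conjI allI)
    show "(g has_derivative (\<lambda>u. flat (monom 1 2 * (p - pderiv p)) x * u)) (at x)" for x
      using flat_has_derivative unfolding g has_field_derivative_def .
    show "\<exists>p'. (\<lambda>x. flat (monom 1 2 * (p - pderiv p)) x * u) = flat p'" for u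
      by (intro exI[of _ "smult u (monom 1 2 * (p - pderiv p))"]) (auto simp: flat_def fun_eq_iff)
  qed
qed blast

definition smooth_step :: "real \<Rightarrow> real" where
  "smooth_step x = flat 1 x / (flat 1 x + flat 1 (1 - x))"

lemma smooth_step_eq_0: "x \<le> 0 \<Longrightarrow> smooth_step x = 0"
  by (simp add: smooth_step_def flat_def)

lemma smooth_step_eq_1: "x \<ge> 1 \<Longrightarrow> smooth_step x = 1"
  by (simp add: smooth_step_def flat_def)

lemma smooth_smooth_step: "smooth smooth_step"
proof -
  let ?q = "\<lambda>x. flat 1 x + flat 1 (1 - x)"
  have pos: "?q x > 0" for x
    by (auto simp: flat_def intro!: add_pos_nonneg add_nonneg_pos)
  have q: "smooth ?q" by (intro smooth_add smooth_flat smooth_reflect)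
  have eq: "smooth_step = (\<lambda>x. flat 1 x * ?q x powr (- 1))"
    by (simp add: smooth_step_def fun_eq_iff powr_minus_divide abs_of_pos[OF pos])
  show ?thesis unfolding eq by (rule smooth_mult[OF smooth_flat smooth_powr(1)[OF q pos]])
qed

definition dds :: "'a::real_normed_vector list \<Rightarrow> ('a \<Rightarrow> 'b::real_normed_vector) \<Rightarrow> 'a \<Rightarrow> 'b" where
  "dds us f = fold dd us f"

lemma dds_Nil: "dds [] f = f" and dds_Cons: "dds (u # us) f = dds us (dd u f)"
  and dds_snoc: "dds (us @ [u]) f = dd u (dds us f)"
  by (simp_all add: dds_def)

lemma smooth_dds: "smooth f \<Longrightarrow> smooth (dds us f)"
  by (induction us arbitrary: f) (auto simp: dds_Nil dds_Cons smooth_dd)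

lemma dds_add: "smooth f \<Longrightarrow> smooth g \<Longrightarrow> dds us (\<lambda>x. f x + g x) = (\<lambda>x. dds us f x + dds us g x)"
  by (induction us arbitrary: f g) (auto simp: dds_Nil dds_Cons smooth_dd dd_add)

lemma dds_zero: "dds us (\<lambda>x::'a::real_normed_vector. 0 :: 'b::real_normed_vector) = (\<lambda>x. 0)"
proof (induction us)
  case (Cons u us)
  have "dd u (\<lambda>x::'a. 0 :: 'b) = (\<lambda>x. 0)" by (rule dd_eqI) simp
  with Cons show ?case by (simp add: dds_Cons)
qed (simp add: dds_Nil)

lemma test_function_dds: "test_function f \<Longrightarrow> test_function (dds us f)"
  by (induction us arbitrary: f) (auto simp: dds_Nil dds_Cons test_function_dd)

lemma dds_conv:
  "locally_integrable \<Phi> \<Longrightarrow> test_function f \<Longrightarrow> dds us (conv \<Phi> f) = conv \<Phi> (dds us f)"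
  by (induction us arbitrary: f) (auto simp: dds_Nil dds_Cons test_function_dd dd_conv)

text \<open>In particular differentiation does not enlarge the support, so a half-space that contains the
  support of a test function contains the supports of all its derivatives.\<close>

lemma dds_zero_on_open:
  assumes "open S" shows "(\<And>y. y \<in> S \<Longrightarrow> f y = 0) \<Longrightarrow> x \<in> S \<Longrightarrow> dds us f x = 0"
proof (induction us arbitrary: f)
  case (Cons u us)
  have "dd u f y = 0" if "y \<in> S" for y
    using dd_zero_on_open[OF assms that] Cons.prems(1) by blast
  then show ?case unfolding dds_Cons by (rule Cons.IH) (use Cons.prems in auto)
qed (simp add: dds_Nil)

text \<open>The vector is part of an orthonormal frame; completeness of the frame is expressed by the Pythagorean
  identity, the form in which the half-space kernels use it.\<close>

definition extends_to_frame :: "real^3 \<Rightarrow> bool" where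
  "extends_to_frame e \<longleftrightarrow> (\<exists>f g :: real^3. e \<bullet> e = 1 \<and> f \<bullet> f = 1 \<and> g \<bullet> g = 1 \<and>
     e \<bullet> f = 0 \<and> e \<bullet> g = 0 \<and> f \<bullet> g = 0 \<and> (\<forall>z. z \<bullet> z = (z \<bullet> e)\<^sup>2 + (z \<bullet> f)\<^sup>2 + (z \<bullet> g)\<^sup>2))"

text \<open>If \<open>x\<close> lies in the ball of radius \<open>R - 1\<close> and \<open>x - z\<close> in the support of \<open>F\<close>, then \<open>z \<bullet> e \<le> - 1\<close>. Hence
  only the small part of the kernel is seen from that ball, and a derivative of the solution is
  bounded by the smallness of the kernel times the \<open>L\<^sup>1\<close> norm of the same derivative of \<open>F\<close>. Finitely
  many derivatives are made small at once by one choice of kernel.\<close>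

lemma half_space_solution:
  fixes F :: "real^3 \<Rightarrow> real"
  assumes e: "extends_to_frame e" and F: "test_function F" and supp: "\<And>y. F y \<noteq> 0 \<Longrightarrow> y \<bullet> e \<ge> R"
    and U: "finite U" and \<epsilon>: "\<epsilon> > 0"
  obtains h where "smooth h" "lap h = F"
    "\<And>us x. us \<in> U \<Longrightarrow> norm x \<le> R - 1 \<Longrightarrow> \<bar>dds us h x\<bar> \<le> \<epsilon>"
proof -
  define M where "M = (\<Sum>us\<in>U. \<integral>y. \<bar>dds us F y\<bar> \<partial>lborel) + 1"
  have M: "M > 0" by (auto simp: M_def intro!: add_nonneg_pos sum_nonneg)
  obtain \<Phi> where \<Phi>: "fundamental_solution \<Phi>" "\<And>z. z \<bullet> e \<le> - 1 \<Longrightarrow> \<bar>\<Phi> z\<bar> \<le> \<epsilon> / M"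
    using e half_space_fundamental_solution[of e _ _ 1 "\<epsilon> / M"] \<epsilon> M unfolding extends_to_frame_def
    by (metis divide_pos_pos zero_less_one)
  have L: "locally_integrable \<Phi>" using \<Phi>(1) by (simp add: fundamental_solution_def)
  have norm_e: "norm e = 1" using e by (auto simp: extends_to_frame_def norm_eq_1)
  show ?thesis
  proof (rule that)
    show "smooth (conv \<Phi> F)" by (rule smooth_conv[OF L F])
    show "lap (conv \<Phi> F) = F"
      using lap_conv_fundamental_solution[OF \<Phi>(1) F] by (simp add: fun_eq_iff)
    fix us and x :: "real^3" assume us: "us \<in> U" and x: "norm x \<le> R - 1"
    define G where "G = dds us F"
    have G: "test_function G" unfolding G_def by (rule test_function_dds[OF F])
    have Gm: "G \<in> borel_measurable borel"
      using smooth_continuous[OF test_smooth[OF G], of UNIV] by (simp add: borel_measurable_continuous_onI)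
    have G0: "G y = 0" if "y \<bullet> e < R" for y
      unfolding G_def
    proof (rule dds_zero_on_open[of "{y. y \<bullet> e < R}"])
      show "open {y. y \<bullet> e < R}" by (intro open_Collect_less continuous_intros)
    qed (use that supp in force)+
    have "x \<bullet> e \<le> R - 1"
      using norm_cauchy_schwarz[of x e] x norm_e by simp
    then have small: "norm (\<Phi> z * G (x - z)) \<le> \<epsilon> / M * \<bar>G (x - z)\<bar>" for z
    proof (cases "z \<bullet> e \<le> -1")
      case True
      from mult_right_mono[OF \<Phi>(2)[OF this] abs_ge_zero[of "G (x - z)"]]
      show ?thesis by (simp add: abs_mult)
    next
      case False
      then have "G (x - z) = 0" using \<open>x \<bullet> e \<le> R - 1\<close> by (intro G0) (simp add: inner_diff_left)
      then show ?thesis by simp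
    qed
    have int: "integrable lborel (\<lambda>z. \<bar>G (x - z)\<bar>)"
      by (intro integrable_abs integrable_test test_function_reflect G)
    have "\<bar>conv \<Phi> G x\<bar> \<le> (\<integral>z. \<epsilon> / M * \<bar>G (x - z)\<bar> \<partial>lborel)"
      unfolding conv_def real_norm_def[symmetric]
      by (rule Bochner_Integration.integral_norm_bound_integral)
        (use small int integrable_conv[OF L G] in auto)
    also have "\<dots> = \<epsilon> / M * (\<integral>z. \<bar>G z\<bar> \<partial>lborel)"
      using lborel_integral_reflect[of "\<lambda>z. \<bar>G z\<bar>" x] Gm by simp
    also have "\<dots> \<le> \<epsilon> / M * M"
    proof (rule mult_left_mono)
      have "(\<integral>z. \<bar>G z\<bar> \<partial>lborel) \<le> (\<Sum>us\<in>U. \<integral>y. \<bar>dds us F y\<bar> \<partial>lborel)"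
        unfolding G_def by (rule member_le_sum[OF us]) (auto simp: U)
      then show "(\<integral>z. \<bar>G z\<bar> \<partial>lborel) \<le> M" by (simp add: M_def)
    qed (use \<epsilon> M in simp)
    finally show "\<bar>dds us (conv \<Phi> F) x\<bar> \<le> \<epsilon>"
      using M by (simp add: dds_conv[OF L F] G_def)
  qed
qed

text \<open>A function supported away from the origin is split by smooth cutoffs into pieces, each supported
  in a half-space \<open>{y. y \<bullet> e \<ge> R - 1}\<close> for one of the listed directions. The cutoff for \<open>e\<close> equals 1 where
  \<open>y \<bullet> e \<ge> R\<close>, so what remains after removing the piece for \<open>e\<close> is supported far out in one of the other
  directions.\<close>

lemma far_solution:
  fixes F :: "real^3 \<Rightarrow> real"
  assumes "test_function F" "\<And>y. F y \<noteq> 0 \<Longrightarrow> \<exists>e\<in>set es. y \<bullet> e \<ge> R"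
    and "\<And>e. e \<in> set es \<Longrightarrow> extends_to_frame e" and U: "finite U" and "\<epsilon> > 0"
  shows "\<exists>h. smooth h \<and> lap h = F \<and> (\<forall>us\<in>U. \<forall>x. norm x \<le> R - 2 \<longrightarrow> \<bar>dds us h x\<bar> \<le> \<epsilon>)"
  using assms(1-3,5)
proof (induction es arbitrary: F \<epsilon>)
  case Nil
  then have "F = (\<lambda>x. 0)" by auto
  moreover have "lap (\<lambda>x::real^3. 0) = (\<lambda>x. 0)"
  proof -
    have "dd u (\<lambda>x::real^3. 0 :: real) = (\<lambda>x. 0)" for u by (rule dd_eqI) simp
    then show ?thesis by (simp add: lap_eq)
  qed
  ultimately show ?case using Nil(4) by (intro exI[of _ "\<lambda>x. 0"]) (auto simp: dds_zero)
next
  case (Cons e es)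
  define \<sigma> where "\<sigma> y = smooth_step (y \<bullet> e + (1 - R))" for y
  have \<sigma>: "smooth \<sigma>"
    unfolding \<sigma>_def using smooth_comp_affine[OF bounded_linear_inner_left smooth_smooth_step, of "1 - R" e]
    by (simp add: add.commute)
  have 1: "test_function (\<lambda>y. \<sigma> y * F y)" by (rule test_function_mult[OF \<sigma> Cons.prems(1)])
  have 2: "test_function (\<lambda>y. (1 - \<sigma> y) * F y)"
    by (rule test_function_mult[OF smooth_diff[OF smooth_const \<sigma>] Cons.prems(1)])
  have supp1: "y \<bullet> e \<ge> R - 1" if "\<sigma> y * F y \<noteq> 0" for y
    using that smooth_step_eq_0[of "y \<bullet> e + (1 - R)"] by (force simp: \<sigma>_def)
  have supp2: "\<exists>e\<in>set es. y \<bullet> e \<ge> R" if "(1 - \<sigma> y) * F y \<noteq> 0" for y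
    using that smooth_step_eq_1[of "y \<bullet> e + (1 - R)"] Cons.prems(2)[of y] by (force simp: \<sigma>_def)
  have \<epsilon>: "\<epsilon> / 2 > 0" using Cons.prems by simp
  obtain h1 where h1: "smooth h1" "lap h1 = (\<lambda>y. \<sigma> y * F y)"
    "\<And>us x. us \<in> U \<Longrightarrow> norm x \<le> R - 1 - 1 \<Longrightarrow> \<bar>dds us h1 x\<bar> \<le> \<epsilon> / 2"
    using half_space_solution[OF _ 1 supp1 U \<epsilon>] Cons.prems(3) by (metis list.set_intros(1))
  obtain h2 where h2: "smooth h2" "lap h2 = (\<lambda>y. (1 - \<sigma> y) * F y)"
    "\<forall>us\<in>U. \<forall>x. norm x \<le> R - 2 \<longrightarrow> \<bar>dds us h2 x\<bar> \<le> \<epsilon> / 2"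
    using Cons.IH[OF 2 supp2 _ \<epsilon>] Cons.prems(3) by (metis list.set_intros(2))
  have "lap (\<lambda>x. h1 x + h2 x) = (\<lambda>x. lap h1 x + lap h2 x)"
    using h1(1) h2(1) by (simp add: lap_eq dd_add smooth_dd sum.distrib)
  then have "lap (\<lambda>x. h1 x + h2 x) = F" by (simp add: h1(2) h2(2) fun_eq_iff algebra_simps)
  moreover have "\<bar>dds us (\<lambda>x. h1 x + h2 x) x\<bar> \<le> \<epsilon>" if "us \<in> U" "norm x \<le> R - 2" for us x
    using h1(3)[of us x] h2(3) that by (force simp: dds_add[OF h1(1) h2(1)])
  ultimately show ?case using smooth_add[OF h1(1) h2(1)] by blast
qed

section \<open>The Poisson equation for arbitrary smooth data\<close>

lemma geometric_tail:
  fixes a :: "nat \<Rightarrow> real"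
  assumes a: "\<And>i. i \<ge> N \<Longrightarrow> \<bar>a i\<bar> \<le> (1/2) ^ i"
  shows "summable a" and "n \<ge> N \<Longrightarrow> \<bar>(\<Sum>i<n. a i) - suminf a\<bar> \<le> 2 * (1/2) ^ n"
proof -
  show s: "summable a"
    by (rule summable_comparison_test[OF _ summable_geometric[of "1/2::real"]]) (use a in auto)
  assume n: "n \<ge> N"
  have g: "summable (\<lambda>i. (1/2::real) ^ n * (1/2) ^ i)" by (intro summable_mult summable_geometric) simp
  have le: "norm (a (i + n)) \<le> (1/2) ^ n * (1/2) ^ i" for i
    using a[of "i + n"] n by (simp add: power_add mult.commute)
  have "norm (\<Sum>i. a (i + n)) \<le> (\<Sum>i. (1/2) ^ n * (1/2) ^ i)"
    by (rule norm_suminf_le[OF le g])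
  also have "\<dots> = 2 * (1/2) ^ n"
    by (subst suminf_mult) (auto simp: summable_geometric suminf_geometric)
  finally have "norm (\<Sum>i. a (i + n)) \<le> 2 * (1/2) ^ n" .
  moreover have "(\<Sum>i<n. a i) - suminf a = - (\<Sum>i. a (i + n))"
    using suminf_minus_initial_segment[OF s, of n] by simp
  ultimately show "\<bar>(\<Sum>i<n. a i) - suminf a\<bar> \<le> 2 * (1/2) ^ n" by simp
qed

text \<open>For every iterated derivative along basis vectors, the series of derivatives converges locally
  uniformly, because from some index on its terms are bounded by a geometric sequence on each ball. The
  index may depend on the derivative, as only finitely many derivatives can be controlled for each
  term.\<close>

lemma smooth_series:
  fixes h :: "nat \<Rightarrow> 'a::euclidean_space \<Rightarrow> real"
  assumes h: "\<And>n. smooth (h n)"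
    and small: "\<And>us r. us \<in> lists Basis \<Longrightarrow>
      \<exists>N. \<forall>n\<ge>N. \<forall>x. norm x \<le> r \<longrightarrow> \<bar>dds us (h n) x\<bar> \<le> (1/2) ^ n"
  shows "smooth (\<lambda>x. \<Sum>n. h n x)" and "(\<lambda>n. lap (h n) x) sums lap (\<lambda>x. \<Sum>n. h n x) x"
proof -
  define H where "H us x = (\<Sum>n. dds us (h n) x)" for us x
  have sums: "(\<lambda>n. dds us (h n) x) sums H us x" if us: "us \<in> lists Basis" for us x
  proof -
    obtain N where "\<And>n. n \<ge> N \<Longrightarrow> \<bar>dds us (h n) x\<bar> \<le> (1/2) ^ n"
      using small[OF us, of "norm x"] by blast
    then show ?thesis unfolding H_def by (intro summable_sums geometric_tail(1))
  qed
  have der: "(H us has_derivative (\<lambda>u. \<Sum>b\<in>Basis. (u \<bullet> b) *\<^sub>R H (us @ [b]) x)) (at x)"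
    if us: "us \<in> lists Basis" for us x
  proof -
    define S where "S = ball (0::'a) (norm x + 1)"
    have "\<exists>g. \<forall>y\<in>S. (\<lambda>n. dds us (h n) y) sums g y \<and>
      (g has_derivative (\<lambda>u. \<Sum>b\<in>Basis. (u \<bullet> b) *\<^sub>R H (us @ [b]) y)) (at y within S)"
    proof (rule has_derivative_series[where f' = "\<lambda>n y u. dd u (dds us (h n)) y"])
      show "convex S" unfolding S_def by (rule convex_ball)
      show "(dds us (h n) has_derivative (\<lambda>u. dd u (dds us (h n)) y)) (at y within S)" for n y
        by (rule has_derivative_at_withinI[OF smooth_has_derivative[OF smooth_dds[OF h]]])
      show "x \<in> S" by (simp add: S_def)
      show "(\<lambda>n. dds us (h n) x) sums H us x" by (rule sums[OF us])
      fix e :: real assume e: "e > 0"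
      have "\<forall>b\<in>Basis. \<exists>N. \<forall>n\<ge>N. \<forall>y. norm y \<le> norm x + 1 \<longrightarrow> \<bar>dds (us @ [b]) (h n) y\<bar> \<le> (1/2) ^ n"
        using us by (intro ballI small) auto
      then obtain N where N: "\<And>b n y. b \<in> Basis \<Longrightarrow> n \<ge> N b \<Longrightarrow> norm y \<le> norm x + 1 \<Longrightarrow>
          \<bar>dds (us @ [b]) (h n) y\<bar> \<le> (1/2) ^ n"
        by metis
      define C where "C = 2 * real DIM('a)"
      have "C > 0" by (simp add: C_def)
      obtain M where M: "(1/2) ^ M < e / C"
        using real_arch_pow_inv[of "e / C" "1/2"] e \<open>C > 0\<close> by auto
      have "norm ((\<Sum>i<n. dd u (dds us (h i)) y) - (\<Sum>b\<in>Basis. (u \<bullet> b) *\<^sub>R H (us @ [b]) y)) \<le> e * norm u"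
        if n: "n \<ge> max M (Max (N ` Basis))" and y: "y \<in> S" for n y u
      proof -
        have "(\<Sum>i<n. dd u (dds us (h i)) y) = (\<Sum>i<n. \<Sum>b\<in>Basis. (u \<bullet> b) * dds (us @ [b]) (h i) y)"
          using dd_Basis[OF smooth_dds[OF h], of u] by (simp add: dds_snoc)
        also have "\<dots> = (\<Sum>b\<in>Basis. (u \<bullet> b) * (\<Sum>i<n. dds (us @ [b]) (h i) y))"
          by (subst sum.swap) (simp add: sum_distrib_left)
        finally have "(\<Sum>i<n. dd u (dds us (h i)) y) - (\<Sum>b\<in>Basis. (u \<bullet> b) *\<^sub>R H (us @ [b]) y)
            = (\<Sum>b\<in>Basis. (u \<bullet> b) * ((\<Sum>i<n. dds (us @ [b]) (h i) y) - H (us @ [b]) y))"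
          by (simp add: right_diff_distrib sum_subtractf)
        also have "norm \<dots> \<le> (\<Sum>b\<in>(Basis::'a set). norm u * (2 * (1/2) ^ n))"
          unfolding real_norm_def
        proof (rule order_trans[OF sum_abs sum_mono])
          fix b :: 'a assume b: "b \<in> Basis"
          have "n \<ge> N b" using n b Max_ge[of "N ` Basis" "N b"] by simp
          moreover have "norm y \<le> norm x + 1" using y by (simp add: S_def)
          ultimately have "\<bar>(\<Sum>i<n. dds (us @ [b]) (h i) y) - H (us @ [b]) y\<bar> \<le> 2 * (1/2) ^ n"
            unfolding H_def using N[OF b] by (intro geometric_tail(2)[of "N b"]) auto
          then show "\<bar>(u \<bullet> b) * ((\<Sum>i<n. dds (us @ [b]) (h i) y) - H (us @ [b]) y)\<bar>
              \<le> norm u * (2 * (1/2) ^ n)"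
            unfolding abs_mult using Basis_le_norm[OF b, of u] by (intro mult_mono) auto
        qed
        also have "\<dots> = norm u * (C * (1/2) ^ n)" by (simp add: C_def)
        also have "\<dots> \<le> norm u * e"
        proof (rule mult_left_mono)
          have "(1/2::real) ^ n \<le> (1/2) ^ M" using n by (intro power_decreasing) auto
          then have "C * (1/2) ^ n \<le> C * (1/2) ^ M" using \<open>C > 0\<close> by (intro mult_left_mono) auto
          also have "\<dots> \<le> e" using M \<open>C > 0\<close> by (simp add: pos_less_divide_eq mult.commute)
          finally show "C * (1/2) ^ n \<le> e" .
        qed simp
        finally show ?thesis by (simp add: mult.commute)
      qed
      then show "\<forall>\<^sub>F n in sequentially. \<forall>y\<in>S. \<forall>u. norm ((\<Sum>i<n. dd u (dds us (h i)) y)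
          - (\<Sum>b\<in>Basis. (u \<bullet> b) *\<^sub>R H (us @ [b]) y)) \<le> e * norm u"
        unfolding eventually_sequentially by blast
    qed
    then obtain g where g: "\<And>y. y \<in> S \<Longrightarrow> (\<lambda>n. dds us (h n) y) sums g y"
      "\<And>y. y \<in> S \<Longrightarrow> (g has_derivative (\<lambda>u. \<Sum>b\<in>Basis. (u \<bullet> b) *\<^sub>R H (us @ [b]) y)) (at y within S)"
      by blast
    have "x \<in> S" "open S" by (auto simp: S_def)
    moreover have "g y = H us y" if "y \<in> S" for y
      using sums_unique2[OF g(1)[OF that] sums[OF us]] .
    ultimately show ?thesis
      using g(2)[OF \<open>x \<in> S\<close>] at_within_open[of x S]
      by (intro has_derivative_transform_within_open[of g _ x UNIV S "H us"]) auto
  qed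
  have "us \<in> lists Basis \<Longrightarrow> Ck k (H us)" for k us
  proof (induction k arbitrary: us)
    case 0
    show ?case
      unfolding Ck.simps continuous_on_eq_continuous_at[OF open_UNIV]
      using has_derivative_continuous[OF der[OF 0]] by blast
  next
    case (Suc k)
    show ?case by (rule Ck_SucI_Basis[OF der[OF Suc.prems] Suc.IH]) (use Suc.prems in auto)
  qed
  then have smooth_H: "smooth (H us)" if "us \<in> lists Basis" for us using that by (simp add: smooth_def)
  have H_Nil: "H [] = (\<lambda>x. \<Sum>n. h n x)" by (simp add: H_def dds_Nil fun_eq_iff)
  show "smooth (\<lambda>x. \<Sum>n. h n x)" using smooth_H[of "[]"] by (simp add: H_Nil)
  have dd_H: "dd b (H us) = H (us @ [b])" if "us \<in> lists Basis" "b \<in> Basis" for us b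
  proof -
    have "(\<Sum>b'\<in>Basis. (b \<bullet> b') *\<^sub>R H (us @ [b']) x) = H (us @ [b]) x" for x
    proof -
      have "(\<Sum>b'\<in>Basis. (b \<bullet> b') *\<^sub>R H (us @ [b']) x) = (\<Sum>b'\<in>Basis. if b' = b then H (us @ [b']) x else 0)"
        using that by (intro sum.cong) (auto simp: inner_Basis)
      then show ?thesis using that by simp
    qed
    then show ?thesis using dd_eqI[OF der[OF that(1)], of b] by simp
  qed
  have "lap (H []) x = (\<Sum>b\<in>Basis. H [b, b] x)"
    unfolding lap_def by (intro sum.cong) (simp_all add: dd_H)
  moreover have "(\<lambda>n. \<Sum>b\<in>Basis. dds [b, b] (h n) x) sums (\<Sum>b\<in>Basis. H [b, b] x)"
    by (intro sums_sum sums) auto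
  ultimately show "(\<lambda>n. lap (h n) x) sums lap (\<lambda>x. \<Sum>n. h n x) x"
    by (simp add: H_Nil lap_def dds_Cons dds_Nil)
qed

definition cutoff :: "nat \<Rightarrow> real^3 \<Rightarrow> real" where
  "cutoff n y = (\<Prod>i\<in>UNIV. smooth_step (real n + 1 - y $ i) * smooth_step (real n + 1 + y $ i))"

lemma test_function_cutoff: "test_function (cutoff n)"
  unfolding test_function_def
proof (intro conjI exI allI impI)
  have "bounded_linear (\<lambda>y::real^3. - (y $ i))" "bounded_linear (\<lambda>y::real^3. y $ i)" for i
    by (auto intro: bounded_linear_minus bounded_linear_vec_nth)
  from smooth_comp_affine[OF this(1) smooth_smooth_step] smooth_comp_affine[OF this(2) smooth_smooth_step]
  show "smooth (cutoff n)"
    unfolding cutoff_def by (intro smooth_prod smooth_mult) auto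
  fix y :: "real^3" assume y: "3 * (real n + 1) < norm y"
  have "norm y \<le> (\<Sum>i\<in>UNIV. \<bar>y $ i\<bar>)" by (rule norm_le_l1_cart)
  have "\<exists>i. \<bar>y $ i\<bar> \<ge> real n + 1"
  proof (rule ccontr)
    assume "\<not> ?thesis"
    then have "(\<Sum>i\<in>(UNIV::3 set). \<bar>y $ i\<bar>) \<le> (\<Sum>i\<in>(UNIV::3 set). real n + 1)"
      by (intro sum_mono) (auto simp: not_le less_imp_le)
    with y \<open>norm y \<le> _\<close> show False by simp
  qed
  then obtain i where "\<bar>y $ i\<bar> \<ge> real n + 1" by blast
  then have "smooth_step (real n + 1 - y $ i) * smooth_step (real n + 1 + y $ i) = 0"
    using smooth_step_eq_0[of "real n + 1 - y $ i"] smooth_step_eq_0[of "real n + 1 + y $ i"] by (auto simp: abs_le_iff abs_if split: if_splits)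
  then show "cutoff n y = 0" unfolding cutoff_def by (intro prod_zero) auto
qed

lemma cutoff_eq_1:
  assumes "\<And>i. \<bar>y $ i\<bar> \<le> real n" shows "cutoff n y = 1"
  unfolding cutoff_def
proof (rule prod.neutral, rule ballI)
  fix i
  have "y $ i \<le> real n" "- real n \<le> y $ i" using assms[of i] by auto
  then show "smooth_step (real n + 1 - y $ i) * smooth_step (real n + 1 + y $ i) = 1"
    by (simp add: smooth_step_eq_1)
qed

text \<open>Every point has a coordinate of maximal modulus, so these six directions see every point that is far from
  the origin.\<close>

definition directions :: "(real^3) list" where
  "directions = [axis 1 1, axis 2 1, axis 3 1, - axis 1 1, - axis 2 1, - axis 3 1]"

lemma extends_to_frame_directions: "e \<in> set directions \<Longrightarrow> extends_to_frame e"
proof -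
  have z: "z \<bullet> z = (z $ 1)\<^sup>2 + (z $ 2)\<^sup>2 + (z $ 3)\<^sup>2" for z :: "real^3"
    by (simp add: inner_vec_def sum_3 power2_eq_square)
  have n: "axis i 1 \<bullet> axis j (1::real) = (if i = j then 1 else 0)" for i j :: 3
    by (simp add: inner_axis_axis)
  have a: "axis i (1::real) $ j = (if i = j then 1 else 0)" for i j :: 3
    by (simp add: axis_def)
  have "extends_to_frame e" if "e = axis i 1 \<or> e = - axis i 1" "{i, j, k} = UNIV" "i \<noteq> j" "i \<noteq> k" "j \<noteq> k" for e i j k
  proof -
    have "z \<bullet> z = (z $ i)\<^sup>2 + (z $ j)\<^sup>2 + (z $ k)\<^sup>2" for z :: "real^3"
      unfolding inner_vec_def that(2)[symmetric] using that(3-5) by (simp add: power2_eq_square)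
    with that show ?thesis
      unfolding extends_to_frame_def
      by - (rule exI[of _ "axis j 1"], rule exI[of _ "axis k 1"], auto simp: n a inner_axis)
  qed
  from this[of e 1 2 3] this[of e 2 1 3] this[of e 3 1 2]
  show "e \<in> set directions \<Longrightarrow> extends_to_frame e"
    using UNIV_3 by (auto simp: directions_def insert_commute)
qed

text \<open>The pieces \<open>F n\<close> are the differences of \<open>g\<close> cut off at consecutive radii; their sum telescopes to \<open>g\<close> and at
  each point only finitely many are nonzero. For the \<open>n\<close>-th piece the derivatives of order at most \<open>n\<close>
  are made smaller than \<open>2\<^sup>-\<^sup>n\<close> on the ball of radius \<open>n - 3\<close>.\<close>

theorem poisson_solvable:
  fixes g :: "real^3 \<Rightarrow> real"
  assumes g: "smooth g"
  obtains h where "smooth h" "lap h = g"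
proof -
  define F where "F n y = (if n = 0 then cutoff 0 y else cutoff n y - cutoff (n - 1) y) * g y" for n y
  have F: "test_function (F n)" for n
    unfolding F_def using test_function_mult'[OF test_function_cutoff g]
      test_function_mult'[OF test_function_diff[OF test_function_cutoff test_function_cutoff] g]
    by (cases "n = 0") simp_all
  have supp: "\<exists>e\<in>set directions. y \<bullet> e \<ge> real n - 1" if "F n y \<noteq> 0" for n y
  proof -
    have "\<exists>i. \<bar>y $ i\<bar> \<ge> real n - 1"
    proof (cases "n = 0")
      case False
      show ?thesis
      proof (rule ccontr)
        assume "\<not> ?thesis"
        then have le: "\<bar>y $ i\<bar> \<le> real n - 1" for i by (meson less_imp_le not_le)
        then have "\<bar>y $ i\<bar> \<le> real n" for i by (rule order_trans) simp
        moreover have "\<bar>y $ i\<bar> \<le> real (n - 1)" for i using le[of i] False by (simp add: of_nat_diff)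
        ultimately have "cutoff n y = 1" "cutoff (n - 1) y = 1" by (auto intro: cutoff_eq_1)
        with that False show False by (simp add: F_def)
      qed
    qed (auto intro!: exI[of _ 1] simp: order_trans[of _ 0])
    then obtain i where i: "\<bar>y $ i\<bar> \<ge> real n - 1" by blast
    then have "y \<bullet> axis i 1 \<ge> real n - 1 \<or> y \<bullet> - axis i 1 \<ge> real n - 1"
      by (auto simp: inner_axis abs_if split: if_splits)
    then show ?thesis using exhaust_3[of i] by (auto simp: directions_def)
  qed
  have telescope: "(\<Sum>i<Suc n. F i y) = cutoff n y * g y" for n y
    by (induction n) (auto simp: F_def algebra_simps)
  have F_sums: "(\<lambda>n. F n y) sums g y" for y
  proof -
    obtain N where N: "norm y \<le> real N" using real_arch_simple by blast
    have "(\<Sum>i<n. F i y) = g y" if n: "n \<ge> Suc N" for n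
    proof -
      obtain m where m: "n = Suc m" "m \<ge> N" using n by (cases n) auto
      have "\<bar>y $ i\<bar> \<le> real m" for i
        using component_le_norm_cart[of y i] N m(2) by (meson of_nat_mono order_trans of_nat_le_iff)
      then show ?thesis using telescope[where n = m and y = y] cutoff_eq_1[where y = y and n = m] m(1) by simp
    qed
    then show ?thesis unfolding sums_def
      by (intro tendsto_eventually) (auto simp: eventually_sequentially)
  qed
  define U where "U n = {us. set us \<subseteq> (Basis :: (real^3) set) \<and> length us \<le> n}" for n
  have "\<exists>h. smooth h \<and> lap h = F n \<and>
      (\<forall>us\<in>U n. \<forall>x. norm x \<le> (real n - 1) - 2 \<longrightarrow> \<bar>dds us h x\<bar> \<le> (1/2) ^ n)" for n
    by (rule far_solution[OF F supp extends_to_frame_directions])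
      (auto simp: U_def intro: finite_lists_length_le)
  then obtain h where h: "\<And>n. smooth (h n)" "\<And>n. lap (h n) = F n"
    "\<And>n us x. us \<in> U n \<Longrightarrow> norm x \<le> real n - 1 - 2 \<Longrightarrow> \<bar>dds us (h n) x\<bar> \<le> (1/2) ^ n"
    by metis
  have small: "\<exists>N. \<forall>n\<ge>N. \<forall>x. norm x \<le> r \<longrightarrow> \<bar>dds us (h n) x\<bar> \<le> (1/2) ^ n"
    if us: "us \<in> lists Basis" for us r
  proof -
    obtain N where N: "r + 3 \<le> real N" using real_arch_simple by blast
    have "\<bar>dds us (h n) x\<bar> \<le> (1/2) ^ n" if "n \<ge> max N (length us)" "norm x \<le> r" for n x
    proof (rule h(3))
      show "us \<in> U n" using us that by (auto simp: U_def)
      have "real N \<le> real n" using that by simp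
      then show "norm x \<le> real n - 1 - 2" using that(2) N by linarith
    qed
    then show ?thesis by blast
  qed
  show ?thesis
  proof
    show "smooth (\<lambda>x. \<Sum>n. h n x)" by (rule smooth_series(1)[OF h(1) small])
    show "lap (\<lambda>x. \<Sum>n. h n x) = g"
    proof
      fix x
      show "lap (\<lambda>x. \<Sum>n. h n x) x = g x"
        using sums_unique2[OF smooth_series(2)[OF h(1) small, of x] F_sums[of x, folded h(2)]] .
    qed
  qed
qed

section \<open>Integration in time\<close>

lemma Ck_Pair: "Ck k f \<Longrightarrow> Ck k g \<Longrightarrow> Ck k (\<lambda>x. (f x, g x))"
proof -
  assume "Ck k f" "Ck k g"
  moreover have "bounded_linear (\<lambda>a::'b. (a, 0::'c))" "bounded_linear (\<lambda>b::'c. (0::'b, b))"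
    by (auto intro!: bounded_linear_Pair bounded_linear_ident bounded_linear_zero)
  ultimately have "Ck k (\<lambda>x. (f x, 0) + (0, g x))"
    by (intro Ck_add Ck_linear_comp[of "\<lambda>a. (a, 0)"] Ck_linear_comp[of "\<lambda>b. (0, b)"])
  then show ?thesis by simp
qed

lemma smooth_Pair: "smooth f \<Longrightarrow> smooth g \<Longrightarrow> smooth (\<lambda>x. (f x, g x))"
  by (simp add: smooth_def Ck_Pair)

lemma compose_has_derivative:
  assumes "smooth f" "smooth \<phi>"
  shows "((\<lambda>x. f (\<phi> x)) has_derivative (\<lambda>u. dd (dd u \<phi> x) f (\<phi> x))) (at x)"
  by (rule has_derivative_compose[OF smooth_has_derivative[OF assms(2)] smooth_has_derivative[OF assms(1)]])

lemma smooth_compose: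
  fixes f :: "'b::euclidean_space \<Rightarrow> real" and \<phi> :: "'a::real_normed_vector \<Rightarrow> 'b"
  assumes f: "smooth f" and \<phi>: "smooth \<phi>"
  shows "smooth (\<lambda>x. f (\<phi> x))"
proof -
  have "smooth f \<Longrightarrow> Ck k (\<lambda>x. f (\<phi> x))" for k f
  proof (induction k arbitrary: f)
    case 0
    show ?case unfolding Ck.simps
      by (rule continuous_on_compose2[OF smooth_continuous[OF 0, of UNIV] smooth_continuous[OF \<phi>]]) simp
  next
    case (Suc k)
    have "smooth (\<lambda>x. dd u \<phi> x \<bullet> b)" for u b by (intro smooth_inner smooth_dd \<phi>)
    then have summand: "Ck k (\<lambda>x. (dd u \<phi> x \<bullet> b) *\<^sub>R dd b f (\<phi> x))" for u b
      by (intro Ck_bilinear[OF bounded_bilinear_scaleR] Suc.IH smooth_dd Suc.prems) (simp add: smooth_def)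
    have "finite A \<Longrightarrow> Ck k (\<lambda>x. \<Sum>b\<in>A. (dd u \<phi> x \<bullet> b) *\<^sub>R dd b f (\<phi> x))" for u A
      by (induction A rule: finite_induct) (auto intro: Ck_add Ck_const summand)
    then have "Ck k (\<lambda>x. dd (dd u \<phi> x) f (\<phi> x))" for u
      by (subst dd_Basis[OF Suc.prems]) simp
    then show ?case by (rule Ck_SucI[OF compose_has_derivative[OF Suc.prems \<phi>]])
  qed
  from this[OF f] show ?thesis unfolding smooth_def ..
qed

text \<open>The Leibniz rule asks for the derivative as a continuous family of bounded linear maps; here it is
  assembled from the partial derivatives along a basis.\<close>

lemma parameter_integral_has_derivative:
  fixes F :: "'a::euclidean_space \<times> real \<Rightarrow> real"
  assumes F: "smooth F"
  shows "((\<lambda>p. integral {0..1} (\<lambda>s. F (p, s))) has_derivative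
    (\<lambda>u. integral {0..1} (\<lambda>s. dd (u, 0) F (p, s)))) (at p)"
proof -
  define fx where "fx p s = (\<Sum>b\<in>Basis. dd (b, 0) F (p, s) *\<^sub>R blinfun_inner_left b)" for p s
  have app: "blinfun_apply (fx p s) u = dd (u, 0) F (p, s)" for p s u
  proof -
    have "linear (\<lambda>u. dd (u, 0) F (p, s))"
      by (rule linear_compose[of "\<lambda>u. (u, 0)" "\<lambda>w. dd w F (p, s)", unfolded o_def, OF _ dd_linear[OF F]])
        (auto intro!: linearI)
    from linear_sum[OF this, of "\<lambda>b. (u \<bullet> b) *\<^sub>R b" Basis]
    have "dd (u, 0) F (p, s) = (\<Sum>b\<in>Basis. (u \<bullet> b) * dd (b, 0) F (p, s))"
      by (simp add: euclidean_representation linear_scale[OF \<open>linear _\<close>])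
    then show ?thesis
      by (simp add: fx_def blinfun.sum_left blinfun.scaleR_left inner_commute mult.commute)
  qed
  have cont: "continuous_on UNIV (\<lambda>(p, s). fx p s)"
    unfolding fx_def split_beta
    by (intro continuous_on_sum continuous_on_scaleR continuous_on_const) (simp add: smooth_continuous[OF smooth_dd[OF F]])
  have contF: "continuous_on UNIV (\<lambda>s. F (p, s))" for p
    by (rule continuous_on_compose2[OF smooth_continuous[OF F]]) (auto intro!: continuous_on_Pair)
  have contfx: "continuous_on (cbox 0 1) (fx p)" for p
    using continuous_on_compose2[OF cont, of "cbox 0 1" "\<lambda>s. (p, s)"]
      continuous_on_Pair[OF continuous_on_const[of "cbox 0 1" p] continuous_on_id[of "cbox (0::real) 1"]] by simp
  have "((\<lambda>p. integral (cbox 0 1) (\<lambda>s. F (p, s))) has_derivative integral (cbox 0 1) (fx p)) (at p within UNIV)"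
  proof (rule leibniz_rule)
    fix p s
    have "((\<lambda>p. F (p, s)) has_derivative (\<lambda>u. dd (u, 0) F (p, s))) (at p within UNIV)"
      by (rule has_derivative_compose[OF _ smooth_has_derivative[OF F]])
        (intro has_derivative_Pair has_derivative_ident has_derivative_const)
    then show "((\<lambda>p. F (p, s)) has_derivative blinfun_apply (fx p s)) (at p within UNIV)"
      by (simp add: app[abs_def])
    show "(\<lambda>s. F (p, s)) integrable_on cbox 0 1"
      by (rule integrable_continuous[OF continuous_on_subset[OF contF]]) simp
    show "continuous_on (UNIV \<times> cbox 0 1) (\<lambda>(x, t). fx x t)"
      by (rule continuous_on_subset[OF cont]) simp
  qed auto
  moreover have "blinfun_apply (integral (cbox 0 1) (fx p)) = (\<lambda>u. integral {0..1} (\<lambda>s. dd (u, 0) F (p, s)))"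
  proof
    fix u
    show "blinfun_apply (integral (cbox 0 1) (fx p)) u = integral {0..1} (\<lambda>s. dd (u, 0) F (p, s))"
      using integral_linear[OF integrable_continuous[OF contfx[of p]] blinfun.bounded_linear_left[of u]]
      by (simp add: o_def app cbox_interval)
  qed
  ultimately show ?thesis by (simp add: cbox_interval)
qed


lemma smooth_parameter_integral:
  fixes F :: "'a::euclidean_space \<times> real \<Rightarrow> real"
  assumes "smooth F" shows "smooth (\<lambda>p. integral {0..1} (\<lambda>s. F (p, s)))"
proof -
  define I where "I G p = integral {0..1} (\<lambda>s. G (p, s))" for G :: "'a \<times> real \<Rightarrow> real" and p
  have "smooth (I F)"
  proof (rule smoothI_derivative[where P = "\<lambda>g. \<exists>G. smooth G \<and> g = I G"])
    fix g assume "\<exists>G. smooth G \<and> g = I G"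
    then obtain G where G: "smooth G" and g: "g = I G" by blast
    show "\<exists>f'. (\<forall>x. (g has_derivative f' x) (at x)) \<and> (\<forall>u. \<exists>G. smooth G \<and> (\<lambda>x. f' x u) = I G)"
    proof (intro exI[of _ "\<lambda>p u. I (dd (u, 0) G) p"] conjI allI)
      show "(g has_derivative (\<lambda>u. I (dd (u, 0) G) x)) (at x)" for x
        unfolding g I_def by (rule parameter_integral_has_derivative[OF G])
      show "\<exists>G'. smooth G' \<and> I (dd (u, 0) G) = I G'" for u
        using smooth_dd[OF G] by blast
    qed
  qed (use assms in blast)
  then show ?thesis by (simp add: I_def[abs_def])
qed

text \<open>The integral of \<open>f (x, \<cdot>)\<close> from 0 to \<open>t\<close>. Rescaling to the fixed interval \<open>{0..1}\<close> makes it valid for negative \<open>t\<close> as well and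
  reduces its smoothness to that of an integral depending on a parameter.\<close>

definition time_integral :: "scalar_field \<Rightarrow> scalar_field" where
  "time_integral f p = snd p * integral {0..1} (\<lambda>s. f (fst p, s * snd p))"

abbreviation shift_map :: "spacetime \<times> real \<Rightarrow> spacetime" where
  "shift_map z \<equiv> (fst (fst z), snd z * snd (fst z))"

lemma shift_map_derivative:
  shows "smooth shift_map" and "dd ((a, \<tau>), 0) shift_map (p, s) = (a, s * \<tau>)"
proof -
  have bl: "bounded_linear (\<lambda>z::spacetime \<times> real. fst (fst z))" "bounded_linear (\<lambda>z::spacetime \<times> real. snd z)"
    "bounded_linear (\<lambda>z::spacetime \<times> real. snd (fst z))"
    by (auto intro!: bounded_linear_fst_comp bounded_linear_snd_comp bounded_linear_ident)
  show "smooth shift_map"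
    by (intro smooth_Pair smooth_mult smooth_linear_comp[OF bl(1) smooth_ident]
        smooth_linear_comp[OF bl(2) smooth_ident] smooth_linear_comp[OF bl(3) smooth_ident])
  have "(shift_map has_derivative (\<lambda>u. (fst (fst u), snd (p, s) * snd (fst u) + snd u * snd (fst (p, s))))) (at (p, s))"
    by (intro has_derivative_Pair has_derivative_mult bounded_linear_imp_has_derivative bl)
  from dd_eq[OF this, of "((a, \<tau>), 0)"] show "dd ((a, \<tau>), 0) shift_map (p, s) = (a, s * \<tau>)"
    by simp
qed

lemma dd_average:
  fixes f :: scalar_field
  assumes f: "smooth f"
  shows "dd (a, \<tau>) (\<lambda>p. integral {0..1} (\<lambda>s. f (fst p, s * snd p))) p
    = integral {0..1} (\<lambda>s. dd (a, s * \<tau>) f (fst p, s * snd p))"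
    and "smooth (\<lambda>p. integral {0..1} (\<lambda>s. f (fst p, s * snd p)))"
proof -
  have F: "smooth (\<lambda>z. f (shift_map z))" by (rule smooth_compose[OF f shift_map_derivative(1)])
  have "dd ((a, \<tau>), 0) (\<lambda>z. f (shift_map z)) (p, s) = dd (a, s * \<tau>) f (fst p, s * snd p)" for s
    using dd_eq[OF compose_has_derivative[OF f shift_map_derivative(1)], of "((a, \<tau>), 0)" "(p, s)"]
    by (simp add: shift_map_derivative(2))
  then show "dd (a, \<tau>) (\<lambda>p. integral {0..1} (\<lambda>s. f (fst p, s * snd p))) p
    = integral {0..1} (\<lambda>s. dd (a, s * \<tau>) f (fst p, s * snd p))"
    using dd_eq[OF parameter_integral_has_derivative[OF F], of "(a, \<tau>)" p] by simp
  show "smooth (\<lambda>p. integral {0..1} (\<lambda>s. f (fst p, s * snd p)))"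
    using smooth_parameter_integral[OF F] by simp
qed

lemma smooth_snd: "smooth (snd :: 'a::real_normed_vector \<times> 'b::real_normed_vector \<Rightarrow> 'b)"
  using smooth_linear_comp[OF bounded_linear_snd smooth_ident] by simp

lemma smooth_time_integral: "smooth f \<Longrightarrow> smooth (time_integral f)"
  unfolding time_integral_def[abs_def] by (intro smooth_mult smooth_snd dd_average(2))

lemma dd_time_integral:
  assumes f: "smooth f"
  shows "dd (a, 0) (time_integral f) = time_integral (dd (a, 0) f)"
    and "dd (0, 1) (time_integral f) = f"
    and "time_integral (dd (0, 1) f) (x, t) = f (x, t) - f (x, 0)"
proof -
  have snd: "dd u (snd :: spacetime \<Rightarrow> real) = (\<lambda>p. snd u)" for u
    by (rule dd_eqI) (rule bounded_linear_imp_has_derivative[OF bounded_linear_snd])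
  have prod: "dd u (time_integral f) p
      = snd p * dd u (\<lambda>p. integral {0..1} (\<lambda>s. f (fst p, s * snd p))) p
        + snd u * integral {0..1} (\<lambda>s. f (fst p, s * snd p))" for u p
    unfolding time_integral_def[abs_def] dd_mult[OF smooth_snd dd_average(2)[OF f]] snd ..
  show "dd (a, 0) (time_integral f) = time_integral (dd (a, 0) f)"
    by (simp add: fun_eq_iff prod dd_average(1)[OF f] time_integral_def)
  have along: "((\<lambda>s. f (x, s * t)) has_vector_derivative t * dd (0, 1) f (x, s * t)) (at s)" for x t s
  proof -
    have "((\<lambda>s. f ((x, 0) + s *\<^sub>R (0, t))) has_vector_derivative dd (0, t) f ((x, 0) + s *\<^sub>R (0, t))) (at s)"
      by (rule has_vector_derivative_along[OF f])
    moreover have "dd (0, t) f q = t * dd (0, 1) f q" for q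
      using linear_scale[OF dd_linear[OF f], of t "(0, 1)" q] by simp
    ultimately show ?thesis by simp
  qed
  have c: "continuous_on S (\<lambda>s. g (x, s * t))" if "smooth g" for g :: scalar_field and x t S
    by (rule continuous_on_compose2[OF smooth_continuous[OF that, of UNIV]])
      (auto intro!: continuous_on_Pair continuous_on_mult continuous_on_const continuous_on_id)
  have hi: "((\<lambda>s. t * dd (0, 1) f (x, s * t)) has_integral f (x, 1 * t) - f (x, 0 * t)) {0..1}" for x t
    by (rule fundamental_theorem_of_calculus[OF zero_le_one has_vector_derivative_at_within[OF along]])
  have "integral {0..1} (\<lambda>s. t * dd (0, 1) f (x, s * t)) = f (x, t) - f (x, 0)" for x t
    using integral_unique[OF hi[of t x]] unfolding mult_1 mult_zero_left .
  then show "time_integral (dd (0, 1) f) (x, t) = f (x, t) - f (x, 0)"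
    by (simp add: time_integral_def)
  have "dd (0, 1) (time_integral f) (x, t) = f (x, t)" for x t
  proof -
    have der: "((\<lambda>s. s * f (x, s * t)) has_vector_derivative s * (t * dd (0, 1) f (x, s * t)) + 1 * f (x, s * t)) (at s)" for s
      by (rule has_vector_derivative_mult[OF has_vector_derivative_id along])
    have "((\<lambda>s. s * (t * dd (0, 1) f (x, s * t)) + 1 * f (x, s * t)) has_integral 1 * f (x, 1 * t) - 0 * f (x, 0 * t)) {0..1}"
      by (rule fundamental_theorem_of_calculus[OF zero_le_one has_vector_derivative_at_within[OF der]])
    from integral_unique[OF this] have *: "integral {0..1} (\<lambda>s. s * (t * dd (0, 1) f (x, s * t)) + f (x, s * t)) = f (x, t)"
      unfolding mult_1 mult_zero_left diff_zero .
    have lin: "dd (0, s) f q = s * dd (0, 1) f q" for s q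
      using linear_scale[OF dd_linear[OF f], of s "(0, 1)" q] by simp
    have lin': "(\<lambda>s. dd (0, s) f (x, s * t)) = (\<lambda>s. s * dd (0, 1) f (x, s * t))"
      by (rule ext, rule lin)
    have "dd (0, 1) (time_integral f) (x, t)
        = integral {0..1} (\<lambda>s. t * (s * dd (0, 1) f (x, s * t))) + integral {0..1} (\<lambda>s. f (x, s * t))"
      by (simp add: prod dd_average(1)[OF f] lin')
    also have "\<dots> = integral {0..1} (\<lambda>s. t * (s * dd (0, 1) f (x, s * t)) + f (x, s * t))"
      by (intro integral_add[symmetric] integrable_continuous_interval continuous_on_mult continuous_on_const
          continuous_on_id c f smooth_dd)
    also have "\<dots> = f (x, t)" using * by (simp add: mult.left_commute)
    finally show ?thesis .
  qed
  then show "dd (0, 1) (time_integral f) = f" by (simp add: fun_eq_iff)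
qed

lemma time_integral_sum:
  assumes "\<And>i. i \<in> A \<Longrightarrow> smooth (f i)"
  shows "time_integral (\<lambda>q. \<Sum>i\<in>A. f i q) p = (\<Sum>i\<in>A. time_integral (f i) p)"
proof (cases "finite A")
  case True
  have "(\<lambda>s. f i (fst p, s * snd p)) integrable_on {0..1}" if "i \<in> A" for i
    by (intro integrable_continuous_interval continuous_on_compose2[OF smooth_continuous[OF assms[OF that], of UNIV]])
      (auto intro!: continuous_on_Pair continuous_on_mult continuous_on_const continuous_on_id)
  then show ?thesis
    by (simp add: time_integral_def integral_sum[OF True] sum_distrib_left)
qed (simp add: time_integral_def)

section \<open>The field equations in the moving frame\<close>

lemma dd_sum:
  assumes "\<And>i. i \<in> A \<Longrightarrow> smooth (f i)"
  shows "dd u (\<lambda>x. \<Sum>i\<in>A. f i x) = (\<lambda>x. \<Sum>i\<in>A. dd u (f i) x)"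
  by (rule dd_eqI) (intro has_derivative_sum smooth_has_derivative assms)

lemma dd_cmult: "smooth f \<Longrightarrow> dd u (\<lambda>x. (c::real) * f x) = (\<lambda>x. c * dd u f x)"
  by (rule dd_linear_comp[OF bounded_linear_mult_right])

lemma smooth_cmult: "smooth f \<Longrightarrow> smooth (\<lambda>x. (c::real) * f x)"
  by (rule smooth_linear_comp[OF bounded_linear_mult_right])

lemma smooth_nth: "smooth F \<Longrightarrow> smooth (\<lambda>q. F q $ i)"
  by (rule smooth_linear_comp[OF bounded_linear_vec_nth])

lemma smooth_vec:
  fixes F :: "'a::real_normed_vector \<Rightarrow> real^'n"
  assumes "\<And>i. smooth (\<lambda>q. F q $ i)" shows "smooth F"
proof -
  have "F = (\<lambda>q. \<Sum>i\<in>UNIV. (F q $ i) *\<^sub>R axis i 1)"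
    using basis_expansion[of "F _"] by (simp add: fun_eq_iff scalar_mult_eq_scaleR)
  moreover have "smooth (\<lambda>q. \<Sum>i\<in>UNIV. (F q $ i) *\<^sub>R axis i (1::real))"
    by (intro smooth_sum smooth_scaleR assms smooth_const)
  ultimately show ?thesis by simp
qed

lemma dx_eq_dd: "smooth F \<Longrightarrow> dx i F = dd (axis i 1, 0) F"
proof
  fix p :: spacetime assume F: "smooth F"
  obtain x t where p: "p = (x, t)" by (cases p)
  show "dx i F p = dd (axis i 1, 0) F p"
    using vector_derivative_at[OF has_vector_derivative_along[OF F, of "(x, t)" "(axis i 1, 0)" 0]]
    by (simp add: dx_def p)
qed

lemma dt_eq_dd: "smooth F \<Longrightarrow> dt F = dd (0, 1) F"
proof
  fix p :: spacetime assume F: "smooth F"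
  obtain x t where p: "p = (x, t)" by (cases p)
  show "dt F p = dd (0, 1) F p"
    using vector_derivative_at[OF has_vector_derivative_along[OF F, of "(x, 0)" "(0, 1)" t]]
    by (simp add: dt_def p)
qed

lemma dt_nth: "smooth F \<Longrightarrow> dt F p $ i = dd (0, 1) (\<lambda>q. F q $ i) p"
  by (simp add: dt_eq_dd dd_linear_comp[OF bounded_linear_vec_nth])

lemma divergence_eq_dd: "smooth F \<Longrightarrow> divergence F p = (\<Sum>i\<in>UNIV. dd (axis i 1, 0) (\<lambda>q. F q $ i) p)"
  by (simp add: divergence_def dx_eq_dd smooth_nth)

lemma curl_eq_0_iff:
  assumes "smooth F"
  shows "curl F p = 0 \<longleftrightarrow> (\<forall>i j. dd (axis i 1, 0) (\<lambda>q. F q $ j) p = dd (axis j 1, 0) (\<lambda>q. F q $ i) p)"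
  using assms by (auto simp: curl_def dx_eq_dd smooth_nth vec_eq_iff forall_3 vector_3)

lemma dalembertian_eq_dd:
  "smooth f \<Longrightarrow> dalembertian \<epsilon> \<mu> f p
    = (\<Sum>i\<in>UNIV. dd (axis i 1, 0) (dd (axis i 1, 0) f) p) - \<mu> * \<epsilon> * dd (0, 1) (dd (0, 1) f) p"
  by (simp add: dalembertian_def laplacian_def dx_eq_dd dt_eq_dd smooth_dd)

text \<open>The first-order system that the sources inherit from a curl-free electric field without magnetic
  field: conservation of charge, an irrotational current, and \<open>grad \<rho> + K \<partial>J/\<partial>t = 0\<close>, where \<open>K = 1 / c\<^sup>2\<close>.\<close>

definition irrotational_sources :: "real \<Rightarrow> scalar_field \<Rightarrow> vector_field \<Rightarrow> bool" where
  "irrotational_sources K \<rho> J \<longleftrightarrow> smooth \<rho> \<and> smooth J \<and>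
     (\<forall>p. dd (0, 1) \<rho> p + (\<Sum>i\<in>UNIV. dd (axis i 1, 0) (\<lambda>q. J q $ i) p) = 0) \<and>
     (\<forall>p i j. dd (axis i 1, 0) (\<lambda>q. J q $ j) p = dd (axis j 1, 0) (\<lambda>q. J q $ i) p) \<and>
     (\<forall>p i. dd (axis i 1, 0) \<rho> p + K * dd (0, 1) (\<lambda>q. J q $ i) p = 0)"

lemma irrotational_sourcesD:
  assumes src: "irrotational_sources K \<rho> J"
  shows "(\<lambda>p. \<Sum>i\<in>UNIV. dd (axis i 1, 0) (\<lambda>q. J q $ i) p) = (\<lambda>p. - dd (0, 1) \<rho> p)"
    and "dd (axis i 1, 0) (\<lambda>q. J q $ k) = dd (axis k 1, 0) (\<lambda>q. J q $ i)"
    and "dd (axis i 1, 0) \<rho> = (\<lambda>p. - K * dd (0, 1) (\<lambda>q. J q $ i) p)"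
proof -
  have 1: "dd (0, 1) \<rho> p + (\<Sum>i\<in>UNIV. dd (axis i 1, 0) (\<lambda>q. J q $ i) p) = 0"
    and 2: "dd (axis i 1, 0) (\<lambda>q. J q $ k) p = dd (axis k 1, 0) (\<lambda>q. J q $ i) p"
    and 3: "dd (axis i 1, 0) \<rho> p + K * dd (0, 1) (\<lambda>q. J q $ i) p = 0" for p i k
    using src unfolding irrotational_sources_def by blast+
  show "(\<lambda>p. \<Sum>i\<in>UNIV. dd (axis i 1, 0) (\<lambda>q. J q $ i) p) = (\<lambda>p. - dd (0, 1) \<rho> p)"
  proof
    fix p show "(\<Sum>i\<in>UNIV. dd (axis i 1, 0) (\<lambda>q. J q $ i) p) = - dd (0, 1) \<rho> p"
      using 1[of p] by linarith
  qed
  show "dd (axis i 1, 0) (\<lambda>q. J q $ k) = dd (axis k 1, 0) (\<lambda>q. J q $ i)"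
    by (rule ext) (rule 2)
  show "dd (axis i 1, 0) \<rho> = (\<lambda>p. - K * dd (0, 1) (\<lambda>q. J q $ i) p)"
  proof
    fix p show "dd (axis i 1, 0) \<rho> p = - K * dd (0, 1) (\<lambda>q. J q $ i) p"
      using 3[of i p] by simp
  qed
qed

text \<open>Here \<open>\<rho> = \<epsilon> div E\<close> and \<open>J = - \<epsilon> \<partial>E/\<partial>t\<close> with \<open>curl E = 0\<close>. So
  \<open>grad \<rho> = \<epsilon> grad div E = \<epsilon> \<Delta>E = \<mu> \<epsilon>\<^sup>2 \<partial>\<^sup>2E/\<partial>t\<^sup>2 = - \<mu> \<epsilon> \<partial>J/\<partial>t\<close> by the wave equation.\<close>

lemma irrotational_sources_of_electric_field:
  assumes eps: "\<epsilon> > 0" and mu: "\<mu> > 0" and \<rho>: "smooth \<rho>" and J: "smooth J" and E: "smooth E"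
    and cont: "continuity_equation \<rho> J" and curlJ: "\<forall>p. curl J p = 0"
    and max: "maxwell \<epsilon> \<mu> \<rho> J E B" and waveE: "\<forall>p. dalembertian_vec \<epsilon> \<mu> E p = 0" and B: "\<forall>p. B p = 0"
  shows "irrotational_sources (\<mu> * \<epsilon>) \<rho> J"
proof -
  define e where "e i q = E q $ i" for i q
  have e: "smooth (e i)" for i unfolding e_def using smooth_nth[OF E] by simp
  have B0: "B = (\<lambda>_. 0)" using B by auto
  have dz: "dd u (\<lambda>_. 0 :: real^3) = (\<lambda>_. 0)" for u :: spacetime by (rule dd_eqI) simp
  have dzr: "dd u (\<lambda>_. 0 :: real) = (\<lambda>_. 0)" for u :: spacetime by (rule dd_eqI) simp
  have "curl B p = 0" "dt B p = 0" for p
    by (simp_all add: B0 curl_eq_0_iff[OF smooth_const] dt_eq_dd[OF smooth_const] dz dzr)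
  moreover have "divergence E p = \<rho> p / \<epsilon>" "curl E p = - dt B p"
    "curl B p = \<mu> *\<^sub>R J p + (\<mu> * \<epsilon>) *\<^sub>R dt E p" for p
    using max unfolding maxwell_def by blast+
  ultimately have divE: "divergence E p = \<rho> p / \<epsilon>" and curlE: "curl E p = 0"
    and ampere: "\<mu> *\<^sub>R J p + (\<mu> * \<epsilon>) *\<^sub>R dt E p = 0" for p
    by (simp_all del: split_paired_All)
  have rho: "\<rho> = (\<lambda>p. \<epsilon> * (\<Sum>i\<in>UNIV. dd (axis i 1, 0) (e i) p))"
    using divE eps by (simp add: fun_eq_iff divergence_eq_dd[OF E] e_def[abs_def])
  have Ji: "(\<lambda>q. J q $ i) = (\<lambda>q. - \<epsilon> * dd (0, 1) (e i) q)" for i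
  proof
    fix q
    have "\<mu> * (J q $ i) + (\<mu> * \<epsilon>) * dd (0, 1) (e i) q = 0"
      using arg_cong[OF ampere[of q], of "\<lambda>w. w $ i"] by (simp add: dt_nth[OF E] e_def[abs_def])
    then have "\<mu> * (J q $ i + \<epsilon> * dd (0, 1) (e i) q) = 0" by (simp add: algebra_simps)
    then show "J q $ i = - \<epsilon> * dd (0, 1) (e i) q" using mu by simp
  qed
  have irr: "dd (axis i 1, 0) (e j) = dd (axis j 1, 0) (e i)" for i j
    using curlE by (auto simp: curl_eq_0_iff[OF E] e_def[abs_def] fun_eq_iff)
  have wave: "(\<Sum>j\<in>UNIV. dd (axis j 1, 0) (dd (axis j 1, 0) (e i)) p) = \<mu> * \<epsilon> * dd (0, 1) (dd (0, 1) (e i)) p" for i p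
  proof -
    have "dalembertian \<epsilon> \<mu> (e i) p = 0"
      using arg_cong[OF waveE[rule_format, of p], of "\<lambda>w. w $ i"]
      by (simp add: dalembertian_vec_def e_def[abs_def])
    then show ?thesis by (simp add: dalembertian_eq_dd[OF e])
  qed
  have "dd (axis i 1, 0) \<rho> p + \<mu> * \<epsilon> * dd (0, 1) (\<lambda>q. J q $ i) p = 0" for i p
  proof -
    have "dd (axis i 1, 0) \<rho> p = \<epsilon> * (\<Sum>j\<in>UNIV. dd (axis i 1, 0) (dd (axis j 1, 0) (e j)) p)"
      by (simp add: rho dd_cmult dd_sum smooth_sum smooth_dd e)
    also have "(\<Sum>j\<in>UNIV. dd (axis i 1, 0) (dd (axis j 1, 0) (e j)) p)
        = (\<Sum>j\<in>UNIV. dd (axis j 1, 0) (dd (axis j 1, 0) (e i)) p)"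
      by (rule sum.cong) (simp_all add: dd_commute[OF e, of "(axis i 1, 0)"] irr[of i])
    also have "\<epsilon> * \<dots> = - (\<mu> * \<epsilon> * dd (0, 1) (\<lambda>q. J q $ i) p)"
      unfolding wave Ji dd_cmult[OF smooth_dd[OF e]] by simp
    finally show ?thesis by simp
  qed
  moreover have "\<forall>p i j. dd (axis i 1, 0) (\<lambda>q. J q $ j) p = dd (axis j 1, 0) (\<lambda>q. J q $ i) p"
    using curlJ curl_eq_0_iff[OF J] by blast
  moreover have "\<forall>p. dd (0, 1) \<rho> p + (\<Sum>i\<in>UNIV. dd (axis i 1, 0) (\<lambda>q. J q $ i) p) = 0"
    using cont by (simp add: continuity_equation_def dt_eq_dd[OF \<rho>] divergence_eq_dd[OF J])
  ultimately show ?thesis using \<rho> J by (simp add: irrotational_sources_def)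
qed

lemma lorentz_factor_square:
  assumes "norm v < c"
  shows "(lorentz_factor c v)\<^sup>2 * (1 - (v \<bullet> v) / c\<^sup>2) = 1"
proof -
  have c: "c > 0" using assms norm_ge_zero[of v] by linarith
  have "(norm v)\<^sup>2 < c\<^sup>2" using assms by (intro power_strict_mono) auto
  then have pos: "1 - (norm v)\<^sup>2 / c\<^sup>2 > 0" using c by simp
  then have "(lorentz_factor c v)\<^sup>2 = 1 / (1 - (norm v)\<^sup>2 / c\<^sup>2)"
    unfolding lorentz_factor_def power_divide by simp
  with pos show ?thesis unfolding dot_square_norm by (metis less_irrefl nonzero_divide_eq_eq)
qed

lemma lorentz_inverse_eq:
  "lorentz c (- v) (x, t) =
    (lorentz_factor c v *\<^sub>R (par v x + t *\<^sub>R v) + perp v x, lorentz_factor c v * (t + (v \<bullet> x) / c\<^sup>2))"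
  by (simp add: lorentz_def lorentz_factor_def par_def perp_def)

lemma linear_par: "linear (par v)"
  by (rule linearI) (simp_all add: par_def inner_add_right add_divide_distrib scaleR_add_left)

lemma linear_perp: "linear (perp v)"
  unfolding perp_def[abs_def] by (intro linear_compose_sub linear_par linear_id[unfolded id_def])

lemma linear_lorentz: "linear (lorentz c v)"
proof -
  have "linear (\<lambda>p. (lorentz_factor c v *\<^sub>R (par v (fst p) - snd p *\<^sub>R v) + perp v (fst p),
      lorentz_factor c v * (snd p - (v \<bullet> fst p) / c\<^sup>2)))"
    by (rule linearI)
      (simp_all add: linear_add[OF linear_par] linear_add[OF linear_perp] linear_scale[OF linear_par]
        linear_scale[OF linear_perp] inner_add_right algebra_simps add_divide_distrib)
  then show ?thesis by (simp add: lorentz_def case_prod_unfold)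
qed

text \<open>Lorentz transformations preserve the Minkowski trace of a bilinear form. With \<open>V = (v, 0)\<close>,
  \<open>T = (0, 1)\<close> and the spatial unit vectors \<open>X i\<close>, one has \<open>L T = \<gamma> (V + T)\<close> and \<open>L (X i) = X i + v\<^sub>i W\<close> with a
  vector \<open>W\<close> in the span of \<open>V\<close> and \<open>T\<close> that does not depend on \<open>i\<close>. The difference of the two sides is
  a combination of the values of \<open>\<beta>\<close> on \<open>V\<close> and \<open>T\<close> whose coefficients vanish.\<close>

lemma lorentz_trace:
  fixes \<beta> :: "spacetime \<Rightarrow> spacetime \<Rightarrow> real"
  assumes \<beta>: "bilinear \<beta>" and v: "norm v < c"
  defines "L \<equiv> lorentz c (- v)"
  shows "(\<Sum>i\<in>UNIV. \<beta> (L (axis i 1, 0)) (L (axis i 1, 0))) - \<beta> (L (0, 1)) (L (0, 1)) / c\<^sup>2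
    = (\<Sum>i\<in>UNIV. \<beta> (axis i 1, 0) (axis i 1, 0)) - \<beta> (0, 1) (0, 1) / c\<^sup>2"
proof (cases "v = 0")
  case True
  then have "L p = p" for p
    by (cases p) (simp add: L_def lorentz_def lorentz_factor_def par_def perp_def)
  then show ?thesis by simp
next
  case False
  define \<gamma> where "\<gamma> = lorentz_factor c v"
  define K where "K = 1 / c\<^sup>2"
  define V T :: spacetime where "V = (v, 0)" and "T = (0, 1)"
  define X :: "3 \<Rightarrow> spacetime" where "X i = (axis i 1, 0)" for i
  define n where "n = v \<bullet> v"
  define s where "s = (\<gamma> - 1) / n"
  define W where "W = s *\<^sub>R V + (\<gamma> * K) *\<^sub>R T"
  have n: "n > 0" using False by (simp add: n_def)
  have \<gamma>: "\<gamma>\<^sup>2 * (1 - n * K) = 1"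
    using lorentz_factor_square[OF v] by (simp add: \<gamma>_def n_def K_def)
  have s: "s * n = \<gamma> - 1" using n by (simp add: s_def)
  have LT: "L T = \<gamma> *\<^sub>R (V + T)"
    by (simp add: L_def T_def V_def lorentz_inverse_eq linear_0[OF linear_par] linear_0[OF linear_perp] \<gamma>_def)
  have LX: "L (X i) = X i + (v $ i) *\<^sub>R W" for i
  proof -
    have "par v (axis i 1) = ((v $ i) / n) *\<^sub>R v" by (simp add: par_def inner_axis n_def)
    then show ?thesis
      unfolding L_def X_def W_def V_def T_def lorentz_inverse_eq perp_def \<gamma>_def[symmetric]
      by (simp add: inner_axis K_def s_def algebra_simps diff_divide_distrib)
  qed
  note bil = bilinear_ladd[OF \<beta>] bilinear_radd[OF \<beta>] bilinear_lmul[OF \<beta>] bilinear_rmul[OF \<beta>]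
  have VX: "V = (v $ 1) *\<^sub>R X 1 + (v $ 2) *\<^sub>R X 2 + (v $ 3) *\<^sub>R X 3"
    by (simp add: V_def X_def vec_eq_iff forall_3 axis_def)
  have nn: "n = (v $ 1)\<^sup>2 + (v $ 2)\<^sup>2 + (v $ 3)\<^sup>2"
    by (simp add: n_def inner_vec_def sum_3 power2_eq_square)
  have sum: "(\<Sum>i\<in>UNIV. \<beta> (L (X i)) (L (X i))) = (\<Sum>i\<in>UNIV. \<beta> (X i) (X i)) + \<beta> V W + \<beta> W V + n * \<beta> W W"
  proof -
    have "\<beta> V W = (v $ 1) * \<beta> (X 1) W + (v $ 2) * \<beta> (X 2) W + (v $ 3) * \<beta> (X 3) W"
      "\<beta> W V = (v $ 1) * \<beta> W (X 1) + (v $ 2) * \<beta> W (X 2) + (v $ 3) * \<beta> W (X 3)"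
      unfolding VX by (simp_all add: bil)
    then show ?thesis unfolding LX nn by (simp add: bil sum_3 power2_eq_square algebra_simps)
  qed
  have "\<beta> V W + \<beta> W V + n * \<beta> W W - K * \<beta> (L T) (L T)
     = (2 * s + n * s\<^sup>2 - K * \<gamma>\<^sup>2) * \<beta> V V + (\<gamma> * K * (1 + s * n - \<gamma>)) * (\<beta> V T + \<beta> T V)
       + (n * \<gamma>\<^sup>2 * K\<^sup>2 - K * \<gamma>\<^sup>2) * \<beta> T T"
    unfolding LT W_def by (simp add: bil power2_eq_square algebra_simps)
  moreover have "1 + s * n - \<gamma> = 0" using s by simp
  moreover have "n * \<gamma>\<^sup>2 * K\<^sup>2 - K * \<gamma>\<^sup>2 = - K"
    using \<gamma> by algebra
  moreover have "2 * s + n * s\<^sup>2 - K * \<gamma>\<^sup>2 = 0"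
  proof -
    have "n * (2 * s + n * s\<^sup>2 - K * \<gamma>\<^sup>2) = 0" using \<gamma> s by algebra
    with n show ?thesis by simp
  qed
  ultimately have "\<beta> V W + \<beta> W V + n * \<beta> W W - K * \<beta> (L T) (L T) = - K * \<beta> T T" by simp
  with sum show ?thesis by (simp add: X_def T_def K_def)
qed


text \<open>The one-form \<open>J \<bullet> dx - c\<^sup>2 \<rho> dt\<close>, evaluated on the constant vector field \<open>U\<close>.\<close>

definition charge_form :: "real \<Rightarrow> scalar_field \<Rightarrow> vector_field \<Rightarrow> spacetime \<Rightarrow> spacetime \<Rightarrow> real" where
  "charge_form c \<rho> J U p = J p \<bullet> fst U - c\<^sup>2 * \<rho> p * snd U"

lemma dd_spacetime:
  fixes f :: scalar_field
  assumes "smooth f"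
  shows "dd (a, \<tau>) f p = (\<Sum>i\<in>UNIV. a $ i * dd (axis i 1, 0) f p) + \<tau> * dd (0, 1) f p"
proof -
  have "(a, \<tau>) = (\<Sum>i\<in>UNIV. (a $ i) *\<^sub>R (axis i 1, 0)) + \<tau> *\<^sub>R (0::real^3, 1)"
    by (simp add: sum_3 vec_eq_iff forall_3 axis_def)
  then show ?thesis
    by (simp only: linear_add[OF dd_linear[OF assms]] linear_sum[OF dd_linear[OF assms]]
        linear_scale[OF dd_linear[OF assms]] real_scaleR_def)
qed

lemma charge_form_derivative:
  assumes "smooth \<rho>" "smooth J"
  shows "smooth (charge_form c \<rho> J U)"
    and "dd V (charge_form c \<rho> J (a, \<sigma>)) p
      = (\<Sum>i\<in>UNIV. a $ i * dd V (\<lambda>q. J q $ i) p) - c\<^sup>2 * \<sigma> * dd V \<rho> p"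
    and "bilinear (\<lambda>V U. dd V (charge_form c \<rho> J U) p)"
proof -
  have eq: "charge_form c \<rho> J (a, \<sigma>) = (\<lambda>q. (\<Sum>i\<in>UNIV. a $ i * (J q $ i)) - (c\<^sup>2 * \<sigma>) * \<rho> q)" for a \<sigma>
    by (simp add: fun_eq_iff charge_form_def inner_vec_def mult_ac)
  have s: "smooth (charge_form c \<rho> J U)" for U
    using eq[of "fst U" "snd U"] assms by (simp add: smooth_diff smooth_sum smooth_cmult smooth_nth)
  then show "smooth (charge_form c \<rho> J U)" .
  show d: "dd V (charge_form c \<rho> J (a, \<sigma>)) p
      = (\<Sum>i\<in>UNIV. a $ i * dd V (\<lambda>q. J q $ i) p) - c\<^sup>2 * \<sigma> * dd V \<rho> p" for V a \<sigma>
    unfolding eq using assms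
    by (simp add: dd_diff smooth_sum smooth_cmult smooth_nth dd_sum dd_cmult)
  have "linear (\<lambda>U. dd V (charge_form c \<rho> J U) p)" for V
  proof (rule linearI)
    fix U U' :: spacetime and r :: real
    show "dd V (charge_form c \<rho> J (U + U')) p = dd V (charge_form c \<rho> J U) p + dd V (charge_form c \<rho> J U') p"
      by (cases U; cases U') (simp add: d sum_3 algebra_simps)
    show "dd V (charge_form c \<rho> J (r *\<^sub>R U)) p = r *\<^sub>R dd V (charge_form c \<rho> J U) p"
      by (cases U) (simp add: d sum_3 algebra_simps)
  qed
  then show "bilinear (\<lambda>V U. dd V (charge_form c \<rho> J U) p)"
    unfolding bilinear_def using dd_linear[OF s] by blast
qed

text \<open>The first-order system without reference to coordinates: the one-form is closed and its
  derivative has zero Minkowski trace. In this form its invariance is evident.\<close>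

lemma irrotational_sources_iff:
  assumes c: "c > 0" and \<rho>: "smooth \<rho>" and J: "smooth J"
  shows "irrotational_sources (1 / c\<^sup>2) \<rho> J \<longleftrightarrow>
    (\<forall>p U V. dd U (charge_form c \<rho> J V) p = dd V (charge_form c \<rho> J U) p) \<and>
    (\<forall>p. (\<Sum>i\<in>UNIV. dd (axis i 1, 0) (charge_form c \<rho> J (axis i 1, 0)) p)
       - dd (0, 1) (charge_form c \<rho> J (0, 1)) p / c\<^sup>2 = 0)" (is "?L \<longleftrightarrow> ?closed \<and> ?trace")
proof -
  note d = charge_form_derivative(2)[OF \<rho> J]
  have sp: "dd V (charge_form c \<rho> J (axis i 1, 0)) p = dd V (\<lambda>q. J q $ i) p" for V i p
    unfolding d by (simp add: axis_def if_distrib[of "\<lambda>x. x * _"] cong: if_cong)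
  have tm: "dd V (charge_form c \<rho> J (0, 1)) p = - (c\<^sup>2 * dd V \<rho> p)" for V p
    unfolding d by simp
  have tr: "?trace \<longleftrightarrow> (\<forall>p. dd (0, 1) \<rho> p + (\<Sum>i\<in>UNIV. dd (axis i 1, 0) (\<lambda>q. J q $ i) p) = 0)"
    unfolding sp tm using c by (simp add: add.commute)
  have "?closed \<longleftrightarrow> (\<forall>p i j. dd (axis i 1, 0) (\<lambda>q. J q $ j) p = dd (axis j 1, 0) (\<lambda>q. J q $ i) p) \<and>
     (\<forall>p i. dd (axis i 1, 0) \<rho> p + 1 / c\<^sup>2 * dd (0, 1) (\<lambda>q. J q $ i) p = 0)" (is "_ \<longleftrightarrow> ?B \<and> ?C")
  proof (intro iffI conjI allI)
    assume cl: ?closed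
    fix p :: spacetime and i j :: 3
    show "dd (axis i 1, 0) (\<lambda>q. J q $ j) p = dd (axis j 1, 0) (\<lambda>q. J q $ i) p"
      using cl unfolding sp[symmetric] by blast
    have "dd (axis i 1, 0) (charge_form c \<rho> J (0, 1)) p = dd (0, 1) (charge_form c \<rho> J (axis i 1, 0)) p"
      using cl by blast
    then show "dd (axis i 1, 0) \<rho> p + 1 / c\<^sup>2 * dd (0, 1) (\<lambda>q. J q $ i) p = 0"
      unfolding sp tm using c by (simp add: field_simps)
  next
    assume BC: "?B \<and> ?C"
    then have B: "dd (axis i 1, 0) (\<lambda>q. J q $ j) p = dd (axis j 1, 0) (\<lambda>q. J q $ i) p" for p i j
      by blast
    have C: "c\<^sup>2 * dd (axis i 1, 0) \<rho> p = - dd (0, 1) (\<lambda>q. J q $ i) p" for p i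
    proof -
      have "dd (axis i 1, 0) \<rho> p = - (1 / c\<^sup>2 * dd (0, 1) (\<lambda>q. J q $ i) p)"
        using BC by (simp only: eq_neg_iff_add_eq_0)
      then show ?thesis using c by simp
    qed
    fix p U V :: spacetime
    obtain a \<tau> b \<sigma> where UV: "U = (a, \<tau>)" "V = (b, \<sigma>)" by (cases U; cases V)
    define D where "D i j = dd (axis i 1, 0) (\<lambda>q. J q $ j) p" for i j
    define w where "w i = dd (0, 1) (\<lambda>q. J q $ i) p" for i
    define r where "r = dd (0, 1) \<rho> p"
    have D: "D i j = D j i" for i j unfolding D_def by (rule B)
    have *: "dd (a, \<tau>) (charge_form c \<rho> J (b, \<sigma>)) p
        = (\<Sum>i\<in>UNIV. \<Sum>j\<in>UNIV. b $ i * a $ j * D j i) + \<tau> * (\<Sum>i\<in>UNIV. b $ i * w i)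
          + \<sigma> * (\<Sum>i\<in>UNIV. a $ i * w i) - c\<^sup>2 * \<sigma> * \<tau> * r" for a \<tau> b \<sigma>
    proof -
      have "c\<^sup>2 * \<sigma> * dd (a, \<tau>) \<rho> p = \<sigma> * (\<Sum>i\<in>UNIV. a $ i * (c\<^sup>2 * dd (axis i 1, 0) \<rho> p)) + c\<^sup>2 * \<sigma> * \<tau> * r"
        by (simp add: dd_spacetime[OF \<rho>, of a \<tau>] r_def sum_distrib_left algebra_simps)
      also have "\<dots> = - \<sigma> * (\<Sum>i\<in>UNIV. a $ i * w i) + c\<^sup>2 * \<sigma> * \<tau> * r"
        unfolding C by (simp add: w_def sum_negf)
      finally show ?thesis
        unfolding d dd_spacetime[OF smooth_nth[OF J], of a \<tau>] D_def[symmetric] w_def[symmetric]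
        by (simp add: sum_distrib_left sum.distrib sum_negf distrib_left mult_ac)
    qed
    show "dd U (charge_form c \<rho> J V) p = dd V (charge_form c \<rho> J U) p"
      unfolding UV * by (simp add: sum_3 D[of 2 1] D[of 3 1] D[of 3 2] algebra_simps)
  qed
  then show ?thesis unfolding irrotational_sources_def using \<rho> J tr by blast
qed

text \<open>The transformation rule for charge and current is that of the pullback of the one-form along the
  inverse Lorentz transformation. It uses that the parallel and the perpendicular projection are
  symmetric.\<close>

lemma charge_form_lorentz:
  assumes v: "norm v < c"
  shows "charge_form c (transformed_charge c v \<rho> J) (transformed_current c v \<rho> J) U q
    = charge_form c \<rho> J (lorentz c (- v) U) (lorentz c (- v) q)"
proof -
  have c: "c > 0" using v norm_ge_zero[of v] by linarith
  obtain a \<tau> where U: "U = (a, \<tau>)" by (cases U)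
  define p where "p = lorentz c (- v) q"
  define g where "g = lorentz_factor c v"
  have par_sym: "par v x \<bullet> y = x \<bullet> par v y" for x y
    by (simp add: par_def inner_commute)
  then have perp_sym: "perp v x \<bullet> y = x \<bullet> perp v y" for x y
    by (simp add: perp_def inner_diff_left inner_diff_right)
  have "charge_form c (transformed_charge c v \<rho> J) (transformed_current c v \<rho> J) U q
      = (g *\<^sub>R (par v (J p) - \<rho> p *\<^sub>R v) + perp v (J p)) \<bullet> a - c\<^sup>2 * (g * (\<rho> p - (v \<bullet> J p) / c\<^sup>2)) * \<tau>"
    by (simp add: charge_form_def transformed_charge_def transformed_current_def bij_lorentz(2)[OF v] Let_def
        U p_def g_def)
  also have "\<dots> = J p \<bullet> (g *\<^sub>R (par v a + \<tau> *\<^sub>R v) + perp v a) - c\<^sup>2 * \<rho> p * (g * (\<tau> + (v \<bullet> a) / c\<^sup>2))"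
    using c by (simp add: inner_add_left inner_add_right inner_diff_left par_sym perp_sym
        inner_commute[of "J p" v] field_simps)
  also have "\<dots> = charge_form c \<rho> J (lorentz c (- v) U) p"
    by (simp add: charge_form_def lorentz_inverse_eq U g_def)
  finally show ?thesis by (simp add: p_def)
qed

lemma smooth_transformed:
  assumes v: "norm v < c" and \<rho>: "smooth \<rho>" and J: "smooth J"
  shows "smooth (transformed_charge c v \<rho> J)" "smooth (transformed_current c v \<rho> J)"
proof -
  have L: "bounded_linear (lorentz c (- v))" by (rule linear_conv_bounded_linear[THEN iffD1, OF linear_lorentz])
  have bl: "bounded_linear (par v)" "bounded_linear (perp v)"
    using linear_par linear_perp by (simp_all add: linear_conv_bounded_linear)
  have \<rho>L: "smooth (\<lambda>q. \<rho> (lorentz c (- v) q))" and JL: "smooth (\<lambda>q. J (lorentz c (- v) q))"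
    by (rule smooth_comp_linear[OF L \<rho>], rule smooth_comp_linear[OF L J])
  show "smooth (transformed_current c v \<rho> J)"
    unfolding transformed_current_def bij_lorentz(2)[OF v] Let_def
    by (intro smooth_add smooth_scaleR smooth_diff smooth_const smooth_linear_comp[OF bl(1)]
        smooth_linear_comp[OF bl(2)] \<rho>L JL)
  have "smooth (\<lambda>q. (v \<bullet> J (lorentz c (- v) q)) * (1 / c\<^sup>2))"
    by (intro smooth_mult smooth_const smooth_linear_comp[OF bounded_linear_inner_right] JL)
  then show "smooth (transformed_charge c v \<rho> J)"
    unfolding transformed_charge_def bij_lorentz(2)[OF v] Let_def
    by (intro smooth_cmult smooth_diff \<rho>L) simp
qed

lemma irrotational_sources_lorentz:
  assumes v: "norm v < c" and src: "irrotational_sources (1 / c\<^sup>2) \<rho> J"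
  shows "irrotational_sources (1 / c\<^sup>2) (transformed_charge c v \<rho> J) (transformed_current c v \<rho> J)"
proof -
  have c: "c > 0" using v norm_ge_zero[of v] by linarith
  have \<rho>: "smooth \<rho>" and J: "smooth J" using src by (auto simp: irrotational_sources_def)
  let ?\<omega> = "charge_form c \<rho> J" and ?L = "lorentz c (- v)"
  let ?\<omega>' = "charge_form c (transformed_charge c v \<rho> J) (transformed_current c v \<rho> J)"
  have L: "bounded_linear ?L" by (rule linear_conv_bounded_linear[THEN iffD1, OF linear_lorentz])
  have pull: "dd V (?\<omega>' U) q = dd (?L V) (?\<omega> (?L U)) (?L q)" for U V q
  proof -
    have "?\<omega>' U = (\<lambda>q. ?\<omega> (?L U) (0 + ?L q))"
      by (rule ext) (simp add: charge_form_lorentz[OF v])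
    then have "dd V (?\<omega>' U) = (\<lambda>q. dd (?L V) (?\<omega> (?L U)) (0 + ?L q))"
      by (simp only: dd_comp_affine[OF L charge_form_derivative(1)[OF \<rho> J]])
    then show ?thesis by simp
  qed
  from src[unfolded irrotational_sources_iff[OF c \<rho> J]]
  have cl: "dd U (?\<omega> V) p = dd V (?\<omega> U) p"
    and tr: "(\<Sum>i\<in>UNIV. dd (axis i 1, 0) (?\<omega> (axis i 1, 0)) p) - dd (0, 1) (?\<omega> (0, 1)) p / c\<^sup>2 = 0" for U V p
    by blast+
  show ?thesis
    unfolding irrotational_sources_iff[OF c smooth_transformed[OF v \<rho> J]] pull
  proof (intro conjI allI)
    show "dd (?L U) (?\<omega> (?L V)) (?L p) = dd (?L V) (?\<omega> (?L U)) (?L p)" for U V p by (rule cl)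
    show "(\<Sum>i\<in>UNIV. dd (?L (axis i 1, 0)) (?\<omega> (?L (axis i 1, 0))) (?L p))
        - dd (?L (0, 1)) (?\<omega> (?L (0, 1))) (?L p) / c\<^sup>2 = 0" for p
      by (rule trans[OF lorentz_trace[OF charge_form_derivative(3)[OF \<rho> J, where c = c and p = "?L p"] v] tr])
  qed
qed


text \<open>From the first-order system,
  \<open>\<Delta>\<rho> = - K \<partial>(div J)/\<partial>t = K \<partial>\<^sup>2\<rho>/\<partial>t\<^sup>2\<close>, and
  \<open>\<Delta>J = grad div J = - \<partial>(grad \<rho>)/\<partial>t = K \<partial>\<^sup>2J/\<partial>t\<^sup>2\<close>.\<close>

lemma irrotational_sources_wave:
  assumes src: "irrotational_sources (\<mu> * \<epsilon>) \<rho> J"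
  shows "dalembertian \<epsilon> \<mu> \<rho> p = 0" "dalembertian_vec \<epsilon> \<mu> J p = 0" "curl J p = 0"
proof -
  define j where "j i = (\<lambda>q. J q $ i)" for i
  have \<rho>: "smooth \<rho>" and J: "smooth J" using src by (auto simp: irrotational_sources_def)
  have j: "smooth (j i)" for i unfolding j_def by (rule smooth_nth[OF J])
  have cont: "(\<lambda>p. \<Sum>i\<in>UNIV. dd (axis i 1, 0) (j i) p) = (\<lambda>p. - dd (0, 1) \<rho> p)"
    and irr: "dd (axis i 1, 0) (j k) = dd (axis k 1, 0) (j i)"
    and grad: "dd (axis i 1, 0) \<rho> = (\<lambda>p. - (\<mu> * \<epsilon>) * dd (0, 1) (j i) p)" for i k
    using irrotational_sourcesD[OF src] unfolding j_def by blast+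
  have "dd (axis i 1, 0) (dd (axis i 1, 0) \<rho>) p = - (\<mu> * \<epsilon>) * dd (0, 1) (dd (axis i 1, 0) (j i)) p" for i
    unfolding grad dd_cmult[OF smooth_dd[OF j]] dd_commute[OF j, of "(axis i 1, 0)" "(0, 1)"] ..
  then have "(\<Sum>i\<in>UNIV. dd (axis i 1, 0) (dd (axis i 1, 0) \<rho>) p)
      = - (\<mu> * \<epsilon>) * (\<Sum>i\<in>UNIV. dd (0, 1) (dd (axis i 1, 0) (j i)) p)"
    by (simp only: sum_distrib_left)
  also have "(\<Sum>i\<in>UNIV. dd (0, 1) (dd (axis i 1, 0) (j i)) p) = dd (0, 1) (\<lambda>p. \<Sum>i\<in>UNIV. dd (axis i 1, 0) (j i) p) p"
    by (simp add: dd_sum smooth_dd j)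
  also have "\<dots> = - dd (0, 1) (dd (0, 1) \<rho>) p"
    unfolding cont by (simp add: dd_minus smooth_dd \<rho>)
  finally show "dalembertian \<epsilon> \<mu> \<rho> p = 0" by (simp add: dalembertian_eq_dd[OF \<rho>])
  have "dalembertian \<epsilon> \<mu> (j i) p = 0" for i
  proof -
    have "(\<Sum>k\<in>UNIV. dd (axis k 1, 0) (dd (axis k 1, 0) (j i)) p)
        = (\<Sum>k\<in>UNIV. dd (axis i 1, 0) (dd (axis k 1, 0) (j k)) p)"
      by (intro sum.cong refl) (simp add: irr[of _ i] dd_commute[OF j, of "(axis i 1, 0)"])
    also have "\<dots> = dd (axis i 1, 0) (\<lambda>p. \<Sum>k\<in>UNIV. dd (axis k 1, 0) (j k) p) p"
      by (simp add: dd_sum smooth_dd j)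
    also have "\<dots> = - dd (0, 1) (dd (axis i 1, 0) \<rho>) p"
      unfolding cont by (simp add: dd_minus smooth_dd \<rho> dd_commute[OF \<rho>, of "(axis i 1, 0)"])
    also have "\<dots> = \<mu> * \<epsilon> * dd (0, 1) (dd (0, 1) (j i)) p"
      unfolding grad by (subst dd_cmult) (simp_all add: smooth_dd j)
    finally show ?thesis by (simp add: dalembertian_eq_dd[OF j])
  qed
  then show "dalembertian_vec \<epsilon> \<mu> J p = 0" by (simp add: dalembertian_vec_def vec_eq_iff j_def)
  show "curl J p = 0"
    unfolding curl_eq_0_iff[OF J] by (intro allI fun_cong[OF irr[unfolded j_def]])
qed

lemma lap_eq_sum_axis: "lap (h :: real^3 \<Rightarrow> real) x = (\<Sum>i\<in>UNIV. dd (axis i 1) (dd (axis i 1) h) x)"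
proof -
  have B: "(Basis :: (real^3) set) = range (\<lambda>i. axis i 1)" by (auto simp: Basis_vec_def)
  have inj: "inj (\<lambda>i::3. axis i (1::real))" by (simp add: inj_def axis_eq_axis)
  show ?thesis unfolding lap_def B sum.reindex[OF inj] by simp
qed

text \<open>The field \<open>grad h - (1/\<epsilon>) \<integral> J dt\<close>. Its divergence is \<open>\<rho> / \<epsilon>\<close> because the Poisson equation fixes it at
  time 0 and the continuity equation fixes its time derivative. Its wave equation is
  \<open>\<Delta>E = grad div E = grad \<rho> / \<epsilon> = - \<mu> \<partial>J/\<partial>t = \<mu> \<epsilon> \<partial>\<^sup>2E/\<partial>t\<^sup>2\<close>.\<close>

lemma electric_field_of_irrotational_sources:
  assumes eps: "\<epsilon> > 0" and src: "irrotational_sources (\<mu> * \<epsilon>) \<rho> J"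
  obtains E where "smooth E" "maxwell \<epsilon> \<mu> \<rho> J E (\<lambda>_. 0)" "\<And>p. dalembertian_vec \<epsilon> \<mu> E p = 0"
proof -
  define j where "j i = (\<lambda>q. J q $ i)" for i
  have \<rho>: "smooth \<rho>" and J: "smooth J" using src by (auto simp: irrotational_sources_def)
  have j: "smooth (j i)" for i unfolding j_def by (rule smooth_nth[OF J])
  have cont: "(\<lambda>p. \<Sum>i\<in>UNIV. dd (axis i 1, 0) (j i) p) = (\<lambda>p. - dd (0, 1) \<rho> p)"
    and irr: "dd (axis i 1, 0) (j k) = dd (axis k 1, 0) (j i)"
    and grad: "dd (axis i 1, 0) \<rho> = (\<lambda>p. - (\<mu> * \<epsilon>) * dd (0, 1) (j i) p)" for i k
    using irrotational_sourcesD[OF src] unfolding j_def by blast+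
  have bl: "bounded_linear (\<lambda>x::real^3. (x, 0::real))"
    by (intro bounded_linear_Pair bounded_linear_ident bounded_linear_zero)
  have "smooth (\<lambda>x. 1 / \<epsilon> * \<rho> (x, 0))"
    by (intro smooth_cmult smooth_comp_linear[OF bl] \<rho>)
  then obtain h where h: "smooth h" and lap_h: "lap h = (\<lambda>x. 1 / \<epsilon> * \<rho> (x, 0))"
    by (rule poisson_solvable)
  define e where "e i p = dd (axis i 1) h (fst p) - 1 / \<epsilon> * time_integral (j i) p" for i and p :: spacetime
  have base: "smooth (\<lambda>p::spacetime. f (fst p))" "dd (a, \<tau>) (\<lambda>p::spacetime. f (fst p)) = (\<lambda>p. dd a f (fst p))"
    if "smooth f" for f :: "real^3 \<Rightarrow> real" and a \<tau>
    using smooth_comp_linear[OF bounded_linear_fst that] dd_comp_affine[OF bounded_linear_fst that, of "(a, \<tau>)" 0]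
    by auto
  note s = base(1) smooth_dd h smooth_cmult smooth_time_integral j
  have e: "smooth (e i)" for i unfolding e_def by (intro smooth_diff s)
  have dde: "dd (a, \<tau>) (e i) p = dd a (dd (axis i 1) h) (fst p) - 1 / \<epsilon> * dd (a, \<tau>) (time_integral (j i)) p" for a \<tau> i p
    unfolding e_def by (subst dd_diff, intro s, intro s, subst base(2), intro s, subst dd_cmult, intro s, rule refl)
  have zero: "dd 0 f x = 0" if "smooth f" for f :: "real^3 \<Rightarrow> real" and x
    using linear_0[OF dd_linear[OF that]] .
  have et: "dd (0, 1) (e i) p = - 1 / \<epsilon> * j i p" for i p
    by (simp add: dde zero smooth_dd h dd_time_integral(2)[OF j])
  have irr_e: "dd (axis i 1, 0) (e k) = dd (axis k 1, 0) (e i)" for i k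
    by (simp add: fun_eq_iff dde dd_time_integral(1)[OF j] irr[of i k] dd_commute[OF h, of "axis i 1"])
  have div_e: "(\<Sum>i\<in>UNIV. dd (axis i 1, 0) (e i) p) = \<rho> p / \<epsilon>" for p
  proof -
    obtain x t where p: "p = (x, t)" by (cases p)
    have "(\<Sum>i\<in>UNIV. dd (axis i 1, 0) (e i) p)
        = lap h x - 1 / \<epsilon> * (\<Sum>i\<in>UNIV. time_integral (dd (axis i 1, 0) (j i)) p)"
      by (simp add: dde p dd_time_integral(1)[OF j] sum_subtractf sum_distrib_left lap_eq_sum_axis)
    also have "(\<Sum>i\<in>UNIV. time_integral (dd (axis i 1, 0) (j i)) p)
        = time_integral (\<lambda>q. \<Sum>i\<in>UNIV. dd (axis i 1, 0) (j i) q) p"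
      by (rule time_integral_sum[symmetric]) (intro smooth_dd j)
    also have "\<dots> = - time_integral (dd (0, 1) \<rho>) p"
      unfolding cont by (simp add: time_integral_def)
    also have "\<dots> = \<rho> (x, 0) - \<rho> (x, t)"
      by (simp add: p dd_time_integral(3)[OF \<rho>])
    finally show ?thesis by (simp add: lap_h p right_diff_distrib)
  qed
  define E where "E p = (\<chi> i. e i p)" for p
  have Ei: "(\<lambda>q. E q $ i) = e i" for i by (simp add: E_def)
  have E: "smooth E" by (rule smooth_vec) (simp add: Ei e)
  have dz: "dd u (\<lambda>_. 0 :: real^3) = (\<lambda>_. 0)" for u :: spacetime by (rule dd_eqI) simp
  have dzr: "dd u (\<lambda>_. 0 :: real) = (\<lambda>_. 0)" for u :: spacetime by (rule dd_eqI) simp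
  have max: "maxwell \<epsilon> \<mu> \<rho> J E (\<lambda>_. 0)"
    unfolding maxwell_def
  proof (intro conjI allI)
    fix p
    show "divergence E p = \<rho> p / \<epsilon>" by (simp add: divergence_eq_dd[OF E] Ei div_e)
    show "divergence (\<lambda>_. 0) p = 0" by (simp add: divergence_eq_dd[OF smooth_const] dzr)
    have "curl E p = 0" unfolding curl_eq_0_iff[OF E] Ei using irr_e by metis
    then show "curl E p = - dt (\<lambda>_. 0) p" by (simp add: dt_eq_dd[OF smooth_const] dz)
    have "\<mu> *\<^sub>R J p + (\<mu> * \<epsilon>) *\<^sub>R dt E p = 0"
      using eps by (simp add: vec_eq_iff dt_nth[OF E] Ei et j_def)
    moreover have "curl (\<lambda>_. 0) p = 0"
      unfolding curl_eq_0_iff[OF smooth_const] by (simp add: dzr)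
    ultimately show "curl (\<lambda>_. 0) p = \<mu> *\<^sub>R J p + (\<mu> * \<epsilon>) *\<^sub>R dt E p" by simp
  qed
  have "dalembertian \<epsilon> \<mu> (e i) p = 0" for i p
  proof -
    have "(\<Sum>k\<in>UNIV. dd (axis k 1, 0) (dd (axis k 1, 0) (e i)) p)
        = (\<Sum>k\<in>UNIV. dd (axis i 1, 0) (dd (axis k 1, 0) (e k)) p)"
      by (intro sum.cong refl) (simp add: irr_e[of _ i] dd_commute[OF e, of "(axis i 1, 0)"])
    also have "\<dots> = dd (axis i 1, 0) (\<lambda>p. \<Sum>k\<in>UNIV. dd (axis k 1, 0) (e k) p) p"
      by (simp add: dd_sum smooth_dd e)
    also have "(\<lambda>p. \<Sum>k\<in>UNIV. dd (axis k 1, 0) (e k) p) = (\<lambda>p. 1 / \<epsilon> * \<rho> p)"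
      by (simp add: div_e fun_eq_iff)
    also have "dd (axis i 1, 0) (\<lambda>p. 1 / \<epsilon> * \<rho> p) p = - \<mu> * dd (0, 1) (j i) p"
      unfolding dd_cmult[OF \<rho>] grad using eps by simp
    also have "dd (0, 1) (dd (0, 1) (e i)) p = - 1 / \<epsilon> * dd (0, 1) (j i) p"
    proof -
      have "dd (0, 1) (e i) = (\<lambda>p. - 1 / \<epsilon> * j i p)" by (rule ext) (rule et)
      then show ?thesis by (simp only: dd_cmult[OF j])
    qed
    then have "- \<mu> * dd (0, 1) (j i) p = \<mu> * \<epsilon> * dd (0, 1) (dd (0, 1) (e i)) p" using eps by simp
    finally show ?thesis by (simp add: dalembertian_eq_dd[OF e])
  qed
  then have "dalembertian_vec \<epsilon> \<mu> E p = 0" for p by (simp add: dalembertian_vec_def vec_eq_iff Ei)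
  with E max show ?thesis using that by blast
qed

theorem lemma2p5:
  fixes \<epsilon>\<^sub>0 \<mu>\<^sub>0 c :: real
    and \<rho> \<rho>' :: scalar_field
    and J E B J' :: vector_field
    and v :: "real^3"
  assumes "\<epsilon>\<^sub>0 > 0" and "\<mu>\<^sub>0 > 0"
    and c: "c = light_speed \<epsilon>\<^sub>0 \<mu>\<^sub>0"
    and "smooth \<rho>" and "smooth J" and "smooth E" and "smooth B"
    and "continuity_equation \<rho> J"
    and "\<forall>p. dalembertian_vec \<epsilon>\<^sub>0 \<mu>\<^sub>0 J p = 0"
    and "\<forall>p. curl J p = 0"
    and "maxwell \<epsilon>\<^sub>0 \<mu>\<^sub>0 \<rho> J E B"
    and "\<forall>p. dalembertian_vec \<epsilon>\<^sub>0 \<mu>\<^sub>0 E p = 0"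
    and "\<forall>p. B p = 0"
    and "norm v < c"
    and "\<rho>' = transformed_charge c v \<rho> J"
    and "J' = transformed_current c v \<rho> J"
  shows "(\<exists>E' B' :: vector_field.
            smooth E' \<and> smooth B' \<and>
            maxwell \<epsilon>\<^sub>0 \<mu>\<^sub>0 \<rho>' J' E' B' \<and>
            (\<forall>q. dalembertian_vec \<epsilon>\<^sub>0 \<mu>\<^sub>0 E' q = 0) \<and>
            (\<forall>q. B' q = 0) \<and>
            (\<forall>q. cross3 (E' q) (B' q) = 0)) \<and>
         smooth \<rho>' \<and> smooth J' \<and>
         (\<forall>q. dalembertian \<epsilon>\<^sub>0 \<mu>\<^sub>0 \<rho>' q = 0) \<and>
         (\<forall>q. dalembertian_vec \<epsilon>\<^sub>0 \<mu>\<^sub>0 J' q = 0) \<and>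
         (\<forall>q. curl J' q = 0)"
proof -
  have K: "1 / c\<^sup>2 = \<mu>\<^sub>0 * \<epsilon>\<^sub>0"
    using assms(1,2) by (simp add: c light_speed_def power_divide)
  have "irrotational_sources (\<mu>\<^sub>0 * \<epsilon>\<^sub>0) \<rho> J"
    by (rule irrotational_sources_of_electric_field) (fact assms)+
  then have src: "irrotational_sources (\<mu>\<^sub>0 * \<epsilon>\<^sub>0) \<rho>' J'"
    using irrotational_sources_lorentz[OF \<open>norm v < c\<close>, of \<rho> J] K assms(15,16) by simp
  obtain E' where E': "smooth E'" "maxwell \<epsilon>\<^sub>0 \<mu>\<^sub>0 \<rho>' J' E' (\<lambda>_. 0)"
    "\<And>q. dalembertian_vec \<epsilon>\<^sub>0 \<mu>\<^sub>0 E' q = 0"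
    using electric_field_of_irrotational_sources[OF \<open>\<epsilon>\<^sub>0 > 0\<close> src] by blast
  have "\<exists>E' B' :: vector_field. smooth E' \<and> smooth B' \<and> maxwell \<epsilon>\<^sub>0 \<mu>\<^sub>0 \<rho>' J' E' B' \<and>
      (\<forall>q. dalembertian_vec \<epsilon>\<^sub>0 \<mu>\<^sub>0 E' q = 0) \<and> (\<forall>q. B' q = 0) \<and> (\<forall>q. cross3 (E' q) (B' q) = 0)"
    using E' by (intro exI[of _ E'] exI[of _ "\<lambda>_. 0"]) (simp add: smooth_const)
  moreover have "smooth \<rho>'" "smooth J'" using src by (auto simp: irrotational_sources_def)
  ultimately show ?thesis using irrotational_sources_wave[OF src] by blast
qed

end
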